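(* Let $\chi$ be a quadratic Dirichlet character of conductor $d$, and let $\eta\in\{-1,1\}$. Then, as $x\to\infty$, \[ \frac{\#\{ pq\leq x:\ \chi(p)=\chi(q)=\eta\}}{\frac 14 \#\{ pq\leq x:\ (pq,d)=1\}} = 1+\eta\, \frac{\mathcal{L}_\chi +o(1)}{\log\log x}, \qquad \text{where} \quad \mathcal{L}_\chi := \sum_{p} \frac{\chi(p)}{p}. \]
   Context: Throughout, $p$ and $q$ denote prime numbers. The notation $\#\{pq\le x:\ \text{condition}\}$ denotes the number of integers $n\le x$ of the form $n=pq$ with $p,q$ primes (not necessarily distinct) satisfying the stated condition. The sum $\mathcal{L}_\chi=\sum_p \chi(p)/p$ runs over all primes $p$ in increasing order (it converges). The $o(1)$ term tends to $0$ as $x\to\infty$ (for fixed $\chi$). *)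

theory Defs
  imports Complex_Main "HOL-Computational_Algebra.Primes"
begin

definition dirichlet_character :: "nat \<Rightarrow> (int \<Rightarrow> complex) \<Rightarrow> bool" where
  "dirichlet_character m \<chi> \<longleftrightarrow>
     m > 0 \<and>
     (\<forall>a b. \<chi> (a * b) = \<chi> a * \<chi> b) \<and>
     (\<forall>a. \<chi> (a + int m) = \<chi> a) \<and>
     (\<forall>a. \<chi> a \<noteq> 0 \<longleftrightarrow> coprime a (int m))"

definition principal_character :: "nat \<Rightarrow> int \<Rightarrow> complex" where
  "principal_character m a = (if coprime a (int m) then 1 else 0)"

text \<open>Quadratic means of order exactly two in the group of characters modulo \<open>m\<close>.\<close>

definition quadratic_character :: "nat \<Rightarrow> (int \<Rightarrow> complex) \<Rightarrow> bool" where
  "quadratic_character m \<chi> \<longleftrightarrow>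
     dirichlet_character m \<chi> \<and>
     \<chi> \<noteq> principal_character m \<and>
     (\<lambda>a. \<chi> a ^ 2) = principal_character m"

text \<open>The conductor of a character \<open>\<chi>\<close> modulo \<open>m\<close> is the least divisor \<open>f\<close> of \<open>m\<close> such that
  \<open>\<chi>\<close> is induced by a character modulo \<open>f\<close>.\<close>

definition conductor :: "nat \<Rightarrow> (int \<Rightarrow> complex) \<Rightarrow> nat" where
  "conductor m \<chi> =
     (LEAST f. f > 0 \<and> f dvd m \<and>
        (\<exists>\<psi>. dirichlet_character f \<psi> \<and> (\<forall>a. coprime a (int m) \<longrightarrow> \<chi> a = \<psi> a)))"

text \<open>The number of integers \<open>n \<le> x\<close> (not of pairs) having the form \<open>n = p q\<close>, with possibly
  equal primes \<open>p\<close> and \<open>q\<close> satisfying \<open>P p q\<close>.\<close>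

definition count_pq :: "real \<Rightarrow> (nat \<Rightarrow> nat \<Rightarrow> bool) \<Rightarrow> nat" where
  "count_pq x P =
     card {n :: nat. real n \<le> x \<and> (\<exists>p q. prime p \<and> prime q \<and> n = p * q \<and> P p q)}"

text \<open>The series over the primes converges only conditionally; \<open>suminf\<close> over \<open>nat\<close> takes the
  primes in increasing order.\<close>

definition prime_sum :: "(int \<Rightarrow> complex) \<Rightarrow> complex" where
  "prime_sum \<chi> = (\<Sum>n::nat. if prime n then \<chi> (int n) / of_nat n else 0)"

end

theory Submission
  imports Defs "HOL-Complex_Analysis.Complex_Analysis" "HOL-Number_Theory.Prime_Powers"
    "HOL-Probability.Sinc_Integral" "HOL-Real_Asymp.Real_Asymp"
begin

text \<open>
  For a prime \<open>p\<close> not dividing \<open>d\<close>, the indicator of \<open>\<chi> p = \<eta>\<close> is \<open>(1 + \<eta> \<chi> p) / 2\<close>. Expanding the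
  product over ordered pairs \<open>p q \<le> x\<close>, four times the count is the number of coprime pairs plus
  \<open>2 \<eta> \<Sum> \<chi> p\<close> plus \<open>\<Sum> \<chi> (p q)\<close>, so it suffices that the first sum is \<open>(L + o(1)) x / ln x\<close>, the
  second \<open>o(x / ln x)\<close>, and the number of coprime pairs \<open>\<sim> 2 x ln ln x / ln x\<close>. By the hyperbola
  method all three follow from the prime number theorem and its analogue
  \<open>\<Sum> \<chi> p = O(x / (ln x) powr (1 + \<epsilon>))\<close> over \<open>p \<le> x\<close>; some \<open>\<epsilon> > 0\<close> is essential here, because the sum over the small
  prime costs a factor \<open>ln ln x\<close>.

  Such a saving comes from polynomial bounds on the line \<open>Re s = 1\<close>. The 3-4-1 inequality is used
  quantitatively to bound \<open>\<zeta>\<close> and \<open>L\<close> from below by \<open>(1 + \<bar>t\<bar>)\<close> to the power \<open>-4\<close>, uniformly for \<open>Re s > 1\<close>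
  (near \<open>s = 1\<close> one needs \<open>L(1) \<noteq> 0\<close>), hence \<open>L'/L\<close> and its derivative grow at most polynomially in
  the height. Perron's formula then bounds the Riesz means of order 11 of \<open>\<Lambda> - 1\<close> and of
  \<open>(1 + \<chi>) \<Lambda> - 1\<close>, with a saving of \<open>ln x\<close>, and since these sequences are at least \<open>-1\<close>, passing from
  order \<open>k + 1\<close> to order \<open>k\<close> only halves the exponent of the saving. No analytic continuation
  beyond \<open>Re s > 1\<close> is used.
\<close>

(* HOL-Analysis declares the letter chi as the binder for vectors. *)
unbundle no vec_syntax

section \<open>Dirichlet series\<close>

text \<open>Write V = 1 + |t|. The exponents 4, 10 and 11 are linked. The 3-4-1 inequality gives
  |L|^4 >> (Re s - 1)^3 / V, and L' << V carries this towards the line when the point is shifted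
  right by about V^-5. Hence |L| >> V^-4, L'/L << V^5, and (L'/L)' = L''/L - (L'/L)^2 << V^10.
  Perron's kernel 1/s^12 of order 11 then leaves the integrable 1/(1 + t^2). No contour crosses the
  line Re s = 1. On Re s = 1 + 1/y the bound for the series alone yields only O(exp y); the saving y
  comes from bounding the mean weighted by ln n as well, which is why (L'/L)' is needed. The bounds
  on L, L', L'' are uniform as Re s tends to 1 and replace values on the line. The exponent 1 of the
  saving at order 11 becomes 2^-11 at order 0. The descent requires a lower bound on the sequence;
  nothing bounds \<chi> \<Lambda> below by -1, hence (1 + \<chi>) \<Lambda> - 1. In the main sum the
  weight ln x / ln (x/p) varies with p, while the sum of \<chi>(p)/p is handled as a conditionally
  convergent series, so absolute values are too costly and the monotonicity of the weight is
  used.\<close>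

definition dirichlet_series :: "(nat \<Rightarrow> real) \<Rightarrow> complex \<Rightarrow> complex" where
  "dirichlet_series a s = (\<Sum>n. of_real (a n) * of_nat n powr (-s))"

text \<open>Testing real points suffices because the norm of a term depends only on
  \<open>Re s\<close>. The index 0 contributes nothing, as \<open>0 powr z = 0\<close>, so series
  over \<open>nat\<close> serve as series over the positive integers.\<close>

definition abs_conv :: "(nat \<Rightarrow> real) \<Rightarrow> bool" where
  "abs_conv a \<longleftrightarrow> (\<forall>\<sigma>>1. summable (\<lambda>n. \<bar>a n\<bar> * real n powr (-\<sigma>)))"

lemma norm_dirichlet_term:
  "norm (of_real (a n) * of_nat n powr (-s) :: complex) = \<bar>a n\<bar> * real n powr (-Re s)"
  by (simp add: norm_mult norm_powr_real_powr)

lemma abs_conv_summable_norm: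
  assumes "abs_conv a" "Re s > 1"
  shows "summable (\<lambda>n. norm (of_real (a n) * of_nat n powr (-s) :: complex))"
  using assms by (simp add: norm_dirichlet_term abs_conv_def)

lemma abs_conv_summable:
  assumes "abs_conv a" "Re s > 1"
  shows "summable (\<lambda>n. of_real (a n) * of_nat n powr (-s) :: complex)"
  by (rule summable_norm_cancel) (rule abs_conv_summable_norm[OF assms])

lemma dirichlet_series_sums:
  assumes "abs_conv a" "Re s > 1"
  shows "(\<lambda>n. of_real (a n) * of_nat n powr (-s)) sums dirichlet_series a s"
  unfolding dirichlet_series_def using abs_conv_summable[OF assms] by (rule summable_sums)

lemma abs_conv_mono:
  assumes "abs_conv b" "\<And>n. \<bar>a n\<bar> \<le> \<bar>b n\<bar>"
  shows "abs_conv a"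
  unfolding abs_conv_def
proof safe
  fix \<sigma> :: real assume "\<sigma> > 1"
  then have "summable (\<lambda>n. \<bar>b n\<bar> * real n powr (-\<sigma>))"
    using assms(1) by (simp add: abs_conv_def)
  then show "summable (\<lambda>n. \<bar>a n\<bar> * real n powr (-\<sigma>))"
    by (rule summable_comparison_test') (auto intro!: mult_right_mono assms(2) simp: abs_mult)
qed

lemma abs_conv_const: "abs_conv (\<lambda>_. c)"
  unfolding abs_conv_def by (auto intro!: summable_mult simp: summable_real_powr_iff)

lemma abs_conv_add:
  assumes "abs_conv a" "abs_conv b"
  shows "abs_conv (\<lambda>n. a n + b n)"
  unfolding abs_conv_def
proof safe
  fix \<sigma> :: real assume "\<sigma> > 1"
  then have "summable (\<lambda>n. \<bar>a n\<bar> * real n powr (-\<sigma>) + \<bar>b n\<bar> * real n powr (-\<sigma>))"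
    using assms by (intro summable_add) (simp_all add: abs_conv_def)
  then show "summable (\<lambda>n. \<bar>a n + b n\<bar> * real n powr (-\<sigma>))"
    by (rule summable_comparison_test')
       (auto simp: abs_mult abs_triangle_ineq mult_right_mono simp flip: distrib_right)
qed

lemma abs_conv_diff:
  assumes "abs_conv a" "abs_conv b"
  shows "abs_conv (\<lambda>n. a n - b n)"
proof -
  have "abs_conv (\<lambda>n. - b n)"
    by (rule abs_conv_mono[OF assms(2)]) simp
  from abs_conv_add[OF assms(1) this] show ?thesis by simp
qed

text \<open>The logarithm is absorbed by n^\<delta>, with \<delta> half the distance from \<sigma>
  to 1, so the remaining exponent still exceeds 1.\<close>

lemma abs_conv_ln:
  assumes "abs_conv a"
  shows "abs_conv (\<lambda>n. a n * ln (real n))"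
  unfolding abs_conv_def
proof safe
  fix \<sigma> :: real assume "\<sigma> > 1"
  define \<delta> where "\<delta> = (\<sigma> - 1) / 2"
  have \<delta>: "\<delta> > 0" and 1: "\<sigma> - \<delta> > 1" using \<open>\<sigma> > 1\<close> by (auto simp: \<delta>_def field_simps)
  have s: "summable (\<lambda>n. 1 / \<delta> * (\<bar>a n\<bar> * real n powr (-(\<sigma> - \<delta>))))"
    using assms[unfolded abs_conv_def, rule_format, OF 1] by (intro summable_mult) simp
  show "summable (\<lambda>n. \<bar>a n * ln (real n)\<bar> * real n powr (-\<sigma>))"
  proof (rule summable_comparison_test'[OF s, of 1])
    fix n :: nat assume n: "n \<ge> 1"
    have "ln (real n) \<le> real n powr \<delta> / \<delta>"
      using n \<delta> by (intro ln_powr_bound) auto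
    then have "\<bar>a n\<bar> * ln (real n) * real n powr (-\<sigma>) \<le>
        \<bar>a n\<bar> * (real n powr \<delta> / \<delta>) * real n powr (-\<sigma>)"
      by (intro mult_right_mono mult_left_mono) auto
    also have "\<dots> = 1 / \<delta> * (\<bar>a n\<bar> * real n powr (-(\<sigma> - \<delta>)))"
      by (simp add: powr_add[symmetric] field_simps powr_diff powr_minus)
    finally show "norm (\<bar>a n * ln (real n)\<bar> * real n powr (-\<sigma>)) \<le> 1 / \<delta> * (\<bar>a n\<bar> * real n powr (-(\<sigma> - \<delta>)))"
      using n by (simp add: abs_mult)
  qed
qed

lemma dirichlet_series_add:
  assumes "abs_conv a" "abs_conv b" "Re s > 1"
  shows "dirichlet_series (\<lambda>n. a n + b n) s = dirichlet_series a s + dirichlet_series b s"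
proof -
  have "(\<lambda>n. of_real (a n) * of_nat n powr (-s) + of_real (b n) * of_nat n powr (-s)) sums
          (dirichlet_series a s + dirichlet_series b s)"
    by (intro sums_add dirichlet_series_sums assms)
  then show ?thesis
    unfolding dirichlet_series_def[of "\<lambda>n. a n + b n"] by (simp add: sums_iff algebra_simps)
qed

lemma dirichlet_series_diff:
  assumes "abs_conv a" "abs_conv b" "Re s > 1"
  shows "dirichlet_series (\<lambda>n. a n - b n) s = dirichlet_series a s - dirichlet_series b s"
proof -
  have "(\<lambda>n. of_real (a n) * of_nat n powr (-s) - of_real (b n) * of_nat n powr (-s)) sums
          (dirichlet_series a s - dirichlet_series b s)"
    by (intro sums_diff dirichlet_series_sums assms)
  then show ?thesis
    unfolding dirichlet_series_def[of "\<lambda>n. a n - b n"] by (simp add: sums_iff algebra_simps)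
qed

text \<open>Termwise differentiation is done on the half-plane right of the midpoint between 1 and
  \<open>Re s\<close>; there the differentiated terms are dominated by their absolute values at the
  real point \<sigma>, so the M-test applies.\<close>

lemma has_field_derivative_dirichlet_series:
  assumes a: "abs_conv a" and s: "Re s > 1"
  shows "(dirichlet_series a has_field_derivative
           - dirichlet_series (\<lambda>n. a n * ln (real n)) s) (at s)"
proof -
  define \<sigma> where "\<sigma> = (1 + Re s) / 2"
  have \<sigma>: "\<sigma> > 1" "\<sigma> < Re s" using s by (auto simp: \<sigma>_def field_simps)
  define S where "S = {z. Re z > \<sigma>}"
  let ?f = "\<lambda>n s. of_real (a n) * of_nat n powr (-s) :: complex"
  let ?f' = "\<lambda>n s. - (of_real (a n * ln (real n)) * of_nat n powr (-s)) :: complex"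
  have "open S" unfolding S_def by (rule open_halfspace_Re_gt)
  have 1: "(?f n has_field_derivative ?f' n z) (at z within S)" for n z
  proof (cases "n = 0")
    case False
    have "(?f n has_field_derivative of_real (a n) * (Ln (of_nat n) * of_nat n powr (-z) * (-1))) (at z)"
      using False
      by (intro DERIV_cmult DERIV_chain2[where g = uminus, OF has_field_derivative_powr_right])
         (auto intro!: derivative_eq_intros)
    moreover have "Ln (of_nat n) = of_real (ln (real n))"
      using False Ln_of_real[of "real n"] by simp
    ultimately have "(?f n has_field_derivative ?f' n z) (at z)"
      by (simp add: mult_ac)
    then show ?thesis
      by (rule has_field_derivative_at_within)
  qed auto
  have 2: "convex S" unfolding S_def by (rule convex_halfspace_Re_gt)
  have 3: "uniformly_convergent_on S (\<lambda>n x. \<Sum>i<n. ?f' i x)"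
  proof (rule Weierstrass_m_test')
    show "summable (\<lambda>n. \<bar>a n * ln (real n)\<bar> * real n powr (-\<sigma>))"
      using abs_conv_ln[OF a] \<sigma>(1) by (simp add: abs_conv_def)
    fix n z assume "z \<in> S"
    then have "real n powr (-Re z) \<le> real n powr (-\<sigma>)"
      by (cases "n = 0") (auto simp: S_def intro!: powr_mono)
    then show "norm (?f' n z) \<le> \<bar>a n * ln (real n)\<bar> * real n powr (-\<sigma>)"
      unfolding norm_minus_cancel norm_dirichlet_term[of "\<lambda>n. a n * ln (real n)"]
      by (rule mult_left_mono) simp
  qed
  have 4: "s \<in> S" "s \<in> interior S"
    using \<sigma> \<open>open S\<close> by (auto simp: S_def interior_open)
  have "((\<lambda>s. \<Sum>n. ?f n s) has_field_derivative (\<Sum>n. ?f' n s)) (at s)"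
    by (rule has_field_derivative_series'(2)[OF 2 1 3 4(1) abs_conv_summable[OF a s] 4(2)])
  moreover have "(\<Sum>n. ?f' n s) = - dirichlet_series (\<lambda>n. a n * ln (real n)) s"
    unfolding dirichlet_series_def using abs_conv_summable[OF abs_conv_ln[OF a] s]
    by (rule suminf_minus)
  ultimately show ?thesis
    by (simp add: dirichlet_series_def[abs_def])
qed

text \<open>Absolute summability over pairs permits regrouping by the product of the indices. The
  convolution identity is asked for positive n only, since the term at 0 vanishes whatever
  \<open>c 0\<close> is.\<close>

lemma dirichlet_series_mult:
  assumes a: "abs_conv a" and b: "abs_conv b" and s: "Re s > 1"
    and c: "\<And>n. n > 0 \<Longrightarrow> c n = (\<Sum>d | d dvd n. a d * b (n div d))"
  shows "dirichlet_series c s = dirichlet_series a s * dirichlet_series b s"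
proof -
  let ?A = "{0<..} :: nat set"
  define f where "f n = (of_real (a n) * of_nat n powr (-s) :: complex)" for n
  define g where "g n = (of_real (b n) * of_nat n powr (-s) :: complex)" for n
  have f: "(f has_sum dirichlet_series a s) UNIV"
    using norm_summable_imp_has_sum[OF abs_conv_summable_norm[OF a s] dirichlet_series_sums[OF a s]]
    by (simp add: f_def[abs_def])
  have g: "(g has_sum dirichlet_series b s) UNIV"
    using norm_summable_imp_has_sum[OF abs_conv_summable_norm[OF b s] dirichlet_series_sums[OF b s]]
    by (simp add: g_def[abs_def])
  have fA: "(\<lambda>n. norm (f n)) summable_on UNIV"
    using norm_summable_imp_summable_on[of "\<lambda>n. norm (f n)"] abs_conv_summable_norm[OF a s]
    by (simp add: f_def)
  have gA: "(\<lambda>n. norm (g n)) summable_on UNIV"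
    using norm_summable_imp_summable_on[of "\<lambda>n. norm (g n)"] abs_conv_summable_norm[OF b s]
    by (simp add: g_def)
  have "(\<lambda>x. norm (case x of (m, k) \<Rightarrow> f m * g k)) summable_on (UNIV \<times> UNIV)"
  proof (subst Infinite_Sum.abs_summable_on_Sigma_iff, intro conjI ballI)
    show "(\<lambda>y. norm (case (x, y) of (m, k) \<Rightarrow> f m * g k)) summable_on UNIV" for x
      using summable_on_cmult_right[OF gA, of "norm (f x)"] by (simp add: norm_mult)
    have "(\<Sum>\<^sub>\<infinity>y. norm (case (x, y) of (m, k) \<Rightarrow> f m * g k)) = norm (f x) * (\<Sum>\<^sub>\<infinity>y. norm (g y))" for x
      by (simp add: norm_mult infsum_cmult_right[OF gA])
    then show "(\<lambda>x. norm (\<Sum>\<^sub>\<infinity>y. norm (case (x, y) of (m, k) \<Rightarrow> f m * g k))) summable_on UNIV"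
      using summable_on_cmult_left[OF fA, of "\<bar>\<Sum>\<^sub>\<infinity>y. norm (g y)\<bar>"] by (simp add: abs_mult)
  qed
  then have "(\<lambda>(m,k). f m * g k) summable_on (UNIV \<times> UNIV)"
    by (rule abs_summable_summable)
  then have "((\<lambda>(m,k). f m * g k) has_sum (dirichlet_series a s * dirichlet_series b s)) (UNIV \<times> UNIV)"
    by (intro has_sum_SigmaI[where g = "\<lambda>m. f m * dirichlet_series b s"])
       (auto intro!: has_sum_cmult_right has_sum_cmult_left f g)
  also have "?this \<longleftrightarrow> ((\<lambda>(m,k). f m * g k) has_sum (dirichlet_series a s * dirichlet_series b s)) (?A \<times> ?A)"
    by (intro has_sum_cong_neutral) (auto simp: f_def g_def)
  also have "\<dots> \<longleftrightarrow> ((\<lambda>(n,d). f d * g (n div d)) has_sum (dirichlet_series a s * dirichlet_series b s))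
                    (SIGMA n:?A. {d. d dvd n})"
    by (rule has_sum_reindex_bij_witness[of _ "\<lambda>(n,d). (d, n div d)" "\<lambda>(m,k). (m * k, m)"])
       (auto elim!: dvdE)
  finally have "((\<lambda>n. \<Sum>d | d dvd n. f d * g (n div d)) has_sum (dirichlet_series a s * dirichlet_series b s)) ?A"
    by (rule has_sum_SigmaD) (auto intro!: has_sum_finite)
  also have "?this \<longleftrightarrow> ((\<lambda>n. of_real (c n) * of_nat n powr (-s)) has_sum (dirichlet_series a s * dirichlet_series b s)) UNIV"
  proof (intro has_sum_cong_neutral)
    fix n assume n: "n \<in> ?A \<inter> UNIV"
    have "f d * g (n div d) = of_real (a d * b (n div d)) * of_nat n powr (-s)" if d: "d dvd n" for d
    proof -
      from d obtain k where k: "n = d * k" by (elim dvdE)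
      have "(of_nat n :: complex) powr (-s) = of_nat d powr (-s) * of_nat k powr (-s)"
        using n unfolding k of_nat_mult by (intro powr_times_real) auto
      then show ?thesis using n k by (simp add: f_def g_def)
    qed
    then show "(\<Sum>d | d dvd n. f d * g (n div d)) = of_real (c n) * of_nat n powr (-s)"
      using n c[of n] by (simp add: sum_distrib_right)
  qed (auto simp: not_less)
  finally show ?thesis
    by (auto dest!: has_sum_imp_sums simp: dirichlet_series_def sums_iff)
qed

text \<open>Dominated convergence with the terms at \<sigma> = 2 as majorant. It fixes the
  integration constant when a series is identified with the exponential of its logarithm.\<close>

lemma dirichlet_series_tendsto_at_infinity:
  assumes a: "abs_conv a"
  shows "((\<lambda>\<sigma>. dirichlet_series a (Complex \<sigma> t)) \<longlongrightarrow> of_real (a 1)) at_top"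
proof -
  have lim: "((\<lambda>\<sigma>. of_real (a n) * of_nat n powr (- Complex \<sigma> t)) \<longlongrightarrow>
      (if n = 1 then of_real (a 1) else 0)) at_top" for n
  proof (cases "n \<le> 1")
    case False
    have "((\<lambda>\<sigma>. \<bar>a n\<bar> * real n powr (-\<sigma>)) \<longlongrightarrow> 0) at_top"
      using False by real_asymp
    then show ?thesis using False
      by (auto simp: norm_dirichlet_term intro!: Lim_null_comparison[of _ "\<lambda>\<sigma>. \<bar>a n\<bar> * real n powr (-\<sigma>)"])
  qed (cases n; auto)
  have "eventually (\<lambda>(n,\<sigma>). norm (of_real (a n) * of_nat n powr (- Complex \<sigma> t)) \<le>
        \<bar>a n\<bar> * real n powr (-2)) (at_top \<times>\<^sub>F at_top)"
    unfolding eventually_prod_filter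
  proof (intro exI conjI allI impI)
    show "eventually (\<lambda>n::nat. n > 0) at_top" by (rule eventually_gt_at_top)
    show "eventually (\<lambda>\<sigma>::real. \<sigma> \<ge> 2) at_top" by (rule eventually_ge_at_top)
    fix n :: nat and \<sigma> :: real assume "n > 0" "\<sigma> \<ge> 2"
    then show "case (n, \<sigma>) of (n,\<sigma>) \<Rightarrow> norm (of_real (a n) * of_nat n powr (- Complex \<sigma> t)) \<le>
        \<bar>a n\<bar> * real n powr (-2)"
      unfolding prod.case norm_dirichlet_term by (auto intro!: mult_left_mono powr_mono)
  qed
  moreover have "summable (\<lambda>n. \<bar>a n\<bar> * real n powr (-2))"
    using a by (auto simp: abs_conv_def)
  ultimately have "((\<lambda>\<sigma>. \<Sum>n. of_real (a n) * of_nat n powr (- Complex \<sigma> t)) \<longlongrightarrow>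
       (\<Sum>n. if n = 1 then of_real (a 1) else 0)) at_top"
    using tannerys_theorem[OF lim] by auto
  moreover have "(\<Sum>n. if n = 1 then of_real (a 1) else 0) = (of_real (a 1) :: complex)"
    using sums_single[of 1 "\<lambda>_. of_real (a 1) :: complex"] by (simp add: sums_iff)
  ultimately show ?thesis by (simp add: dirichlet_series_def)
qed

section \<open>Completely multiplicative sign functions\<close>

lemma mangoldt_le_ln: "mangoldt n \<le> ln (real n)"
  by (cases "n = 0") (auto intro: mangoldt_le)

lemma abs_conv_mangoldt: "abs_conv mangoldt"
proof (rule abs_conv_mono)
  show "abs_conv (\<lambda>n. 1 * ln (real n))"
    by (intro abs_conv_ln abs_conv_const)
  show "\<bar>mangoldt n\<bar> \<le> \<bar>1 * ln (real n)\<bar>" for n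
    using mangoldt_le_ln[of n] mangoldt_nonneg[of n] by simp
qed

lemma Re_of_nat_powr:
  assumes "n > 0"
  shows "Re (of_nat n powr (- Complex \<sigma> t)) = real n powr (-\<sigma>) * cos (t * ln (real n))"
proof -
  have "Ln (of_nat n) = of_real (ln (real n))"
    using assms Ln_of_real[of "real n"] by simp
  then have "of_nat n powr (- Complex \<sigma> t) = exp (Complex (- \<sigma> * ln (real n)) (- t * ln (real n)))"
    using assms by (simp add: powr_def complex_eq_iff Re_exp Im_exp)
  then show ?thesis
    using assms by (simp add: Re_exp powr_def)
qed

text \<open>Both the constant 1, whose series is zeta, and the values of a quadratic character fit
  here, so the two are treated together.\<close>

locale sign_character =
  fixes c :: "nat \<Rightarrow> real"
  assumes mult: "c (m * n) = c m * c n"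
    and one: "c 1 = 1"
    and vals: "c n \<in> {-1, 0, 1}"
begin

lemma abs_le_1: "\<bar>c n\<bar> \<le> 1"
  using vals[of n] by auto

lemma abs_conv_char: "abs_conv c"
  by (rule abs_conv_mono[OF abs_conv_const[of 1]]) (use abs_le_1 in auto)

lemma abs_conv_mult_char:
  assumes "abs_conv a"
  shows "abs_conv (\<lambda>n. c n * a n)"
proof (rule abs_conv_mono[OF assms])
  show "\<bar>c n * a n\<bar> \<le> \<bar>a n\<bar>" for n
    unfolding abs_mult using abs_le_1[of n] by (intro mult_left_le_one_le) auto
qed

lemma abs_conv_char_mangoldt: "abs_conv (\<lambda>n. c n * mangoldt n)"
  by (rule abs_conv_mult_char[OF abs_conv_mangoldt])

lemma mult_div: "d dvd n \<Longrightarrow> n > 0 \<Longrightarrow> c d * c (n div d) = c n"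
  by (auto simp: mult[symmetric] elim!: dvdE)

text \<open>This is -L' = (-L'/L) L, the series form of the divisor sum of \<Lambda> being ln. It is
  stated as a product because the nonvanishing of L is derived from it below.\<close>

lemma series_ln_eq:
  assumes s: "Re s > 1"
  shows "dirichlet_series (\<lambda>n. c n * ln (real n)) s =
         dirichlet_series (\<lambda>n. c n * mangoldt n) s * dirichlet_series c s"
proof (rule dirichlet_series_mult[OF abs_conv_char_mangoldt abs_conv_char s])
  fix n :: nat assume n: "n > 0"
  have "(\<Sum>d | d dvd n. c d * mangoldt d * c (n div d)) = (\<Sum>d | d dvd n. c n * mangoldt d)"
    using n by (intro sum.cong) (auto simp flip: mult_div)
  also have "\<dots> = c n * ln (real n)"
    using n mangoldt_sum[of n, where ?'a = real] by (simp flip: sum_distrib_left)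
  finally show "c n * ln (real n) = (\<Sum>d | d dvd n. c d * mangoldt d * c (n div d))" ..
qed

text \<open>The derivative of the preceding identity, L'' = (L'/L) L' + (L'/L)' L, obtained from
  convolutions: in \<open>u\<close> the logarithm sits on the cofactor, in \<open>v\<close> on the
  divisor, and ln d + ln (n/d) = ln n joins them.\<close>

lemma series_ln_square_eq:
  assumes s: "Re s > 1"
  shows "dirichlet_series (\<lambda>n. c n * ln (real n) ^ 2) s =
         dirichlet_series (\<lambda>n. c n * mangoldt n) s * dirichlet_series (\<lambda>n. c n * ln (real n)) s +
         dirichlet_series (\<lambda>n. c n * mangoldt n * ln (real n)) s * dirichlet_series c s"
proof -
  define u where "u n = (\<Sum>d | d dvd n. (c d * mangoldt d) * (c (n div d) * ln (real (n div d))))" for n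
  define v where "v n = (\<Sum>d | d dvd n. (c d * mangoldt d * ln (real d)) * c (n div d))" for n
  have v: "v n = c n * (\<Sum>d | d dvd n. mangoldt d * ln (real d))" if "n > 0" for n
    unfolding v_def sum_distrib_left using that
    by (intro sum.cong) (auto simp flip: mult_div)
  have u: "u n = c n * (\<Sum>d | d dvd n. mangoldt d * (ln (real n) - ln (real d)))" if "n > 0" for n
    unfolding u_def sum_distrib_left
  proof (intro sum.cong refl)
    fix d assume "d \<in> {d. d dvd n}"
    then have d: "d dvd n" by simp
    then have "ln (real (n div d)) = ln (real n) - ln (real d)"
      using that by (auto elim!: dvdE simp: ln_mult)
    then show "c d * mangoldt d * (c (n div d) * ln (real (n div d))) =
        c n * (mangoldt d * (ln (real n) - ln (real d)))"
      unfolding mult_div[OF d that, symmetric] by (simp only: mult_ac)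
  qed
  have uv: "u n + v n = c n * ln (real n) ^ 2" for n
  proof (cases "n = 0")
    case False
    then have "u n + v n = c n * ((\<Sum>d | d dvd n. mangoldt d * (ln (real n) - ln (real d))) +
        (\<Sum>d | d dvd n. mangoldt d * ln (real d)))"
      by (simp add: u v distrib_left)
    also have "\<dots> = c n * ((\<Sum>d | d dvd n. mangoldt d) * ln (real n))"
      unfolding sum.distrib[symmetric] sum_distrib_right by (simp add: algebra_simps)
    finally show ?thesis using False mangoldt_sum[of n, where ?'a = real]
      by (simp add: power2_eq_square)
  qed (auto simp: u_def v_def)
  have ln2: "abs_conv (\<lambda>n. 1 * ln (real n) * ln (real n))"
    by (intro abs_conv_ln abs_conv_const)
  have acv: "abs_conv v"
  proof (rule abs_conv_mono[OF ln2])
    fix n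
    show "\<bar>v n\<bar> \<le> \<bar>1 * ln (real n) * ln (real n)\<bar>"
    proof (cases "n = 0")
      case False
      have "\<bar>v n\<bar> = \<bar>c n\<bar> * \<bar>\<Sum>d | d dvd n. mangoldt d * ln (real d)\<bar>"
        using False by (simp add: v abs_mult)
      also have "\<dots> \<le> 1 * \<bar>\<Sum>d | d dvd n. mangoldt d * ln (real d)\<bar>"
        by (intro mult_right_mono abs_le_1) auto
      also have "\<dots> = (\<Sum>d | d dvd n. mangoldt d * ln (real d))"
        unfolding mult_1 by (intro abs_of_nonneg sum_nonneg mult_nonneg_nonneg mangoldt_nonneg)
          (use False in \<open>auto intro!: Nat.gr0I simp: Suc_le_eq\<close>)
      also have "\<dots> \<le> (\<Sum>d | d dvd n. mangoldt d * ln (real n))"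
      proof (intro sum_mono mult_left_mono mangoldt_nonneg)
        fix d assume "d \<in> {d. d dvd n}"
        then have "0 < d" "d \<le> n" using False by (auto intro!: Nat.gr0I dest: dvd_imp_le)
        then show "ln (real d) \<le> ln (real n)" by simp
      qed
      also have "\<dots> = ln (real n) * ln (real n)"
        using False mangoldt_sum[of n, where ?'a = real] by (simp flip: sum_distrib_right)
      finally show ?thesis by simp
    qed (auto simp: v_def)
  qed
  \<comment> \<open>No separate estimate of \<open>u\<close> is made: it is the difference of the
    known total and \<open>v\<close>.\<close>
  have acu: "abs_conv u"
  proof -
    have "abs_conv (\<lambda>n. c n * (1 * ln (real n) * ln (real n)) - v n)"
      by (intro abs_conv_diff acv abs_conv_mult_char ln2)
    moreover have "(\<lambda>n. c n * (1 * ln (real n) * ln (real n)) - v n) = u"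
      using uv by (auto simp: fun_eq_iff power2_eq_square algebra_simps)
    ultimately show ?thesis by simp
  qed
  have "dirichlet_series (\<lambda>n. c n * ln (real n) ^ 2) s = dirichlet_series u s + dirichlet_series v s"
    using dirichlet_series_add[OF acu acv s] by (simp add: uv)
  also have "dirichlet_series u s =
      dirichlet_series (\<lambda>n. c n * mangoldt n) s * dirichlet_series (\<lambda>n. c n * ln (real n)) s"
    by (rule dirichlet_series_mult[OF abs_conv_char_mangoldt abs_conv_ln[OF abs_conv_char] s])
       (simp add: u_def)
  also have "dirichlet_series v s =
      dirichlet_series (\<lambda>n. c n * mangoldt n * ln (real n)) s * dirichlet_series c s"
    by (rule dirichlet_series_mult[OF abs_conv_ln[OF abs_conv_char_mangoldt] abs_conv_char s])
       (simp add: v_def)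
  finally show ?thesis .
qed

text \<open>A branch of log L without an Euler product: the coefficient at a prime power p^k is
  c(p^k)/k. At n = 1 the quotient is 0 / 0 = 0.\<close>

definition log_series :: "complex \<Rightarrow> complex" where
  "log_series = dirichlet_series (\<lambda>n. c n * (mangoldt n / ln (real n)))"

lemma abs_conv_log: "abs_conv (\<lambda>n. c n * (mangoldt n / ln (real n)))"
proof (rule abs_conv_mult_char, rule abs_conv_mono[OF abs_conv_const[of 1]])
  fix n :: nat
  show "\<bar>mangoldt n / ln (real n)\<bar> \<le> \<bar>1\<bar>"
    using mangoldt_le_ln[of n] mangoldt_nonneg[of n]
    by (cases "n \<le> 1") (auto simp: divide_le_eq le_Suc_eq)
qed

text \<open>The product of L and exp (- log L) has derivative 0 by \<open>series_ln_eq\<close>,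
  hence is constant on the half-plane, and its limit as \<sigma> grows is 1 because only the
  coefficient at n = 1 survives.\<close>

lemma exp_log_series:
  assumes "Re s > 1"
  shows "dirichlet_series c s = exp (log_series s)"
proof -
  let ?S = "{s. Re s > 1}"
  have eq: "(\<lambda>n. c n * (mangoldt n / ln (real n)) * ln (real n)) = (\<lambda>n. c n * mangoldt n)"
  proof
    fix n show "c n * (mangoldt n / ln (real n)) * ln (real n) = c n * mangoldt n"
      by (cases "n \<le> 1") (auto simp: le_Suc_eq)
  qed
  have G: "(log_series has_field_derivative - dirichlet_series (\<lambda>n. c n * mangoldt n) s) (at s)"
    if "Re s > 1" for s
    using has_field_derivative_dirichlet_series[OF abs_conv_log that] by (simp only: log_series_def eq)
  have D: "((\<lambda>s. dirichlet_series c s * exp (- log_series s)) has_field_derivative 0) (at s)"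
    if "Re s > 1" for s
    using that series_ln_eq[OF that]
    by (auto intro!: derivative_eq_intros has_field_derivative_dirichlet_series abs_conv_char G)
  have "\<exists>k. \<forall>s\<in>?S. dirichlet_series c s * exp (- log_series s) = k"
    by (rule has_field_derivative_zero_constant)
       (use D in \<open>auto intro: has_field_derivative_at_within convex_halfspace_Re_gt\<close>)
  then obtain k where k: "\<And>s. Re s > 1 \<Longrightarrow> dirichlet_series c s * exp (- log_series s) = k"
    by auto
  have "((\<lambda>\<sigma>. dirichlet_series c (Complex \<sigma> 0) * exp (- log_series (Complex \<sigma> 0))) \<longlongrightarrow>
      of_real (c 1) * exp (- of_real (c 1 * (mangoldt 1 / ln (real 1))))) at_top"
    unfolding log_series_def
    by (intro tendsto_intros dirichlet_series_tendsto_at_infinity[OF abs_conv_log, of 0] dirichlet_series_tendsto_at_infinity abs_conv_char)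
  then have "((\<lambda>\<sigma>. dirichlet_series c (Complex \<sigma> 0) * exp (- log_series (Complex \<sigma> 0))) \<longlongrightarrow> 1) at_top"
    using one by simp
  moreover have "((\<lambda>\<sigma>. dirichlet_series c (Complex \<sigma> 0) * exp (- log_series (Complex \<sigma> 0))) \<longlongrightarrow> k) at_top"
    by (intro tendsto_eventually eventually_mono[OF eventually_gt_at_top[of 1]] k) simp
  ultimately have "k = 1"
    using tendsto_unique trivial_limit_at_top_linorder by blast
  then show ?thesis
    using k[OF assms] by (simp add: exp_minus field_simps)
qed

lemma series_nonzero:
  assumes "Re s > 1"
  shows "dirichlet_series c s \<noteq> 0"
  using exp_log_series[OF assms] by simp

end

interpretation zeta: sign_character "\<lambda>_. 1"
  by unfold_locales auto

abbreviation zeta_series :: "complex \<Rightarrow> complex" where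
  "zeta_series \<equiv> dirichlet_series (\<lambda>_. 1)"

text \<open>For \<open>c n = 0\<close> the usual trigonometric polynomial becomes \<open>3 + cos (2 \<theta>) \<ge> 0\<close>, so the zeta
  function may be used in place of the series of the principal character.\<close>

lemma (in sign_character) three_four_one:
  assumes "\<sigma> > 1"
  shows "norm (zeta_series (Complex \<sigma> 0)) ^ 3 * norm (dirichlet_series c (Complex \<sigma> t)) ^ 4 *
           norm (zeta_series (Complex \<sigma> (2 * t))) \<ge> 1"
proof -
  let ?l = "\<lambda>n. mangoldt n / ln (real n)"
  have pos: "?l n * real n powr (-\<sigma>) * (3 + 4 * c n * cos (t * ln (real n)) + cos (2 * t * ln (real n))) \<ge> 0" for n
  proof (cases "n = 0")
    case False
    have "3 + 4 * c n * cos (t * ln (real n)) + cos (2 * t * ln (real n)) =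
        2 * (1 - (c n)\<^sup>2) + 2 * (c n + cos (t * ln (real n)))\<^sup>2"
      using cos_double_cos[of "t * ln (real n)"] by (simp add: power2_eq_square algebra_simps)
    also have "\<dots> \<ge> 0"
      using vals[of n] by auto
    finally show ?thesis using False mangoldt_nonneg[of n] by (intro mult_nonneg_nonneg) auto
  qed auto
  have sm: "(\<lambda>n. b n * Re (of_nat n powr (- Complex \<sigma> u))) sums Re (dirichlet_series b (Complex \<sigma> u))"
    if "abs_conv b" for b u
    using sums_Re[OF dirichlet_series_sums[OF that, of "Complex \<sigma> u"]] assms by simp
  have "(\<lambda>n. 3 * (1 * ?l n * Re (of_nat n powr (- Complex \<sigma> 0))) +
             4 * (c n * ?l n * Re (of_nat n powr (- Complex \<sigma> t))) +
             1 * ?l n * Re (of_nat n powr (- Complex \<sigma> (2 * t)))) sums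
     (3 * Re (zeta.log_series (Complex \<sigma> 0)) + 4 * Re (log_series (Complex \<sigma> t)) +
      Re (zeta.log_series (Complex \<sigma> (2 * t))))"
    unfolding log_series_def zeta.log_series_def
    by (intro sums_add sums_mult sm abs_conv_log zeta.abs_conv_log)
  also have "(\<lambda>n. 3 * (1 * ?l n * Re (of_nat n powr (- Complex \<sigma> 0))) +
             4 * (c n * ?l n * Re (of_nat n powr (- Complex \<sigma> t))) +
             1 * ?l n * Re (of_nat n powr (- Complex \<sigma> (2 * t)))) =
       (\<lambda>n. ?l n * real n powr (-\<sigma>) * (3 + 4 * c n * cos (t * ln (real n)) + cos (2 * t * ln (real n))))"
    (is "?f = ?g")
  proof
    fix n show "?f n = ?g n"
      by (cases "n = 0") (simp_all add: Re_of_nat_powr algebra_simps add_divide_distrib)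
  qed
  finally have "3 * Re (zeta.log_series (Complex \<sigma> 0)) + 4 * Re (log_series (Complex \<sigma> t)) +
      Re (zeta.log_series (Complex \<sigma> (2 * t))) \<ge> 0"
    by (rule sums_le[OF pos sums_zero])
  then have "1 \<le> exp (3 * Re (zeta.log_series (Complex \<sigma> 0)) + 4 * Re (log_series (Complex \<sigma> t)) +
      Re (zeta.log_series (Complex \<sigma> (2 * t))))"
    by simp
  also have "\<dots> = norm (zeta_series (Complex \<sigma> 0)) ^ 3 * norm (dirichlet_series c (Complex \<sigma> t)) ^ 4 *
           norm (zeta_series (Complex \<sigma> (2 * t)))"
    using assms exp_of_nat_mult[of 3 "Re (zeta.log_series (Complex \<sigma> 0))"]
      exp_of_nat_mult[of 4 "Re (log_series (Complex \<sigma> t))"]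
    by (simp add: exp_log_series zeta.exp_log_series exp_add)
  finally show ?thesis .
qed

section \<open>Approximation near the line \<open>Re s = 1\<close>\<close>

definition ln_powr :: "nat \<Rightarrow> complex \<Rightarrow> complex \<Rightarrow> complex" where
  "ln_powr k s w = Ln w ^ k * w powr (-s)"

text \<open>Repeated integration by parts of (ln w)^k w^(-s). No constant is added, so for
  \<open>Re s > 1\<close> it vanishes at infinity, and minus its value at 1 is the polar part k! /
  (s - 1)^(k+1) of the k-th derivative of zeta, up to sign.\<close>

fun ln_powr_primitive :: "nat \<Rightarrow> complex \<Rightarrow> complex \<Rightarrow> complex" where
  "ln_powr_primitive 0 s w = - (w powr (1 - s)) / (s - 1)"
| "ln_powr_primitive (Suc k) s w = - (Ln w ^ Suc k * w powr (1 - s)) / (s - 1) +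
     of_nat (Suc k) / (s - 1) * ln_powr_primitive k s w"

text \<open>A majorant which, times |s|, bounds the derivative of \<open>ln_powr k s\<close> on
  [n, n+1] simultaneously for all k up to 2 and all \<open>Re s > 1\<close>. Its value at n = 0 is 0
  by division by zero.\<close>

definition ln_powr_variation :: "nat \<Rightarrow> real" where
  "ln_powr_variation n = 3 * (1 + ln (real n + 1)) ^ 2 / real n ^ 2"

lemma ln_powr_variation_nonneg: "ln_powr_variation n \<ge> 0"
  by (simp add: ln_powr_variation_def)

lemma summable_ln_powr_variation: "summable ln_powr_variation"
proof (rule summable_comparison_test_bigo)
  show "summable (\<lambda>n. norm (real n powr (-3/2)))"
    by (simp add: summable_real_powr_iff)
  show "ln_powr_variation \<in> O(\<lambda>n. real n powr (-3/2))"
    unfolding ln_powr_variation_def by real_asymp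
qed

lemma has_field_derivative_ln_powr:
  assumes "w \<notin> \<real>\<^sub>\<le>\<^sub>0"
  shows "(ln_powr k s has_field_derivative
           (of_nat k * Ln w ^ (k - 1) - s * Ln w ^ k) * w powr (-s - 1)) (at w)"
proof -
  have "w \<noteq> 0" using assms by auto
  have "((\<lambda>w. Ln w ^ k * w powr (-s)) has_field_derivative
      (of_nat k * (inverse w * Ln w ^ (k - Suc 0))) * w powr (-s) + (-s * w powr (-s - 1)) * Ln w ^ k) (at w)"
    using assms by (intro DERIV_mult has_field_derivative_powr DERIV_power has_field_derivative_Ln) 
  moreover have "w powr (-s) = w powr (-s - 1) * w"
    using \<open>w \<noteq> 0\<close> by (simp add: powr_diff)
  ultimately show ?thesis
    using \<open>w \<noteq> 0\<close> unfolding ln_powr_def[abs_def] by (simp add: field_simps)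
qed

lemma has_field_derivative_ln_powr_primitive:
  assumes "w \<notin> \<real>\<^sub>\<le>\<^sub>0" "s \<noteq> 1"
  shows "(ln_powr_primitive k s has_field_derivative ln_powr k s w) (at w)"
proof (induction k)
  case 0
  have "((\<lambda>w. - (w powr (1 - s)) / (s - 1)) has_field_derivative
      - ((1 - s) * w powr (1 - s - 1)) / (s - 1)) (at w)"
    using assms by (intro DERIV_cdivide DERIV_minus has_field_derivative_powr)
  moreover have "- ((1 - s) * w powr (1 - s - 1)) / (s - 1) = w powr (-s)"
    using assms by (simp add: divide_simps algebra_simps)
  ultimately show ?case
    by (simp add: ln_powr_def)
next
  case (Suc k)
  have "w \<noteq> 0" using assms by auto
  have eq: "w powr (1 - s) = w powr (-s) * w"
    using \<open>w \<noteq> 0\<close> by (simp add: powr_diff powr_minus field_simps)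
  have *: "((\<lambda>w. Ln w ^ Suc k * w powr (1 - s)) has_field_derivative
      (of_nat (Suc k) * (inverse w * Ln w ^ (Suc k - Suc 0))) * w powr (1 - s) +
      ((1 - s) * w powr (1 - s - 1)) * Ln w ^ Suc k) (at w)"
    using assms by (intro DERIV_mult has_field_derivative_powr DERIV_power has_field_derivative_Ln)
  have "((\<lambda>w. - (Ln w ^ Suc k * w powr (1 - s)) / (s - 1) + of_nat (Suc k) / (s - 1) * ln_powr_primitive k s w)
     has_field_derivative
      - ((of_nat (Suc k) * (inverse w * Ln w ^ (Suc k - Suc 0))) * w powr (1 - s) +
      ((1 - s) * w powr (1 - s - 1)) * Ln w ^ Suc k) / (s - 1) + of_nat (Suc k) / (s - 1) * ln_powr k s w) (at w)"
    by (intro DERIV_add DERIV_cdivide DERIV_minus DERIV_cmult * Suc.IH)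
  moreover have "- ((of_nat (Suc k) * (inverse w * Ln w ^ (Suc k - Suc 0))) * w powr (1 - s) +
      ((1 - s) * w powr (1 - s - 1)) * Ln w ^ Suc k) / (s - 1) + of_nat (Suc k) / (s - 1) * ln_powr k s w
      = ln_powr (Suc k) s w"
  proof -
    have "(of_nat (Suc k) * (inverse w * Ln w ^ k)) * (w powr (-s) * w) = of_nat (Suc k) * (Ln w ^ k * w powr (-s))"
      using \<open>w \<noteq> 0\<close> by simp
    then show ?thesis
      unfolding ln_powr_def eq using assms(2)
      by (simp add: divide_simps) (simp add: algebra_simps)
  qed
  ultimately show ?case by simp
qed

lemma ln_powr_primitive_1: "ln_powr_primitive k s 1 = - fact k / (s - 1) ^ Suc k"
  by (induction k) (simp_all add: divide_simps)

lemma tendsto_ln_power_powr_0: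
  assumes "a < 0"
  shows "((\<lambda>n. ln (real n) ^ k * real n powr a) \<longlongrightarrow> 0) sequentially"
proof (rule Lim_null_comparison)
  define d where "d = - a / (2 * (real k + 1))"
  have d: "d > 0" using assms by (simp add: d_def divide_neg_pos)
  show "eventually (\<lambda>n. norm (ln (real n) ^ k * real n powr a) \<le> (1 / d) ^ k * real n powr (a / 2)) sequentially"
    using eventually_ge_at_top[of 1]
  proof eventually_elim
    case (elim n)
    have "ln (real n) ^ k \<le> (real n powr d / d) ^ k"
      using elim d by (intro power_mono ln_powr_bound) auto
    also have "\<dots> = (1 / d) ^ k * real n powr (k * d)"
      using elim by (simp add: power_divide powr_power mult_ac)
    finally have "ln (real n) ^ k * real n powr a \<le> (1 / d) ^ k * real n powr (k * d) * real n powr a"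
      by (intro mult_right_mono) auto
    also have "\<dots> = (1 / d) ^ k * real n powr (k * d + a)"
      by (simp add: powr_add mult.assoc)
    also have "\<dots> \<le> (1 / d) ^ k * real n powr (a / 2)"
    proof -
      have "k * d \<le> - a / 2"
        using assms by (simp add: d_def field_simps)
      then show ?thesis
        using elim d by (intro mult_left_mono powr_mono) auto
    qed
    finally show ?case using elim by simp
  qed
  show "((\<lambda>n. (1 / d) ^ k * real n powr (a / 2)) \<longlongrightarrow> 0) sequentially"
    using assms by real_asymp
qed

lemma tendsto_Ln_power_powr_0:
  assumes "Re z < 0"
  shows "((\<lambda>n. Ln (of_nat n) ^ k * of_nat n powr z) \<longlongrightarrow> 0) sequentially"
proof (rule Lim_null_comparison[OF _ tendsto_ln_power_powr_0[OF assms, of k]])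
  show "eventually (\<lambda>n. norm (Ln (of_nat n) ^ k * of_nat n powr z) \<le> ln (real n) ^ k * real n powr Re z) sequentially"
    using eventually_ge_at_top[of 1]
  proof eventually_elim
    case (elim n)
    have "Ln (of_nat n) = of_real (ln (real n))"
      using elim Ln_of_real[of "real n"] by simp
    then show ?case using elim by (simp add: norm_mult norm_power norm_powr_real_powr)
  qed
qed

lemma ln_powr_tendsto_0:
  assumes "Re s > 1"
  shows "((\<lambda>n. ln_powr k s (of_nat (Suc n))) \<longlongrightarrow> 0) sequentially"
  using tendsto_Ln_power_powr_0[of "-s" k] assms unfolding ln_powr_def 
  by (intro filterlim_compose[OF _ filterlim_Suc, of "\<lambda>n. Ln (of_nat n) ^ k * of_nat n powr (-s)"]) auto

lemma ln_powr_primitive_tendsto_0: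
  assumes "Re s > 1"
  shows "((\<lambda>n. ln_powr_primitive k s (of_nat n)) \<longlongrightarrow> 0) sequentially"
proof (induction k)
  case 0
  have "((\<lambda>n. - (Ln (of_nat n) ^ 0 * of_nat n powr (1 - s)) / (s - 1)) \<longlongrightarrow> - 0 / (s - 1)) sequentially"
    using assms by (intro tendsto_intros tendsto_Ln_power_powr_0) auto
  then show ?case by simp
next
  case (Suc k)
  have "((\<lambda>n. - (Ln (of_nat n) ^ Suc k * of_nat n powr (1 - s)) / (s - 1) +
      of_nat (Suc k) / (s - 1) * ln_powr_primitive k s (of_nat n)) \<longlongrightarrow>
      - 0 / (s - 1) + of_nat (Suc k) / (s - 1) * 0) sequentially"
    using assms by (intro tendsto_intros tendsto_Ln_power_powr_0 Suc.IH) auto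
  then show ?case by simp
qed

lemma norm_ln_powr_deriv_le:
  assumes "1 < Re s" "k \<le> 2" "n \<ge> 1" "real n \<le> x" "x \<le> real n + 1"
  shows "norm ((of_nat k * Ln (of_real x) ^ (k - 1) - s * Ln (of_real x) ^ k) * (of_real x) powr (-s - 1))
           \<le> norm s * ln_powr_variation n"
proof -
  have x: "x \<ge> 1" using assms by linarith
  have Ln: "Ln (of_real x) = of_real (ln x)" using x by (simp add: Ln_of_real)
  define y where "y = 1 + ln (real n + 1)"
  have "ln x \<le> ln (real n + 1)" "ln x \<ge> 0" using assms x by simp_all
  then have y: "1 \<le> y" "ln x \<le> y" "0 \<le> ln x" unfolding y_def by linarith+
  have pw: "ln x ^ j \<le> y ^ 2" if "j \<le> 2" for j
  proof -
    have "ln x ^ j \<le> y ^ j" using y by (intro power_mono) auto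
    also have "\<dots> \<le> y ^ 2" using y that by (intro power_increasing) auto
    finally show ?thesis .
  qed
  have s1: "norm s \<ge> 1" using assms(1) complex_Re_le_cmod[of s] by linarith
  have "norm (of_nat k * Ln (of_real x) ^ (k - 1) - s * Ln (of_real x) ^ k :: complex) \<le>
      norm (of_nat k * Ln (of_real x) ^ (k - 1) :: complex) + norm (s * Ln (of_real x) ^ k)"
    by (rule norm_triangle_ineq4)
  also have "\<dots> = real k * ln x ^ (k - 1) + norm s * ln x ^ k"
    using y by (simp add: Ln norm_mult norm_power)
  also have "\<dots> \<le> real k * y ^ 2 + norm s * y ^ 2"
    using assms(2) by (intro add_mono mult_left_mono pw) auto
  \<comment> \<open>From k \<le> 2 and |s| \<ge> 1; the resulting 2 + 1 is the factor 3 in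
    \<open>ln_powr_variation\<close>.\<close>
  also have "\<dots> \<le> (2 * norm s) * y ^ 2 + norm s * y ^ 2"
    using assms(2) s1 by (intro add_mono mult_right_mono) auto
  finally have A: "norm (of_nat k * Ln (of_real x) ^ (k - 1) - s * Ln (of_real x) ^ k :: complex) \<le> 3 * norm s * y ^ 2"
    by simp
  have "norm ((of_real x :: complex) powr (-s - 1)) = x powr (- Re s - 1)"
    using x by (simp add: norm_powr_real_powr)
  also have "\<dots> \<le> x powr (- 2)"
    using x assms(1) by (intro powr_mono) auto
  also have "\<dots> \<le> real n powr (- 2)"
    using assms by (intro powr_mono2') auto
  also have "\<dots> = 1 / real n ^ 2"
    using assms by (simp add: powr_minus divide_inverse)
  finally have B: "norm ((of_real x :: complex) powr (-s - 1)) \<le> 1 / real n ^ 2" .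
  have "norm ((of_nat k * Ln (of_real x) ^ (k - 1) - s * Ln (of_real x) ^ k) * (of_real x) powr (-s - 1)) \<le>
      3 * norm s * y ^ 2 * (1 / real n ^ 2)"
    unfolding norm_mult by (intro mult_mono A B) auto
  then show ?thesis by (simp add: ln_powr_variation_def y_def mult_ac)
qed

lemma of_real_closed_segment:
  fixes n :: nat
  assumes "w \<in> closed_segment (of_nat n) (of_nat n + 1 :: complex)"
  obtains x where "w = of_real x" "real n \<le> x" "x \<le> real n + 1"
proof -
  from assms obtain u where "0 \<le> u" "u \<le> 1" "w = (1 - u) *\<^sub>R of_nat n + u *\<^sub>R (of_nat n + 1)"
    by (auto simp: in_segment)
  then show ?thesis
    by (intro that[of "real n + u"]) (auto simp: scaleR_conv_of_real algebra_simps)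
qed

lemma segment_not_nonpos:
  fixes n :: nat
  assumes "w \<in> closed_segment (of_nat n) (of_nat n + 1 :: complex)" "n \<ge> 1"
  shows "w \<notin> \<real>\<^sub>\<le>\<^sub>0"
proof -
  obtain x where "w = of_real x" "real n \<le> x" "x \<le> real n + 1"
    using assms(1) by (rule of_real_closed_segment)
  then show ?thesis using assms(2) by (auto simp: complex_nonpos_Reals_iff)
qed

lemma norm_ln_powr_diff_le:
  assumes "1 < Re s" "k \<le> 2" "n \<ge> 1" "w \<in> closed_segment (of_nat n) (of_nat n + 1)"
  shows "norm (ln_powr k s w - ln_powr k s (of_nat n)) \<le> norm s * ln_powr_variation n"
proof -
  let ?S = "closed_segment (of_nat n) (of_nat n + 1 :: complex)"
  have "norm (ln_powr k s w - ln_powr k s (of_nat n)) \<le> norm s * ln_powr_variation n * norm (w - of_nat n)"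
  proof (rule field_differentiable_bound[where S = ?S])
    show "(ln_powr k s has_field_derivative (of_nat k * Ln z ^ (k - 1) - s * Ln z ^ k) * z powr (-s - 1)) (at z within ?S)"
      if "z \<in> ?S" for z
      using segment_not_nonpos[OF that assms(3)]
      by (rule has_field_derivative_at_within[OF has_field_derivative_ln_powr])
    show "norm ((of_nat k * Ln z ^ (k - 1) - s * Ln z ^ k) * z powr (-s - 1)) \<le> norm s * ln_powr_variation n"
      if z: "z \<in> ?S" for z
    proof -
      obtain x where "z = of_real x" "real n \<le> x" "x \<le> real n + 1"
        using z by (rule of_real_closed_segment)
      then show ?thesis using norm_ln_powr_deriv_le[OF assms(1-3)] by blast
    qed
  qed (use assms in auto)
  also have "\<dots> \<le> norm s * ln_powr_variation n * 1"
  proof (intro mult_left_mono mult_nonneg_nonneg ln_powr_variation_nonneg)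
    show "norm (w - of_nat n) \<le> 1"
      using assms(4)
    proof (rule of_real_closed_segment)
      fix x assume x: "w = of_real x" "real n \<le> x" "x \<le> real n + 1"
      then have "w - of_nat n = of_real (x - real n)" by simp
      then show ?thesis using x by (simp only: norm_of_real)
    qed
  qed auto
  finally show ?thesis by simp
qed

lemma norm_ln_powr_primitive_diff_le:
  assumes "1 < Re s" "k \<le> 2" "n \<ge> 1"
  shows "norm (ln_powr_primitive k s (of_nat n + 1) - ln_powr_primitive k s (of_nat n) - ln_powr k s (of_nat n))
           \<le> norm s * ln_powr_variation n"
proof -
  let ?S = "closed_segment (of_nat n) (of_nat n + 1 :: complex)"
  \<comment> \<open>Subtracting a linear function makes the derivative equal to
    \<open>ln_powr k s w\<close> minus its value at n, so the error of replacing an integral by its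
    left endpoint follows from the mean value bound without integrals.\<close>
  let ?g = "\<lambda>w. ln_powr_primitive k s w - ln_powr k s (of_nat n) * w"
  have s: "s \<noteq> 1" using assms(1) by auto
  have "norm (?g (of_nat n + 1) - ?g (of_nat n)) \<le> norm s * ln_powr_variation n * norm ((of_nat n + 1) - of_nat n :: complex)"
  proof (rule field_differentiable_bound[where S = ?S])
    show "(?g has_field_derivative ln_powr k s z - ln_powr k s (of_nat n)) (at z within ?S)"
      if "z \<in> ?S" for z
      using segment_not_nonpos[OF that assms(3)] s
      by (auto intro!: derivative_eq_intros has_field_derivative_at_within[OF has_field_derivative_ln_powr_primitive])
    show "norm (ln_powr k s z - ln_powr k s (of_nat n)) \<le> norm s * ln_powr_variation n"
      if "z \<in> ?S" for z
      using norm_ln_powr_diff_le[OF assms that] .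
  qed (use assms in auto)
  then show ?thesis by (simp add: algebra_simps)
qed

lemma abs_conv_ln_power: "abs_conv c \<Longrightarrow> abs_conv (\<lambda>n. c n * ln (real n) ^ k)"
  by (induction k) (auto simp: mult.assoc[symmetric] power_Suc2 simp del: power_Suc intro!: abs_conv_ln)

lemma dirichlet_series_ln_power_sums:
  assumes "abs_conv c" "Re s > 1"
  shows "(\<lambda>n. of_real (c (Suc n)) * ln_powr k s (of_nat (Suc n))) sums
           dirichlet_series (\<lambda>n. c n * ln (real n) ^ k) s"
proof -
  have "(\<lambda>n. of_real (c (Suc n) * ln (real (Suc n)) ^ k) * of_nat (Suc n) powr (-s)) sums
      dirichlet_series (\<lambda>n. c n * ln (real n) ^ k) s"
    using dirichlet_series_sums[OF abs_conv_ln_power[OF assms(1), of k] assms(2)]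
    by (subst sums_Suc_iff) simp
  moreover have "Ln (of_nat (Suc n)) = complex_of_real (ln (real (Suc n)))" for n
    using Ln_of_real[of "real (Suc n)"] by simp
  ultimately show ?thesis
    unfolding ln_powr_def by (simp add: mult_ac del: of_nat_Suc)
qed

lemma norm_sums_le:
  fixes f :: "nat \<Rightarrow> complex"
  assumes "f sums S" "g \<longlonglongrightarrow> 0" "\<And>N. norm ((\<Sum>n<N. f n) - g N) \<le> B"
  shows "norm S \<le> B"
proof (rule LIMSEQ_le_const2)
  have "(\<lambda>N. (\<Sum>n<N. f n) - g N) \<longlonglongrightarrow> S - 0"
    using assms by (intro tendsto_diff) (auto simp: sums_def)
  then show "(\<lambda>N. norm ((\<Sum>n<N. f n) - g N)) \<longlonglongrightarrow> norm S"
    by (intro tendsto_norm) simp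
qed (use assms(3) in auto)

text \<open>Abel summation against bounded partial sums. The bound does not degenerate as
  \<open>Re s\<close> tends to 1 and is linear in the height, which makes it the substitute for
  continuation to the line.\<close>

theorem norm_dirichlet_series_ln_power_le:
  assumes c: "abs_conv c" and s: "Re s > 1" and k: "k \<le> 2"
    and D: "\<And>N. \<bar>\<Sum>n<N. c (Suc n)\<bar> \<le> D"
  shows "norm (dirichlet_series (\<lambda>n. c n * ln (real n) ^ k) s) \<le> D * suminf ln_powr_variation * norm s"
proof (rule norm_sums_le)
  let ?h = "\<lambda>n. ln_powr k s (of_nat (Suc n))"
  let ?C = "\<lambda>N. \<Sum>n<N. c (Suc n)"
  show "(\<lambda>n. of_real (c (Suc n)) * ?h n) sums dirichlet_series (\<lambda>n. c n * ln (real n) ^ k) s"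
    by (rule dirichlet_series_ln_power_sums[OF c s])
  show "(\<lambda>N. of_real (?C N) * ?h N) \<longlonglongrightarrow> 0"
  proof (rule Lim_null_comparison)
    show "(\<lambda>N. D * norm (?h N)) \<longlonglongrightarrow> 0"
      by (intro tendsto_mult_right_zero tendsto_norm_zero ln_powr_tendsto_0 s)
    show "eventually (\<lambda>N. norm (of_real (?C N) * ?h N) \<le> D * norm (?h N)) sequentially"
      unfolding norm_mult norm_of_real by (intro always_eventually allI mult_right_mono D) auto
  qed
  fix N
  \<comment> \<open>Summation by parts; the subtracted boundary term tends to 0 and is therefore
    removed before the limit is taken.\<close>
  have "(\<Sum>n<N. of_real (c (Suc n)) * ?h n) - of_real (?C N) * ?h N =
      (\<Sum>n<N. of_real (?C (Suc n)) * (?h n - ?h (Suc n)))"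
    by (induction N) (simp_all add: algebra_simps)
  also have "norm \<dots> \<le> (\<Sum>n<N. D * (norm s * ln_powr_variation (Suc n)))"
  proof (rule sum_norm_le)
    fix n
    have "norm (?h n - ?h (Suc n)) \<le> norm s * ln_powr_variation (Suc n)"
      using norm_ln_powr_diff_le[OF s k, of "Suc n" "of_nat (Suc n) + 1"]
      by (simp add: norm_minus_commute add_ac)
    then show "norm (of_real (?C (Suc n)) * (?h n - ?h (Suc n))) \<le> D * (norm s * ln_powr_variation (Suc n))"
      unfolding norm_mult norm_of_real using D[of "Suc n"] by (intro mult_mono) auto
  qed
  also have "\<dots> = D * norm s * (\<Sum>n<N. ln_powr_variation (Suc n))"
    by (simp add: sum_distrib_left mult.assoc)
  also have "\<dots> \<le> D * norm s * suminf ln_powr_variation"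
  proof (rule mult_left_mono)
    have "(\<Sum>n<N. ln_powr_variation (Suc n)) \<le> (\<Sum>n<Suc N. ln_powr_variation n)"
      by (subst sum.lessThan_Suc_shift) (simp add: ln_powr_variation_nonneg)
    also have "\<dots> \<le> suminf ln_powr_variation"
      by (rule sum_le_suminf) (auto simp: summable_ln_powr_variation ln_powr_variation_nonneg)
    finally show "(\<Sum>n<N. ln_powr_variation (Suc n)) \<le> suminf ln_powr_variation" .
    show "D * norm s \<ge> 0" using D[of 0] by simp
  qed
  finally show "norm ((\<Sum>n<N. of_real (c (Suc n)) * ?h n) - of_real (?C N) * ?h N) \<le> D * suminf ln_powr_variation * norm s"
    by (simp add: mult_ac)
qed

text \<open>Each term is compared with the integral over the next unit interval. The integrals
  telescope to minus the primitive at 1, which is exactly the polar part, and the errors sum to a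
  multiple of |s|.\<close>

theorem norm_zeta_ln_power_diff_le:
  assumes s: "Re s > 1" and k: "k \<le> 2"
  shows "norm (dirichlet_series (\<lambda>n. ln (real n) ^ k) s - fact k / (s - 1) ^ Suc k) \<le>
           suminf ln_powr_variation * norm s"
proof (rule norm_sums_le)
  let ?h = "\<lambda>n. ln_powr k s (of_nat (Suc n))"
  let ?H = "\<lambda>n. ln_powr_primitive k s (of_nat (Suc n))"
  have 1: "(\<lambda>n. of_real 1 * ?h n) sums dirichlet_series (\<lambda>n. 1 * ln (real n) ^ k) s"
    by (rule dirichlet_series_ln_power_sums[OF abs_conv_const s])
  have H0: "?H \<longlonglongrightarrow> 0"
    using ln_powr_primitive_tendsto_0[OF s, of k] by (rule LIMSEQ_Suc)
  have "(\<lambda>n. ?H (Suc n) - ?H n) sums (0 - ?H 0)"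
    by (rule telescope_sums[OF H0])
  from sums_diff[OF 1 this] show "(\<lambda>n. ?h n - (?H (Suc n) - ?H n)) sums
      (dirichlet_series (\<lambda>n. ln (real n) ^ k) s - fact k / (s - 1) ^ Suc k)"
    by (simp add: ln_powr_primitive_1)
  show "(\<lambda>_. 0 :: complex) \<longlonglongrightarrow> 0" by simp
  fix N
  have "norm ((\<Sum>n<N. ?h n - (?H (Suc n) - ?H n)) - 0) \<le> (\<Sum>n<N. norm s * ln_powr_variation (Suc n))"
    unfolding diff_0_right
  proof (rule sum_norm_le)
    fix n
    have "norm (?h n - (?H (Suc n) - ?H n)) = norm (?H (Suc n) - ?H n - ?h n)"
      by (metis minus_diff_eq norm_minus_cancel)
    also have "\<dots> \<le> norm s * ln_powr_variation (Suc n)"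
      using norm_ln_powr_primitive_diff_le[OF s k, of "Suc n"] by (simp add: add_ac)
    finally show "norm (?h n - (?H (Suc n) - ?H n)) \<le> norm s * ln_powr_variation (Suc n)" .
  qed
  also have "\<dots> = norm s * (\<Sum>n<N. ln_powr_variation (Suc n))"
    by (simp add: sum_distrib_left)
  also have "\<dots> \<le> norm s * suminf ln_powr_variation"
  proof (rule mult_left_mono)
    have "(\<Sum>n<N. ln_powr_variation (Suc n)) \<le> (\<Sum>n<Suc N. ln_powr_variation n)"
      by (subst sum.lessThan_Suc_shift) (simp add: ln_powr_variation_nonneg)
    also have "\<dots> \<le> suminf ln_powr_variation"
      by (rule sum_le_suminf) (auto simp: summable_ln_powr_variation ln_powr_variation_nonneg)
    finally show "(\<Sum>n<N. ln_powr_variation (Suc n)) \<le> suminf ln_powr_variation" .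
  qed auto
  finally show "norm ((\<Sum>n<N. ?h n - (?H (Suc n) - ?H n)) - 0) \<le> suminf ln_powr_variation * norm s"
    by (simp add: mult_ac)
qed

section \<open>Lower bounds from the 3-4-1 inequality\<close>

text \<open>The pole at 1 has residue \<open>\<kappa>\<close>, and no zero lies in the strip near 1.\<close>

locale regular_character = sign_character +
  fixes \<kappa> K r m :: real
  assumes \<kappa>: "0 \<le> \<kappa>" "\<kappa> \<le> 1"
    and r: "0 < r" "r \<le> 1"
    and m: "0 < m"
    and approx: "\<And>k s. Re s > 1 \<Longrightarrow> k \<le> 2 \<Longrightarrow>
       norm (dirichlet_series (\<lambda>n. c n * ln (real n) ^ k) s - of_real \<kappa> * fact k / (s - 1) ^ Suc k) \<le> K * norm s"
    and near: "\<And>s. 1 < Re s \<Longrightarrow> Re s \<le> 1 + r \<Longrightarrow> \<bar>Im s\<bar> \<le> r \<Longrightarrow> m \<le> norm (dirichlet_series c s)"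

lemma norm_le_height:
  assumes "1 < Re s" "Re s \<le> 2"
  shows "norm s \<le> 2 * (1 + \<bar>Im s\<bar>)"
  using cmod_le[of s] assms by simp

lemma suminf_ln_powr_variation_pos: "suminf ln_powr_variation > 0"
proof (rule suminf_pos2[of _ 1])
  show "ln_powr_variation 1 > 0"
  proof -
    have "1 + ln (2::real) \<noteq> 0" using ln_gt_zero[of "2::real"] by linarith
    then show ?thesis by (simp add: ln_powr_variation_def)
  qed
qed (auto simp: summable_ln_powr_variation ln_powr_variation_nonneg)

context regular_character
begin

lemma K_nonneg: "K \<ge> 0"
proof -
  have "0 \<le> K * norm (2 :: complex)"
    by (rule order_trans[OF norm_ge_zero approx[of 2 0]]) auto
  then show ?thesis by simp
qed

text \<open>At distance at least r from the pole the polar part is at most 2 / r^3, since k! \<le>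
  2, r \<le> 1 and the pole has order at most 3; the rest grows linearly in the height.\<close>

lemma derivative_series_le:
  assumes s: "1 < Re s" "Re s \<le> 2" and t: "\<bar>Im s\<bar> \<ge> r" and k: "k \<le> 2"
  shows "norm (dirichlet_series (\<lambda>n. c n * ln (real n) ^ k) s) \<le> (2 / r ^ 3 + 2 * K) * (1 + \<bar>Im s\<bar>)"
proof -
  have ns: "norm (s - 1) \<ge> r"
    using t abs_Im_le_cmod[of "s - 1"] by simp
  have f2: "fact k \<le> (2 :: real)"
    using k by (cases k rule: nat.exhaust) (auto simp: le_Suc_eq numeral_2_eq_2)
  have "norm (of_real \<kappa> * fact k / (s - 1) ^ Suc k) = \<kappa> * fact k / norm (s - 1) ^ Suc k"
    using \<kappa> by (simp add: norm_mult norm_divide norm_power del: power_Suc)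
  also have "\<dots> \<le> 1 * 2 / r ^ Suc k"
    using ns r \<kappa> f2 by (intro frac_le mult_mono power_mono) auto
  also have "\<dots> \<le> 2 / r ^ 3"
    using r k power_decreasing[of "Suc k" 3 r] by (intro frac_le) (auto simp del: power_Suc)
  also have "\<dots> \<le> 2 / r ^ 3 * (1 + \<bar>Im s\<bar>)"
    using r by (simp add: field_simps)
  finally have 1: "norm (of_real \<kappa> * fact k / (s - 1) ^ Suc k) \<le> 2 / r ^ 3 * (1 + \<bar>Im s\<bar>)" .
  have "norm (dirichlet_series (\<lambda>n. c n * ln (real n) ^ k) s - of_real \<kappa> * fact k / (s - 1) ^ Suc k) \<le> K * norm s"
    using approx s k by simp
  also have "\<dots> \<le> K * (2 * (1 + \<bar>Im s\<bar>))"
    using norm_le_height[OF s] K_nonneg by (intro mult_left_mono) auto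
  finally have 2: "norm (dirichlet_series (\<lambda>n. c n * ln (real n) ^ k) s - of_real \<kappa> * fact k / (s - 1) ^ Suc k) \<le>
      2 * K * (1 + \<bar>Im s\<bar>)"
    by (simp add: mult_ac)
  have "norm (dirichlet_series (\<lambda>n. c n * ln (real n) ^ k) s) \<le>
     norm (of_real \<kappa> * fact k / (s - 1) ^ Suc k) +
     norm (dirichlet_series (\<lambda>n. c n * ln (real n) ^ k) s - of_real \<kappa> * fact k / (s - 1) ^ Suc k)"
    by (rule norm_triangle_sub)
  with 1 2 show ?thesis
    by (simp only: distrib_right)
qed

text \<open>The 3-4-1 inequality solved for L, with zeta(\<sigma>) bounded through its pole by a
  multiple of 1 / (\<sigma> - 1) and zeta(\<sigma> + 2it) bounded by a multiple of 1 + |t|.\<close>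

lemma fourth_power_lower_bound:
  assumes s: "1 < Re s" "Re s \<le> 2" and t: "\<bar>Im s\<bar> \<ge> r"
  shows "(Re s - 1) ^ 3 / ((1 + 2 * suminf ln_powr_variation) ^ 3 *
            (1 / r + 2 * suminf ln_powr_variation) * (1 + \<bar>Im s\<bar>)) \<le> norm (dirichlet_series c s) ^ 4"
proof -
  define A where "A = suminf ln_powr_variation"
  define \<sigma> t where "\<sigma> = Re s" and "t = Im s"
  have A: "A > 0" unfolding A_def by (rule suminf_ln_powr_variation_pos)
  have st: "s = Complex \<sigma> t" by (simp add: \<sigma>_def t_def)
  have \<sigma>: "1 < \<sigma>" "\<sigma> \<le> 2" "\<bar>t\<bar> \<ge> r" using s t by (auto simp: \<sigma>_def t_def)
  have z: "norm (zeta_series w - 1 / (w - 1)) \<le> A * norm w" if "Re w > 1" for w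
    using norm_zeta_ln_power_diff_le[OF that, of 0] by (simp add: A_def)
  have z': "norm (zeta_series w) \<le> 1 / norm (w - 1) + A * norm w" if "Re w > 1" for w
    using norm_triangle_sub[of "zeta_series w" "1 / (w - 1)"] z[OF that] by (simp add: norm_divide)
  have "norm (zeta_series (Complex \<sigma> 0)) \<le> 1 / (\<sigma> - 1) + A * 2"
  proof -
    have c: "Complex \<sigma> 0 = of_real \<sigma>" by (simp add: complex_of_real_def)
    have "Complex \<sigma> 0 - 1 = of_real (\<sigma> - 1)" by (simp add: complex_of_real_def complex_eq_iff)
    then have "norm (Complex \<sigma> 0 - 1) = \<sigma> - 1" using \<sigma> by (simp only: norm_of_real)
    moreover have "norm (Complex \<sigma> 0) \<le> 2" using \<sigma> by (simp only: c norm_of_real)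
    moreover from this have "A * norm (Complex \<sigma> 0) \<le> A * 2"
      using A by (intro mult_left_mono) auto
    ultimately show ?thesis
      using z'[of "Complex \<sigma> 0"] \<sigma> by simp
  qed
  also have "\<dots> \<le> (1 + 2 * A) / (\<sigma> - 1)"
  proof -
    have "2 * A * (\<sigma> - 1) \<le> 2 * A" using \<sigma> A by (intro mult_left_le) auto
    then have "A * 2 \<le> 2 * A / (\<sigma> - 1)" using \<sigma> by (simp add: le_divide_eq mult_ac)
    then show ?thesis by (simp add: add_divide_distrib)
  qed
  finally have z1: "norm (zeta_series (Complex \<sigma> 0)) \<le> (1 + 2 * A) / (\<sigma> - 1)" .
  have z2: "norm (zeta_series (Complex \<sigma> (2 * t))) \<le> (1 / r + 2 * A) * (1 + \<bar>t\<bar>)"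
  proof -
    have "r \<le> norm (Complex \<sigma> (2 * t) - 1)"
      using abs_Im_le_cmod[of "Complex \<sigma> (2 * t) - 1"] \<sigma> by (simp add: abs_mult)
    then have "1 / norm (Complex \<sigma> (2 * t) - 1) \<le> 1 / r"
      using r by (intro divide_left_mono) (auto intro!: mult_pos_pos)
    also have "\<dots> \<le> 1 / r * (1 + \<bar>t\<bar>)" using r by (simp add: field_simps)
    finally have 1: "1 / norm (Complex \<sigma> (2 * t) - 1) \<le> 1 / r * (1 + \<bar>t\<bar>)" .
    have "norm (Complex \<sigma> (2 * t)) \<le> 2 * (1 + \<bar>t\<bar>)"
      using cmod_le[of "Complex \<sigma> (2 * t)"] \<sigma> by (simp add: abs_mult)
    then have "A * norm (Complex \<sigma> (2 * t)) \<le> 2 * A * (1 + \<bar>t\<bar>)"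
      using A mult_left_mono by fastforce
    with 1 z'[of "Complex \<sigma> (2 * t)"] show ?thesis using \<sigma> by (simp add: distrib_right)
  qed
  have "1 \<le> norm (zeta_series (Complex \<sigma> 0)) ^ 3 * norm (dirichlet_series c s) ^ 4 *
           norm (zeta_series (Complex \<sigma> (2 * t)))"
    unfolding st by (rule three_four_one) fact
  also have "\<dots> \<le> ((1 + 2 * A) / (\<sigma> - 1)) ^ 3 * norm (dirichlet_series c s) ^ 4 * ((1 / r + 2 * A) * (1 + \<bar>t\<bar>))"
    using z1 z2 \<sigma> A by (intro mult_mono power_mono mult_nonneg_nonneg) auto
  finally have *: "1 \<le> ((1 + 2 * A) / (\<sigma> - 1)) ^ 3 * norm (dirichlet_series c s) ^ 4 * ((1 / r + 2 * A) * (1 + \<bar>t\<bar>))" .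
  have "(\<sigma> - 1) ^ 3 / ((1 + 2 * A) ^ 3 * (1 / r + 2 * A) * (1 + \<bar>t\<bar>)) \<le> norm (dirichlet_series c s) ^ 4"
  proof -
    define X Y Z where "X = (1 + 2 * A) ^ 3" and "Y = (1 / r + 2 * A) * (1 + \<bar>t\<bar>)" and "Z = (\<sigma> - 1) ^ 3"
    have "X > 0" "Y > 0" "Z > 0"
      using A r \<sigma> by (auto simp: X_def Y_def Z_def intro!: mult_pos_pos add_pos_pos zero_less_power)
    moreover have "1 \<le> X / Z * norm (dirichlet_series c s) ^ 4 * Y"
      using * by (simp add: X_def Y_def Z_def power_divide)
    ultimately have "Z / (X * Y) \<le> norm (dirichlet_series c s) ^ 4"
      by (simp add: field_simps)
    then show ?thesis by (simp add: X_def Y_def Z_def mult.assoc)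
  qed
  then show ?thesis by (simp add: A_def \<sigma>_def t_def)
qed

text \<open>The 3-4-1 bound degenerates as \<open>Re s\<close> tends to 1, but L changes slowly: a
  point too close to the line is compared with the point at abscissa 1 + \<delta> on the same
  height, and the loss is at most \<delta> times the bound on L'.\<close>

lemma lower_bound:
  obtains m' where "m' > 0"
    "\<And>s. 1 < Re s \<Longrightarrow> Re s \<le> 1 + r \<Longrightarrow> m' / (1 + \<bar>Im s\<bar>) ^ 4 \<le> norm (dirichlet_series c s)"
proof -
  define A where "A = 2 / r ^ 3 + 2 * K"
  define B where "B = (1 + 2 * suminf ln_powr_variation) ^ 3 * (1 / r + 2 * suminf ln_powr_variation)"
  have A: "A > 0" using r K_nonneg by (auto simp: A_def intro!: add_pos_nonneg)
  have B: "B > 0" using r suminf_ln_powr_variation_pos by (auto simp: B_def intro!: mult_pos_pos add_pos_pos zero_less_power)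
  \<comment> \<open>With B the constant of the 3-4-1 bound and \<delta> = e / V^5, the requirement
    (2 A \<delta> V)^4 \<le> \<delta>^3 / (B V) reads 16 A^4 B e \<le> 1.\<close>
  define e where "e = min r (1 / (16 * A ^ 4 * B))"
  have e: "e > 0" "e \<le> r" "e \<le> 1 / (16 * A ^ 4 * B)" using r A B by (auto simp: e_def)
  have main: "A * e / (1 + \<bar>Im s\<bar>) ^ 4 \<le> norm (dirichlet_series c s)"
    if s: "1 < Re s" "Re s \<le> 1 + r" "\<bar>Im s\<bar> \<ge> r" for s
  proof -
    define V where "V = 1 + \<bar>Im s\<bar>"
    have V: "V \<ge> 1" by (simp add: V_def)
    define \<delta> where "\<delta> = e / V ^ 5"
    have \<delta>: "\<delta> > 0" using e V by (simp add: \<delta>_def)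
    have "\<delta> \<le> e / 1" unfolding \<delta>_def using e V by (intro divide_left_mono) auto
    then have \<delta>r: "\<delta> \<le> r" using e by simp
    \<comment> \<open>The factor 2 pays for the move: the derivative costs at most A V \<delta>, so
      A \<delta> V = A e / V^4 remains.\<close>
    have far: "2 * A * \<delta> * V \<le> norm (dirichlet_series c w)"
      if w: "Re w \<ge> 1 + \<delta>" "Re w \<le> 1 + r" "Im w = Im s" for w
    proof (rule power_le_imp_le_base)
      have "(2 * A * \<delta> * V) ^ Suc 3 = 16 * A ^ 4 * \<delta> * \<delta> ^ 3 * V ^ 4"
        by (simp add: power_mult_distrib eval_nat_numeral)
      also have "\<dots> = 16 * A ^ 4 * (e / V ^ 5) * \<delta> ^ 3 * V ^ 4"
        by (simp add: \<delta>_def)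
      also have "\<dots> \<le> 16 * A ^ 4 * (1 / (16 * A ^ 4 * B) / V ^ 5) * \<delta> ^ 3 * V ^ 4"
        using e A \<delta> V by (intro mult_right_mono mult_left_mono divide_right_mono) auto
      also have "\<dots> = \<delta> ^ 3 / (B * V)"
        using A B V by (simp add: field_simps eval_nat_numeral)
      also have "\<dots> \<le> (Re w - 1) ^ 3 / (B * V)"
        using w \<delta> B V by (intro divide_right_mono power_mono) auto
      also have "\<dots> \<le> norm (dirichlet_series c w) ^ 4"
        using fourth_power_lower_bound[of w] w s \<delta> r by (simp add: B_def V_def mult.assoc)
      finally show "(2 * A * \<delta> * V) ^ Suc 3 \<le> norm (dirichlet_series c w) ^ Suc 3"
        by (simp add: eval_nat_numeral)
    qed auto
    have eq: "A * e / V ^ 4 = A * \<delta> * V"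
      using V by (simp add: \<delta>_def eval_nat_numeral field_simps)
    show ?thesis
    proof (cases "Re s \<ge> 1 + \<delta>")
      case True
      with far[of s] s have "2 * (A * \<delta> * V) \<le> norm (dirichlet_series c s)" by simp
      moreover have "A * \<delta> * V \<ge> 0" using A \<delta> V by simp
      ultimately show ?thesis unfolding V_def[symmetric] eq by linarith
    next
      case False
      define w where "w = Complex (1 + \<delta>) (Im s)"
      have "2 * A * \<delta> * V \<le> norm (dirichlet_series c w)"
        by (rule far) (use \<delta>r in \<open>auto simp: w_def\<close>)
      moreover have "norm (dirichlet_series c w - dirichlet_series c s) \<le> A * V * norm (w - s)"
      proof (rule field_differentiable_bound[where S = "closed_segment s w"])
        fix z assume z: "z \<in> closed_segment s w"
        have "closed_segment s w \<subseteq> {z. 1 < Re z} \<inter> {z. Re z \<le> 2} \<inter> {z. Im z \<le> Im s} \<inter> {z. Im z \<ge> Im s}"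
          by (rule closed_segment_subset)
             (use s \<delta> \<delta>r r False in \<open>auto simp: w_def intro!: convex_Int convex_halfspace_Re_gt convex_halfspace_Re_le convex_halfspace_Im_le convex_halfspace_Im_ge\<close>)
        with z have zz: "1 < Re z" "Re z \<le> 2" "Im z = Im s" by (auto intro!: antisym)
        show "(dirichlet_series c has_field_derivative - dirichlet_series (\<lambda>n. c n * ln (real n)) z)
            (at z within closed_segment s w)"
          by (rule has_field_derivative_at_within[OF has_field_derivative_dirichlet_series])
             (use zz abs_conv_char in auto)
        show "norm (- dirichlet_series (\<lambda>n. c n * ln (real n)) z) \<le> A * V"
          using derivative_series_le[of z 1] zz s by (simp add: A_def V_def)
      qed auto
      moreover have "norm (w - s) \<le> \<delta>"
      proof -
        have "w - s = of_real (1 + \<delta> - Re s)" by (simp add: w_def complex_eq_iff)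
        then show ?thesis using s False by (simp only: norm_of_real)
      qed
      then have "A * V * norm (w - s) \<le> A * V * \<delta>"
        using A V by (intro mult_left_mono) auto
      ultimately have "A * \<delta> * V \<le> norm (dirichlet_series c s)"
        using norm_triangle_sub[of "dirichlet_series c w" "dirichlet_series c s"] by (simp add: mult_ac)
      then show ?thesis unfolding V_def[symmetric] eq .
    qed
  qed
  show ?thesis
  proof (rule that[of "min m (A * e)"])
    show "min m (A * e) > 0" using m A e by simp
    fix s assume s: "1 < Re s" "Re s \<le> 1 + r"
    show "min m (A * e) / (1 + \<bar>Im s\<bar>) ^ 4 \<le> norm (dirichlet_series c s)"
    proof (cases "\<bar>Im s\<bar> \<ge> r")
      case True
      have "min m (A * e) / (1 + \<bar>Im s\<bar>) ^ 4 \<le> (A * e) / (1 + \<bar>Im s\<bar>) ^ 4"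
        by (intro divide_right_mono) auto
      with main[OF s True] show ?thesis by simp
    next
      case False
      have "min m (A * e) / (1 + \<bar>Im s\<bar>) ^ 4 \<le> m / 1"
        using m A e by (intro frac_le) auto
      with near[OF s] False show ?thesis by simp
    qed
  qed
qed

text \<open>Dividing bounds of size V by L >> V^-4 gives V^5 for the logarithmic derivative; its
  derivative contains the square, hence V^10. The growth of L' and L'' is left as a premise so that
  zeta, unbounded at its pole, can be handled separately there.\<close>

lemma log_derivative_bound:
  assumes A: "A \<ge> 0"
  obtains C where "C > 0"
    "\<And>s. 1 < Re s \<Longrightarrow> Re s \<le> 1 + r \<Longrightarrow>
       norm (dirichlet_series (\<lambda>n. c n * ln (real n)) s) \<le> A * (1 + \<bar>Im s\<bar>) \<Longrightarrow>
       norm (dirichlet_series (\<lambda>n. c n * ln (real n) ^ 2) s) \<le> A * (1 + \<bar>Im s\<bar>) \<Longrightarrow>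
       norm (dirichlet_series (\<lambda>n. c n * mangoldt n) s) \<le> C * (1 + \<bar>Im s\<bar>) ^ 10 \<and>
       norm (dirichlet_series (\<lambda>n. c n * mangoldt n * ln (real n)) s) \<le> C * (1 + \<bar>Im s\<bar>) ^ 10"
proof -
  obtain m' where m': "m' > 0"
    "\<And>s. 1 < Re s \<Longrightarrow> Re s \<le> 1 + r \<Longrightarrow> m' / (1 + \<bar>Im s\<bar>) ^ 4 \<le> norm (dirichlet_series c s)"
    using lower_bound by blast
  define q where "q = A / m'"
  have q: "q \<ge> 0" using A m' by (simp add: q_def)
  show ?thesis
  \<comment> \<open>The summand 1 keeps the constant positive even when A = 0.\<close>
  proof (rule that[of "q + q ^ 2 + 1"])
    show "q + q ^ 2 + 1 > 0" using q by (intro add_nonneg_pos) auto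
    fix s assume s: "1 < Re s" "Re s \<le> 1 + r"
      and f1: "norm (dirichlet_series (\<lambda>n. c n * ln (real n)) s) \<le> A * (1 + \<bar>Im s\<bar>)"
      and f2: "norm (dirichlet_series (\<lambda>n. c n * ln (real n) ^ 2) s) \<le> A * (1 + \<bar>Im s\<bar>)"
    define V where "V = 1 + \<bar>Im s\<bar>"
    have V: "V \<ge> 1" by (simp add: V_def)
    define f where "f = dirichlet_series c s"
    define F where "F = dirichlet_series (\<lambda>n. c n * mangoldt n) s"
    define F1 where "F1 = dirichlet_series (\<lambda>n. c n * mangoldt n * ln (real n)) s"
    have f: "f \<noteq> 0" using series_nonzero[OF s(1)] by (simp add: f_def)
    have fl: "m' / V ^ 4 \<le> norm f" using m'(2)[OF s] by (simp add: V_def f_def)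
    have quot: "norm (w / f) \<le> q * V ^ 5" if "norm w \<le> A * V" for w
    proof -
      have "norm (w / f) \<le> (A * V) / (m' / V ^ 4)"
        unfolding norm_divide using that fl m' V f A by (intro frac_le) auto
      also have "\<dots> = q * V ^ 5" by (simp add: q_def eval_nat_numeral field_simps)
      finally show ?thesis .
    qed
    have F: "F = dirichlet_series (\<lambda>n. c n * ln (real n)) s / f"
      using series_ln_eq[OF s(1)] f by (simp add: F_def f_def)
    have nF: "norm F \<le> q * V ^ 5"
      unfolding F by (rule quot) (use f1 in \<open>simp add: V_def\<close>)
    have F1: "F1 = dirichlet_series (\<lambda>n. c n * ln (real n) ^ 2) s / f - F ^ 2"
      using series_ln_square_eq[OF s(1)] series_ln_eq[OF s(1)] f
      by (simp add: F1_def F_def f_def field_simps power2_eq_square)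
    have "norm F1 \<le> norm (dirichlet_series (\<lambda>n. c n * ln (real n) ^ 2) s / f) + norm (F ^ 2)"
      unfolding F1 by (rule norm_triangle_ineq4)
    also have "\<dots> \<le> q * V ^ 5 + (q * V ^ 5) ^ 2"
      unfolding norm_power
      by (intro add_mono quot power_mono nF) (use f2 in \<open>auto simp: V_def\<close>)
    finally have nF1: "norm F1 \<le> q * V ^ 5 + q ^ 2 * V ^ 10"
      by (simp add: power_mult_distrib flip: power_mult)
    have V5: "V ^ 5 \<le> V ^ 10" using V by (intro power_increasing) auto
    have "norm F \<le> q * V ^ 10"
      using nF mult_left_mono[OF V5 q] by linarith
    also have "\<dots> \<le> (q + q ^ 2 + 1) * V ^ 10"
      using V q by (intro mult_right_mono) auto
    finally have 1: "norm F \<le> (q + q ^ 2 + 1) * V ^ 10" .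
    have "norm F1 \<le> (q + q ^ 2) * V ^ 10"
      using nF1 mult_left_mono[OF V5 q] by (simp add: distrib_right)
    also have "\<dots> \<le> (q + q ^ 2 + 1) * V ^ 10"
      using V q by (intro mult_right_mono) auto
    finally have 2: "norm F1 \<le> (q + q ^ 2 + 1) * V ^ 10" .
    from 1 2 show "norm (dirichlet_series (\<lambda>n. c n * mangoldt n) s) \<le> (q + q ^ 2 + 1) * (1 + \<bar>Im s\<bar>) ^ 10 \<and>
       norm (dirichlet_series (\<lambda>n. c n * mangoldt n * ln (real n)) s) \<le> (q + q ^ 2 + 1) * (1 + \<bar>Im s\<bar>) ^ 10"
      by (simp add: F_def F1_def V_def)
  qed
qed

end

section \<open>The logarithmic derivative of zeta compared with zeta itself\<close>

text \<open>Subtracting 1 from \<Lambda> removes the pole: near s = 1 both -zeta'/zeta and zeta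
  behave as 1 / (s - 1), and after differentiation both have the polar part 1 / (s - 1)^2. Away from
  1 the terms are bounded separately.\<close>

lemma zeta_mangoldt_bound:
  obtains C r where "C > 0" "0 < r" "r \<le> 1"
    "\<And>s. 1 < Re s \<Longrightarrow> Re s \<le> 1 + r \<Longrightarrow>
       norm (dirichlet_series (\<lambda>n. mangoldt n - 1) s) \<le> C * (1 + \<bar>Im s\<bar>) ^ 10 \<and>
       norm (dirichlet_series (\<lambda>n. (mangoldt n - 1) * ln (real n)) s) \<le> C * (1 + \<bar>Im s\<bar>) ^ 10"
proof -
  define K where "K = suminf ln_powr_variation"
  have K: "K > 0" unfolding K_def by (rule suminf_ln_powr_variation_pos)
  \<comment> \<open>Near 1 one has |s| \<le> 3 and |s - 1| \<le> 2 r, so the regular part of (s - 1)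
    zeta(s) is at most 2 r * 3 K \<le> 1/2 and that product stays at least 1/2 in norm.\<close>
  define r where "r = min (1/2) (1 / (12 * K))"
  have r: "0 < r" "r \<le> 1 / 2" "r \<le> 1 / (12 * K)" using K by (auto simp: r_def)
  let ?e = "\<lambda>k s. dirichlet_series (\<lambda>n. ln (real n) ^ k) s - fact k / (s - 1) ^ Suc k"
  have e: "norm (?e k s) \<le> K * norm s" if "Re s > 1" "k \<le> 2" for k s
    using norm_zeta_ln_power_diff_le[OF that] by (simp add: K_def)
  have near_e: "norm (?e k s) \<le> 3 * K"
    if s: "1 < Re s" "Re s \<le> 1 + r" "\<bar>Im s\<bar> \<le> r" and k: "k \<le> 2" for k s
  proof -
    have "norm s \<le> \<bar>Re s\<bar> + \<bar>Im s\<bar>" by (rule cmod_le)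
    also have "\<dots> \<le> 3" using s r by simp
    finally have "K * norm s \<le> K * 3" using K by (intro mult_left_mono) auto
    then show ?thesis using e[OF s(1) k] by simp
  qed
  have u_le: "norm (s - 1) \<le> 2 * r"
    if s: "1 < Re s" "Re s \<le> 1 + r" "\<bar>Im s\<bar> \<le> r" for s
    using cmod_le[of "s - 1"] s by simp
  have w_ge: "norm (1 + (s - 1) * ?e 0 s) \<ge> 1 / 2" "norm (1 + (s - 1) * ?e 0 s) \<le> 3 / 2"
    if s: "1 < Re s" "Re s \<le> 1 + r" "\<bar>Im s\<bar> \<le> r" for s
  proof -
    have "norm ((s - 1) * ?e 0 s) \<le> (2 * r) * (3 * K)"
      unfolding norm_mult using near_e[OF s, of 0] u_le[OF s] r by (intro mult_mono) auto
    also have "\<dots> \<le> 1 / 2" using r K by (simp add: field_simps)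
    finally have *: "norm ((s - 1) * ?e 0 s) \<le> 1 / 2" .
    show "norm (1 + (s - 1) * ?e 0 s) \<ge> 1 / 2"
      using norm_triangle_ineq2[of 1 "- ((s - 1) * ?e 0 s)"] * by simp
    show "norm (1 + (s - 1) * ?e 0 s) \<le> 3 / 2"
      using norm_triangle_ineq[of 1 "(s - 1) * ?e 0 s"] * by simp
  qed
  have f0: "zeta_series s = (1 + (s - 1) * ?e 0 s) / (s - 1)" if "Re s > 1" for s
  proof -
    have "s - 1 \<noteq> 0" using that by auto
    then show ?thesis by (simp add: right_diff_distrib)
  qed
  interpret Z: regular_character "\<lambda>_. 1" 1 K r "1/2"
  proof unfold_locales
    show "norm (dirichlet_series (\<lambda>n. 1 * ln (real n) ^ k) s - of_real 1 * fact k / (s - 1) ^ Suc k) \<le> K * norm s"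
      if "Re s > 1" "k \<le> 2" for k s
      using e[OF that] by simp
    show "1 / 2 \<le> norm (zeta_series s)" if s: "1 < Re s" "Re s \<le> 1 + r" "\<bar>Im s\<bar> \<le> r" for s
    proof -
      have "1 / 2 / 1 \<le> norm (1 + (s - 1) * ?e 0 s) / norm (s - 1)"
        using w_ge(1)[OF s] u_le[OF s] r s by (intro frac_le) (auto simp: complex_eq_iff)
      then show ?thesis
        unfolding norm_divide[symmetric] f0[OF s(1), symmetric] by simp
    qed
  qed (use r K in auto)
  define A where "A = 2 / r ^ 3 + 2 * K"
  have A: "A \<ge> 0" using r K by (simp add: A_def)
  obtain C where C: "C > 0"
    "\<And>s. 1 < Re s \<Longrightarrow> Re s \<le> 1 + r \<Longrightarrow>
       norm (dirichlet_series (\<lambda>n. 1 * ln (real n)) s) \<le> A * (1 + \<bar>Im s\<bar>) \<Longrightarrow>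
       norm (dirichlet_series (\<lambda>n. 1 * ln (real n) ^ 2) s) \<le> A * (1 + \<bar>Im s\<bar>) \<Longrightarrow>
       norm (dirichlet_series (\<lambda>n. 1 * mangoldt n) s) \<le> C * (1 + \<bar>Im s\<bar>) ^ 10 \<and>
       norm (dirichlet_series (\<lambda>n. 1 * mangoldt n * ln (real n)) s) \<le> C * (1 + \<bar>Im s\<bar>) ^ 10"
    using Z.log_derivative_bound[OF A] by blast
  \<comment> \<open>The sum of the bounds for the two cases: C + A for heights at least r, and the
    remaining summands for the explicit estimates near the pole.\<close>
  define C' where "C' = C + A + 15 * K + 4 * (11 * K + 18 * K\<^sup>2) + 3 * K"
  have C': "C' > 0" using C K A by (auto simp: C'_def intro!: add_pos_nonneg)
  have acm: "abs_conv (\<lambda>n. mangoldt n :: real)" and ac1: "abs_conv (\<lambda>_. 1)"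
    using abs_conv_mangoldt abs_conv_const by auto
  show ?thesis
  proof (rule that[of C' r])
    fix s assume s: "1 < Re s" "Re s \<le> 1 + r"
    define V where "V = 1 + \<bar>Im s\<bar>"
    have V: "V \<ge> 1" by (simp add: V_def)
    define F F1 where "F = dirichlet_series mangoldt s"
      and "F1 = dirichlet_series (\<lambda>n. mangoldt n * ln (real n)) s"
    define f where "f k = dirichlet_series (\<lambda>n. ln (real n) ^ k) s" for k
    have d0: "dirichlet_series (\<lambda>n. mangoldt n - 1) s = F - f 0"
      using dirichlet_series_diff[OF acm ac1 s(1)] by (simp add: F_def f_def)
    have d1: "dirichlet_series (\<lambda>n. (mangoldt n - 1) * ln (real n)) s = F1 - f 1"
      using dirichlet_series_diff[OF abs_conv_ln[OF acm] abs_conv_ln[OF ac1] s(1)]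
      by (simp add: F1_def f_def left_diff_distrib)
    have "norm (F - f 0) \<le> C' * V ^ 10 \<and> norm (F1 - f 1) \<le> C' * V ^ 10"
    proof (cases "\<bar>Im s\<bar> \<ge> r")
      case True
      have f: "norm (f k) \<le> A * V" if "k \<le> 2" for k
        using Z.derivative_series_le[of s k] s True r that by (simp add: f_def A_def V_def)
      have FF: "norm F \<le> C * V ^ 10" "norm F1 \<le> C * V ^ 10"
        using C(2)[OF s] f[of 1] f[of 2] by (auto simp: F_def F1_def V_def f_def)
      have "V ^ 1 \<le> V ^ 10" using V by (intro power_increasing) auto
      then have "A * V \<le> A * V ^ 10" using A by (intro mult_left_mono) auto
      then have f': "norm (f k) \<le> A * V ^ 10" if "k \<le> 2" for k using f[OF that] by linarith
      have CA: "C * V ^ 10 + A * V ^ 10 \<le> C' * V ^ 10"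
        using K V unfolding distrib_right[symmetric] by (intro mult_right_mono) (auto simp: C'_def)
      show ?thesis
        using FF f'[of 0] f'[of 1] CA norm_triangle_ineq4[of F "f 0"] norm_triangle_ineq4[of F1 "f 1"]
        by simp
    next
      case False
      then have sr: "\<bar>Im s\<bar> \<le> r" by simp
      define u where "u = s - 1"
      define e0 e1 e2 where "e0 = ?e 0 s" and "e1 = ?e 1 s" and "e2 = ?e 2 s"
      \<comment> \<open>Here w = (s - 1) zeta(s), bounded away from 0; all poles are expressed
        through u and cancel algebraically.\<close>
      define w where "w = 1 + u * e0"
      have u: "u \<noteq> 0" "norm u \<le> 1"
        using u_le[OF s sr] s r by (auto simp: u_def)
      have ne: "norm e0 \<le> 3 * K" "norm e1 \<le> 3 * K" "norm e2 \<le> 3 * K"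
        unfolding e0_def e1_def e2_def by (rule near_e[OF s sr]; simp)+
      have w: "norm w \<ge> 1 / 2" "norm w \<le> 3 / 2"
        using w_ge[OF s sr] by (auto simp: w_def u_def e0_def)
      have w0: "w \<noteq> 0" using w by auto
      have f0': "f 0 = 1 / u + e0" "f 1 = 1 / u ^ 2 + e1" "f 2 = 2 / u ^ 3 + e2"
        by (simp_all add: f_def e0_def e1_def e2_def u_def eval_nat_numeral)
      have f0w: "f 0 = w / u" using u f0' by (simp add: w_def field_simps)
      have "f 1 = F * f 0"
        using zeta.series_ln_eq[OF s(1)] by (simp add: f_def F_def)
      then have "F = f 1 * u / w"
        using u w0 unfolding f0w by (simp add: field_simps)
      also have "\<dots> = (1 + u ^ 2 * e1) / (u * w)"
        using u w0 unfolding f0'(2) by (simp add: divide_simps) (simp add: algebra_simps power2_eq_square)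
      finally have F: "F = (1 + u ^ 2 * e1) / (u * w)" .
      have "f 2 = F * f 1 + F1 * f 0"
        using zeta.series_ln_square_eq[OF s(1)] by (simp add: f_def F_def F1_def)
      then have "F1 * f 0 = f 2 - F * f 1" by simp
      then have F1: "F1 = (f 2 - F * f 1) * u / w"
        using u w0 unfolding f0w by (simp add: field_simps)
      have "F - 1 / u = ((1 + u ^ 2 * e1) - w) / (u * w)"
        unfolding F using u w0 by (simp add: divide_simps)
      also have "(1 + u ^ 2 * e1) - w = u * (u * e1 - e0)"
        by (simp add: w_def algebra_simps power2_eq_square)
      finally have "F - 1 / u = (u * e1 - e0) / w"
        using u by simp
      then have "F - f 0 = (u * e1 - e0) / w - e0"
        by (simp add: f0' algebra_simps)
      also have "norm \<dots> \<le> norm ((u * e1 - e0) / w) + norm e0" by (rule norm_triangle_ineq4)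
      also have "norm ((u * e1 - e0) / w) \<le> (1 * (3 * K) + 3 * K) / (1 / 2)"
        unfolding norm_divide using w u ne K
        by (intro frac_le order_trans[OF norm_triangle_ineq4] add_mono)
           (auto simp: norm_mult intro!: order_trans[OF mult_mono[of "norm u" 1 "norm e1" "3*K"]])
      finally have N0: "norm (F - f 0) \<le> 15 * K" using ne by simp
      \<comment> \<open>In the numerator over u^2 w^2 every term is divisible by u^2, so after
        subtracting the double pole no simple pole remains either.\<close>
      have "F1 - 1 / u ^ 2 = (u * e2 * w - 2 * e1 - u ^ 2 * e1 ^ 2 - e0 ^ 2) / w ^ 2"
      proof -
        have "F1 = ((2 + u ^ 3 * e2) * w - (1 + u ^ 2 * e1) ^ 2) / (u ^ 2 * w ^ 2)"
          unfolding F1 F f0' using u w0 by (simp add: divide_simps) (simp add: algebra_simps eval_nat_numeral)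
        then have "F1 - 1 / u ^ 2 = ((2 + u ^ 3 * e2) * w - (1 + u ^ 2 * e1) ^ 2 - w ^ 2) / (u ^ 2 * w ^ 2)"
          using u w0 by (simp add: diff_divide_distrib)
        also have "(2 + u ^ 3 * e2) * w - (1 + u ^ 2 * e1) ^ 2 - w ^ 2 =
            u ^ 2 * (u * e2 * w - 2 * e1 - u ^ 2 * e1 ^ 2 - e0 ^ 2)"
          by (simp add: w_def algebra_simps eval_nat_numeral)
        finally show ?thesis using u by simp
      qed
      then have "F1 - f 1 = (u * e2 * w - 2 * e1 - u ^ 2 * e1 ^ 2 - e0 ^ 2) / w ^ 2 - e1"
        unfolding f0'(2) by (simp add: algebra_simps)
      also have "norm \<dots> \<le> norm (u * e2 * w - 2 * e1 - u ^ 2 * e1 ^ 2 - e0 ^ 2) / norm w ^ 2 + norm e1"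
        using norm_triangle_ineq4 by (metis norm_divide norm_power)
      also have "norm (u * e2 * w - 2 * e1 - u ^ 2 * e1 ^ 2 - e0 ^ 2) / norm w ^ 2 \<le> (11 * K + 18 * K\<^sup>2) / (1 / 2) ^ 2"
      proof (intro frac_le power_mono)
        have "norm (u * e2 * w) \<le> 1 * (3 * K) * (3 / 2)"
          unfolding norm_mult using u ne w K by (intro mult_mono) auto
        moreover have "norm (2 * e1) \<le> 6 * K" using ne by (simp add: norm_mult)
        moreover have "norm (u ^ 2 * e1 ^ 2) \<le> 1 ^ 2 * (3 * K) ^ 2"
          unfolding norm_mult norm_power using u ne by (intro mult_mono power_mono) auto
        moreover have "norm (e0 ^ 2) \<le> (3 * K) ^ 2"
          unfolding norm_power using ne by (intro power_mono) auto
        moreover have "norm (u * e2 * w - 2 * e1 - u ^ 2 * e1 ^ 2 - e0 ^ 2) \<le>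
            norm (u * e2 * w) + norm (2 * e1) + norm (u ^ 2 * e1 ^ 2) + norm (e0 ^ 2)"
          by (intro order_trans[OF norm_triangle_ineq4] add_mono order_refl)
        ultimately show "norm (u * e2 * w - 2 * e1 - u ^ 2 * e1 ^ 2 - e0 ^ 2) \<le> 11 * K + 18 * K\<^sup>2"
          using K by (simp add: power_mult_distrib)
      qed (use w K in auto)
      finally have N1: "norm (F1 - f 1) \<le> 4 * (11 * K + 18 * K\<^sup>2) + 3 * K"
        using ne by (simp add: power2_eq_square)
      have "1 \<le> V ^ 10" using V by simp
      then have "C' * 1 \<le> C' * V ^ 10" using C' by (intro mult_left_mono) auto
      moreover have "15 * K \<le> C'" "4 * (11 * K + 18 * K\<^sup>2) + 3 * K \<le> C'"
        using K A C by (auto simp: C'_def)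
      ultimately show ?thesis using N0 N1 by linarith
    qed
    then show "norm (dirichlet_series (\<lambda>n. mangoldt n - 1) s) \<le> C' * (1 + \<bar>Im s\<bar>) ^ 10 \<and>
       norm (dirichlet_series (\<lambda>n. (mangoldt n - 1) * ln (real n)) s) \<le> C' * (1 + \<bar>Im s\<bar>) ^ 10"
      by (simp only: d0 d1 V_def)
  qed (use r C' in auto)
qed

section \<open>Series with bounded coefficient sums up to the point 1\<close>

locale nonprincipal_character = sign_character +
  fixes D :: real
  assumes partial_sums: "\<And>N. \<bar>\<Sum>n<N. c (Suc n)\<bar> \<le> D"
begin

lemma D_nonneg: "D \<ge> 0"
  using partial_sums[of 0] by simp

text \<open>The series after summation by parts. In this form it has a summable majorant uniform in
  \<sigma> from 1 to 2, while the original series at 1 need not converge absolutely.\<close>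

definition abel_term :: "real \<Rightarrow> nat \<Rightarrow> real" where
  "abel_term \<sigma> n = (\<Sum>k<Suc n. c (Suc k)) * (real (Suc n) powr (-\<sigma>) - real (Suc (Suc n)) powr (-\<sigma>))"

lemma abel_term_bound:
  assumes "1 \<le> \<sigma>" "\<sigma> \<le> 2"
  shows "\<bar>abel_term \<sigma> n\<bar> \<le> 2 * D * real (Suc n) powr (-2)"
proof -
  define x where "x = real (Suc n)"
  have x: "x \<ge> 1" by (simp add: x_def)
  have "\<exists>z>x. z < x + 1 \<and> (x + 1) powr (-\<sigma>) - x powr (-\<sigma>) = (x + 1 - x) * (- \<sigma> * z powr (-\<sigma> - 1))"
    using x by (intro MVT2) (auto intro!: derivative_eq_intros)
  then obtain z where z: "z > x" "(x + 1) powr (-\<sigma>) - x powr (-\<sigma>) = - \<sigma> * z powr (-\<sigma> - 1)"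
    by auto
  have "z powr (-\<sigma> - 1) \<le> x powr (-\<sigma> - 1)"
    using z x assms by (intro powr_mono2') auto
  also have "\<dots> \<le> x powr (-2)"
    using x assms by (intro powr_mono) auto
  finally have "\<sigma> * z powr (-\<sigma> - 1) \<le> 2 * x powr (-2)"
    using assms by (intro mult_mono) auto
  then have "\<bar>x powr (-\<sigma>) - (x + 1) powr (-\<sigma>)\<bar> \<le> 2 * x powr (-2)"
  proof -
    have "\<sigma> * z powr (-\<sigma> - 1) \<ge> 0" using assms by simp
    moreover have "x powr (-\<sigma>) - (x + 1) powr (-\<sigma>) = \<sigma> * z powr (-\<sigma> - 1)"
      using z(2) by simp
    ultimately show ?thesis using \<open>\<sigma> * z powr (-\<sigma> - 1) \<le> 2 * x powr (-2)\<close> by simp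
  qed
  then have "\<bar>abel_term \<sigma> n\<bar> \<le> D * (2 * x powr (-2))"
    unfolding abel_term_def abs_mult using partial_sums[of "Suc n"] D_nonneg
    by (intro mult_mono) (auto simp: x_def add_ac)
  then show ?thesis by (simp add: x_def mult_ac)
qed

lemma summable_abel_bound: "summable (\<lambda>n. 2 * D * real (Suc n) powr (-2))"
  by (intro summable_mult, subst summable_Suc_iff) (simp add: summable_real_powr_iff)

lemma sums_abel_term:
  assumes "1 \<le> \<sigma>" "\<sigma> \<le> 2"
  shows "(\<lambda>n. c (Suc n) * real (Suc n) powr (-\<sigma>)) sums (\<Sum>n. abel_term \<sigma> n)"
proof -
  have "summable (abel_term \<sigma>)"
    by (rule summable_comparison_test'[OF summable_abel_bound]) (use abel_term_bound[OF assms] in auto)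
  then have 1: "(\<lambda>N. \<Sum>n<N. abel_term \<sigma> n) \<longlonglongrightarrow> (\<Sum>n. abel_term \<sigma> n)"
    by (rule summable_LIMSEQ)
  have 2: "(\<lambda>N. (\<Sum>k<N. c (Suc k)) * real (Suc N) powr (-\<sigma>)) \<longlonglongrightarrow> 0"
  proof (rule Lim_null_comparison)
    show "eventually (\<lambda>N. norm ((\<Sum>k<N. c (Suc k)) * real (Suc N) powr (-\<sigma>)) \<le> D * real (Suc N) powr (-\<sigma>)) sequentially"
    proof (intro always_eventually allI)
      fix N
      show "norm ((\<Sum>k<N. c (Suc k)) * real (Suc N) powr (-\<sigma>)) \<le> D * real (Suc N) powr (-\<sigma>)"
        using mult_right_mono[OF partial_sums[of N], of "real (Suc N) powr (-\<sigma>)"]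
        by (simp add: abs_mult)
    qed
    show "(\<lambda>N. D * real (Suc N) powr (-\<sigma>)) \<longlonglongrightarrow> 0"
      using assms by real_asymp
  qed
  have "(\<Sum>n<N. c (Suc n) * real (Suc n) powr (-\<sigma>)) =
      (\<Sum>n<N. abel_term \<sigma> n) + (\<Sum>k<N. c (Suc k)) * real (Suc N) powr (-\<sigma>)" for N
    by (induction N) (auto simp: abel_term_def algebra_simps)
  then show ?thesis
    unfolding sums_def using tendsto_add[OF 1 2] by simp
qed

text \<open>This is L(1), encoded by the rearranged series so that continuity from the right follows
  by dominated convergence.\<close>

definition value_at_1 :: real where
  "value_at_1 = (\<Sum>n. abel_term 1 n)"

lemma sums_value_at_1: "(\<lambda>n. c (Suc n) / real (Suc n)) sums value_at_1"
  using sums_abel_term[of 1] by (simp add: value_at_1_def powr_minus divide_inverse)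

lemma series_tendsto_value_at_1:
  "((\<lambda>\<sigma>. dirichlet_series c (of_real \<sigma>)) \<longlongrightarrow> of_real value_at_1) (at_right 1)"
proof -
  have lim: "((\<lambda>\<sigma>. abel_term \<sigma> n) \<longlongrightarrow> abel_term 1 n) (at_right 1)" for n
    unfolding abel_term_def by (intro tendsto_intros) auto
  have "eventually (\<lambda>(n,\<sigma>). norm (abel_term \<sigma> n) \<le> 2 * D * real (Suc n) powr (-2)) (at_top \<times>\<^sub>F at_right 1)"
    unfolding eventually_prod_filter
  proof (intro exI conjI allI impI)
    show "eventually (\<lambda>n::nat. True) at_top" by simp
    show "eventually (\<lambda>\<sigma>::real. \<sigma> \<in> {1<..<2}) (at_right 1)" by (rule eventually_at_right_real) simp
    fix n :: nat and \<sigma> :: real assume "\<sigma> \<in> {1<..<2}"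
    then show "case (n, \<sigma>) of (n,\<sigma>) \<Rightarrow> norm (abel_term \<sigma> n) \<le> 2 * D * real (Suc n) powr (-2)"
      using abel_term_bound[of \<sigma> n] by auto
  qed
  then have "((\<lambda>\<sigma>. \<Sum>n. abel_term \<sigma> n) \<longlongrightarrow> value_at_1) (at_right 1)"
    unfolding value_at_1_def using tannerys_theorem[OF lim _ summable_abel_bound] by auto
  then have "((\<lambda>\<sigma>. complex_of_real (\<Sum>n. abel_term \<sigma> n)) \<longlongrightarrow> of_real value_at_1) (at_right 1)"
    by (intro tendsto_of_real)
  moreover have "eventually (\<lambda>\<sigma>. complex_of_real (\<Sum>n. abel_term \<sigma> n) = dirichlet_series c (of_real \<sigma>)) (at_right 1)"
  proof (rule eventually_mono)
    show "eventually (\<lambda>\<sigma>::real. \<sigma> \<in> {1<..<2}) (at_right 1)" by (rule eventually_at_right_real) simp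
    fix \<sigma> :: real assume \<sigma>: "\<sigma> \<in> {1<..<2}"
    have "(\<lambda>n. of_real (c (Suc n)) * of_nat (Suc n) powr (- of_real \<sigma>)) sums dirichlet_series c (of_real \<sigma>)"
      using dirichlet_series_sums[OF abs_conv_char, of "of_real \<sigma>"] \<sigma> by (subst sums_Suc_iff) simp
    moreover have "(\<lambda>n. of_real (c (Suc n) * real (Suc n) powr (-\<sigma>))) sums complex_of_real (\<Sum>n. abel_term \<sigma> n)"
      using sums_abel_term[of \<sigma>] \<sigma> by (intro sums_of_real) auto
    moreover have "complex_of_real (c (Suc n) * real (Suc n) powr (-\<sigma>)) =
        of_real (c (Suc n)) * of_nat (Suc n) powr (- of_real \<sigma>)" for n
      using powr_of_real[of "real (Suc n)" "-\<sigma>"] by simp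
    ultimately show "complex_of_real (\<Sum>n. abel_term \<sigma> n) = dirichlet_series c (of_real \<sigma>)"
      using sums_unique2 by (simp only:) blast
  qed
  ultimately show ?thesis
    by (rule Lim_transform_eventually)
qed

text \<open>There is no pole, so L' is bounded near 1 and L stays within half of |L(1)| of L(1) in a
  small box; this provides the lower bound that the 3-4-1 inequality cannot give there.\<close>

lemma char_mangoldt_bound:
  assumes nz: "value_at_1 \<noteq> 0"
  obtains C r where "C > 0" "0 < r" "r \<le> 1"
    "\<And>s. 1 < Re s \<Longrightarrow> Re s \<le> 1 + r \<Longrightarrow>
       norm (dirichlet_series (\<lambda>n. c n * mangoldt n) s) \<le> C * (1 + \<bar>Im s\<bar>) ^ 10 \<and>
       norm (dirichlet_series (\<lambda>n. c n * mangoldt n * ln (real n)) s) \<le> C * (1 + \<bar>Im s\<bar>) ^ 10"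
proof -
  define K where "K = D * suminf ln_powr_variation"
  have K: "K \<ge> 0" using D_nonneg suminf_ln_powr_variation_pos by (simp add: K_def)
  have approx: "norm (dirichlet_series (\<lambda>n. c n * ln (real n) ^ k) s) \<le> K * norm s"
    if "Re s > 1" "k \<le> 2" for k s
    using norm_dirichlet_series_ln_power_le[OF abs_conv_char that partial_sums] by (simp add: K_def)
  define l where "l = \<bar>value_at_1\<bar>"
  have l: "l > 0" using nz by (simp add: l_def)
  \<comment> \<open>Chosen so that 4 K * 2 r \<le> l / 2; the summand 1 covers the case K =
    0.\<close>
  define r where "r = min 1 (l / (16 * K + 1))"
  have r: "0 < r" "r \<le> 1" "r \<le> l / (16 * K + 1)" using K l by (auto simp: r_def)
  \<comment> \<open>The derivative is available only for \<open>Re s > 1\<close>, so the mean value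
    bound is applied from real points \<sigma> and then \<sigma> tends to 1. The 4 comes from |z|
    \<le> 4 on the box.\<close>
  have lip: "norm (dirichlet_series c s - of_real value_at_1) \<le> 4 * K * norm (s - 1)"
    if s: "1 < Re s" "Re s \<le> 2" "\<bar>Im s\<bar> \<le> 1" for s
  proof (rule tendsto_le)
    show "((\<lambda>\<sigma>. norm (dirichlet_series c s - dirichlet_series c (of_real \<sigma>))) \<longlongrightarrow>
      norm (dirichlet_series c s - of_real value_at_1)) (at_right 1)"
      by (intro tendsto_intros series_tendsto_value_at_1)
    show "((\<lambda>\<sigma>::real. 4 * K * norm (s - of_real \<sigma>)) \<longlongrightarrow> 4 * K * norm (s - 1)) (at_right 1)"
      by (rule tendsto_eq_intros refl | simp)+
    have bnd: "norm (dirichlet_series c s - dirichlet_series c (of_real \<sigma>)) \<le> 4 * K * norm (s - of_real \<sigma>)"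
      if \<sigma>: "\<sigma> \<in> {1<..<2}" for \<sigma>
    proof (rule field_differentiable_bound[where S = "closed_segment (of_real \<sigma>) s"])
      fix z assume z: "z \<in> closed_segment (of_real \<sigma>) s"
      have "closed_segment (of_real \<sigma>) s \<subseteq> {z. 1 < Re z} \<inter> {z. Re z \<le> 2} \<inter> {z. Im z \<le> 1} \<inter> {z. Im z \<ge> -1}"
        by (rule closed_segment_subset)
           (use s \<sigma> in \<open>auto intro!: convex_Int convex_halfspace_Re_gt convex_halfspace_Re_le convex_halfspace_Im_le convex_halfspace_Im_ge\<close>)
      with z have zz: "1 < Re z" "Re z \<le> 2" "\<bar>Im z\<bar> \<le> 1" by (auto simp: abs_le_iff)
      show "(dirichlet_series c has_field_derivative - dirichlet_series (\<lambda>n. c n * ln (real n)) z)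
          (at z within closed_segment (of_real \<sigma>) s)"
        by (rule has_field_derivative_at_within[OF has_field_derivative_dirichlet_series])
           (use zz abs_conv_char in auto)
      have "norm (- dirichlet_series (\<lambda>n. c n * ln (real n)) z) \<le> K * norm z"
        using approx[of z 1] zz by simp
      also have "\<dots> \<le> K * 4"
        using norm_le_height[OF zz(1,2)] zz K by (intro mult_left_mono) auto
      finally show "norm (- dirichlet_series (\<lambda>n. c n * ln (real n)) z) \<le> 4 * K" by simp
    qed auto
    show "eventually (\<lambda>\<sigma>. norm (dirichlet_series c s - dirichlet_series c (of_real \<sigma>)) \<le>
        4 * K * norm (s - of_real \<sigma>)) (at_right 1)"
      using eventually_at_right_real[of 1 2] by (rule eventually_mono) (use bnd in auto)
  qed auto
  interpret R: regular_character c 0 K r "l / 2"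
  proof unfold_locales
    show "norm (dirichlet_series (\<lambda>n. c n * ln (real n) ^ k) s - of_real 0 * fact k / (s - 1) ^ Suc k) \<le> K * norm s"
      if "Re s > 1" "k \<le> 2" for k s
      using approx[OF that] by simp
    show "l / 2 \<le> norm (dirichlet_series c s)" if s: "1 < Re s" "Re s \<le> 1 + r" "\<bar>Im s\<bar> \<le> r" for s
    proof -
      have "norm (s - 1) \<le> 2 * r" using cmod_le[of "s - 1"] s by simp
      then have "4 * K * norm (s - 1) \<le> 4 * K * (2 * r)" using K by (intro mult_left_mono) auto
      also have "\<dots> \<le> l / 2"
      proof -
        have "r * (16 * K + 1) \<le> l" using r K by (simp add: pos_le_divide_eq)
        then show ?thesis using r by (simp add: algebra_simps)
      qed
      finally have "norm (dirichlet_series c s - of_real value_at_1) \<le> l / 2"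
        using lip[of s] s r by simp
      moreover have "norm (complex_of_real value_at_1) = l" by (simp add: l_def)
      ultimately show ?thesis
        using norm_triangle_sub[of "complex_of_real value_at_1" "dirichlet_series c s"]
        by (simp add: norm_minus_commute)
    qed
  qed (use r l in auto)
  have A: "2 * K \<ge> 0" using K by simp
  obtain C where C: "C > 0"
    "\<And>s. 1 < Re s \<Longrightarrow> Re s \<le> 1 + r \<Longrightarrow>
       norm (dirichlet_series (\<lambda>n. c n * ln (real n)) s) \<le> 2 * K * (1 + \<bar>Im s\<bar>) \<Longrightarrow>
       norm (dirichlet_series (\<lambda>n. c n * ln (real n) ^ 2) s) \<le> 2 * K * (1 + \<bar>Im s\<bar>) \<Longrightarrow>
       norm (dirichlet_series (\<lambda>n. c n * mangoldt n) s) \<le> C * (1 + \<bar>Im s\<bar>) ^ 10 \<and>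
       norm (dirichlet_series (\<lambda>n. c n * mangoldt n * ln (real n)) s) \<le> C * (1 + \<bar>Im s\<bar>) ^ 10"
    using R.log_derivative_bound[OF A] by blast
  show ?thesis
  proof (rule that[of C r])
    fix s assume s: "1 < Re s" "Re s \<le> 1 + r"
    have "norm (dirichlet_series (\<lambda>n. c n * ln (real n) ^ k) s) \<le> 2 * K * (1 + \<bar>Im s\<bar>)" if "k \<le> 2" for k
    proof -
      have "K * norm s \<le> K * (2 * (1 + \<bar>Im s\<bar>))"
        using norm_le_height[of s] s r K by (intro mult_left_mono) auto
      then show ?thesis using approx[OF s(1) that] by (simp add: mult_ac)
    qed
    from this[of 1] this[of 2] show "norm (dirichlet_series (\<lambda>n. c n * mangoldt n) s) \<le> C * (1 + \<bar>Im s\<bar>) ^ 10 \<and>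
       norm (dirichlet_series (\<lambda>n. c n * mangoldt n * ln (real n)) s) \<le> C * (1 + \<bar>Im s\<bar>) ^ 10"
      by (intro C(2) s) auto
  qed (use r C in auto)
qed

end

section \<open>Nonvanishing at 1\<close>

lemma sum_divisors_coprime_mult:
  fixes f :: "nat \<Rightarrow> real"
  assumes "coprime a b" "a > 0" "b > 0"
  shows "(\<Sum>d | d dvd a * b. f d) = (\<Sum>x | x dvd a. \<Sum>y | y dvd b. f (x * y))"
proof -
  have "(\<Sum>x | x dvd a. \<Sum>y | y dvd b. f (x * y)) = (\<Sum>(x, y) \<in> {x. x dvd a} \<times> {y. y dvd b}. f (x * y))"
    by (rule sum.cartesian_product)
  also have "\<dots> = (\<Sum>d | d dvd a * b. f d)"
  proof (rule sum.reindex_bij_witness[of _ "\<lambda>d. (gcd d a, gcd d b)" "\<lambda>(x, y). x * y"])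
    have gcd: "gcd (x * y) a = x \<and> gcd (x * y) b = y" if xy: "x dvd a" "y dvd b" for x y
    proof -
      have "coprime y a" "coprime x b"
        using assms(1) xy by (meson coprime_commute coprime_divisors dvd_refl)+
      then show ?thesis
        using xy by (simp add: gcd_mult_left_right_cancel gcd_mult_left_left_cancel coprime_commute
            gcd_nat.absorb1)
    qed
    show "(gcd (case xy of (x, y) \<Rightarrow> x * y) a, gcd (case xy of (x, y) \<Rightarrow> x * y) b) = xy"
      if "xy \<in> {x. x dvd a} \<times> {y. y dvd b}" for xy
      using that gcd by auto
    show "(case xy of (x, y) \<Rightarrow> x * y) \<in> {d. d dvd a * b}"
      if "xy \<in> {x. x dvd a} \<times> {y. y dvd b}" for xy
      using that by (auto intro: mult_dvd_mono)
    show "(case (gcd d a, gcd d b) of (x, y) \<Rightarrow> x * y) = d" if "d \<in> {d. d dvd a * b}" for d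
    proof -
      from that obtain x y where "d = x * y" "x dvd a" "y dvd b"
        using division_decomp[of d a b] by auto
      then show ?thesis using gcd by simp
    qed
  qed auto
  finally show ?thesis ..
qed

section \<open>Divisor sums of \<open>c\<close> and their Lambert series\<close>

context sign_character
begin

lemma char_power: "c (p ^ k) = c p ^ k"
  by (induction k) (use one mult in auto)

lemma sum_divisors_prime_power:
  assumes "prime p"
  shows "(\<Sum>d | d dvd p ^ k. c d) = (\<Sum>i\<le>k. c p ^ i)"
proof -
  have "{d. d dvd p ^ k} = (\<lambda>i. p ^ i) ` {..k}"
    using assms by (auto simp: divides_primepow_nat le_imp_power_dvd)
  moreover have "inj_on (\<lambda>i. p ^ i) {..k}"
    using assms prime_gt_1_nat by (auto intro!: inj_onI)
  ultimately show ?thesis by (simp add: sum.reindex char_power)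
qed

text \<open>The sum is k + 1, 1, or the indicator of even k, according to whether c(p) is 1, 0 or
  -1.\<close>

lemma sum_divisors_prime_power_bounds:
  assumes "prime p"
  shows "(\<Sum>d | d dvd p ^ k. c d) \<ge> 0" "even k \<Longrightarrow> (\<Sum>d | d dvd p ^ k. c d) \<ge> 1"
proof -
  have neg: "(\<Sum>i\<le>k. (-1 :: real) ^ i) = (if even k then 1 else 0)"
    by (induction k) auto
  have zero: "(\<Sum>i\<le>k. (0 :: real) ^ i) = 1"
    by (induction k) auto
  show "(\<Sum>d | d dvd p ^ k. c d) \<ge> 0" "even k \<Longrightarrow> (\<Sum>d | d dvd p ^ k. c d) \<ge> 1"
    using vals[of p] by (auto simp: sum_divisors_prime_power[OF assms] neg zero)
qed

text \<open>One prime is split off completely. The exponent j serves two inductions: j = 1 for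
  nonnegativity, j = 2 for the values at squares.\<close>

lemma sum_divisors_decompose:
  assumes "n > 1"
  obtains p k n' where "prime p" "n = p ^ k * n'" "n' > 0" "n' < n"
    "\<And>j. j > 0 \<Longrightarrow> (\<Sum>d | d dvd n ^ j. c d) = (\<Sum>d | d dvd p ^ (j * k). c d) * (\<Sum>d | d dvd n' ^ j. c d)"
proof -
  obtain p where p: "prime p" "p dvd n" using assms prime_factor_nat[of n] by auto
  obtain n' where n': "n = p ^ multiplicity p n * n'" "\<not> p dvd n'"
    using multiplicity_decompose'[of n p] assms p by (metis not_prime_unit not_one_less_zero)
  define k where "k = multiplicity p n"
  have k: "k > 0" using p assms by (auto simp: k_def prime_multiplicity_gt_zero_iff)
  have n0: "n' > 0" using n' assms by (cases "n' = 0") auto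
  have "p ^ k > 1" by (rule one_less_power[OF prime_gt_1_nat[OF p(1)] k])
  then have "n' < n" using n'(1) n0 by (simp add: k_def[symmetric])
  moreover have "(\<Sum>d | d dvd n ^ j. c d) = (\<Sum>d | d dvd p ^ (j * k). c d) * (\<Sum>d | d dvd n' ^ j. c d)" for j
  proof -
    have "coprime (p ^ (j * k)) (n' ^ j)"
      using prime_imp_coprime[OF p(1) n'(2)] by simp
    moreover have "n ^ j = p ^ (j * k) * n' ^ j"
      using n'(1) by (metis k_def mult.commute power_mult power_mult_distrib)
    ultimately have "(\<Sum>d | d dvd n ^ j. c d) = (\<Sum>x | x dvd p ^ (j * k). \<Sum>y | y dvd n' ^ j. c (x * y))"
      using p n0 by (simp add: sum_divisors_coprime_mult prime_gt_0_nat)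
    then show ?thesis by (simp add: mult sum_product)
  qed
  ultimately show ?thesis using that[of p k n'] p n' n0 k_def by blast
qed

lemma sum_divisors_nonneg:
  assumes "n > 0" 
  shows "(\<Sum>d | d dvd n. c d) \<ge> 0"
  using assms
proof (induction n rule: less_induct)
  case (less n)
  show ?case
  proof (cases "n > 1")
    case True
    then obtain p k n' where *: "prime p" "n = p ^ k * n'" "n' > 0" "n' < n"
      "\<And>j. j > 0 \<Longrightarrow> (\<Sum>d | d dvd n ^ j. c d) = (\<Sum>d | d dvd p ^ (j * k). c d) * (\<Sum>d | d dvd n' ^ j. c d)"
      using sum_divisors_decompose by metis
    show ?thesis
      using *(5)[of 1] less.IH[OF *(4,3)] sum_divisors_prime_power_bounds(1)[OF *(1), of k] by simp
  next
    case False
    then have "n = 1" using less by simp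
    then show ?thesis using one by simp
  qed
qed

lemma sum_divisors_square:
  assumes "n > 0"
  shows "(\<Sum>d | d dvd n ^ 2. c d) \<ge> 1"
  using assms
proof (induction n rule: less_induct)
  case (less n)
  show ?case
  proof (cases "n > 1")
    case True
    then obtain p k n' where *: "prime p" "n = p ^ k * n'" "n' > 0" "n' < n"
      "\<And>j. j > 0 \<Longrightarrow> (\<Sum>d | d dvd n ^ j. c d) = (\<Sum>d | d dvd p ^ (j * k). c d) * (\<Sum>d | d dvd n' ^ j. c d)"
      using sum_divisors_decompose by metis
    have "1 * 1 \<le> (\<Sum>d | d dvd p ^ (2 * k). c d) * (\<Sum>d | d dvd n' ^ 2. c d)"
      using less.IH[OF *(4,3)] sum_divisors_prime_power_bounds(2)[OF *(1), of "2 * k"] by (intro mult_mono) auto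
    then show ?thesis using *(5)[of 2] by simp
  next
    case False
    then have "n = 1" using less by simp
    then show ?thesis using one by simp
  qed
qed

text \<open>Expanding each quotient as a geometric series gives the double sum of c(n) t^(nk);
  collecting equal products nk produces the divisor sums. Absolute summability follows from c(n)
  being bounded by 1.\<close>

lemma lambert_has_sum:
  fixes t :: real
  assumes t: "0 < t" "t < 1"
  shows "((\<lambda>n. (\<Sum>d | d dvd n. c d) * t ^ n) has_sum (\<Sum>n. c (Suc n) * (t ^ Suc n / (1 - t ^ Suc n)))) {1..}"
proof -
  let ?A = "{1..} :: nat set"
  have tn: "t ^ n < 1" if "n \<ge> 1" for n using t that by (simp add: power_less_one_iff)
  have inner: "((\<lambda>k. c n * t ^ (n * k)) has_sum (c n * (t ^ n / (1 - t ^ n)))) ?A" if "n \<ge> 1" for n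
    using has_sum_geometric_from_1[of "t ^ n"] tn[OF that] t
    by (intro has_sum_cmult_right) (simp add: power_mult)
  have inner': "((\<lambda>k. norm (c n * t ^ (n * k))) has_sum (\<bar>c n\<bar> * (t ^ n / (1 - t ^ n)))) ?A" if "n \<ge> 1" for n
  proof -
    have "((\<lambda>k. \<bar>c n\<bar> * (t ^ n) ^ k) has_sum (\<bar>c n\<bar> * (t ^ n / (1 - t ^ n)))) ?A"
      using has_sum_geometric_from_1[of "t ^ n"] tn[OF that] t by (intro has_sum_cmult_right) simp
    then show ?thesis using t by (simp add: abs_mult power_mult)
  qed
  have bound: "\<bar>c n\<bar> * (t ^ n / (1 - t ^ n)) \<le> t ^ n / (1 - t)" if "n \<ge> 1" for n
  proof -
    have "t ^ n \<le> t ^ 1" using t that by (intro power_decreasing) auto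
    then have "t ^ n / (1 - t ^ n) \<le> t ^ n / (1 - t)" using t tn[OF that] by (intro divide_left_mono) auto
    moreover have "\<bar>c n\<bar> * (t ^ n / (1 - t ^ n)) \<le> 1 * (t ^ n / (1 - t ^ n))"
      using abs_le_1 t tn[OF that] by (intro mult_right_mono) auto
    ultimately show ?thesis by simp
  qed
  have geo: "summable (\<lambda>n. t ^ Suc n / (1 - t))"
    using t by (intro summable_divide, subst summable_Suc_iff) (simp add: summable_geometric)
  have outer: "summable (\<lambda>n. norm (\<bar>c (Suc n)\<bar> * (t ^ Suc n / (1 - t ^ Suc n))))"
  proof (rule summable_comparison_test'[OF geo])
    fix n
    have "\<bar>c (Suc n)\<bar> * (t ^ Suc n / (1 - t ^ Suc n)) \<ge> 0"
      using t tn[of "Suc n"] by (intro mult_nonneg_nonneg divide_nonneg_nonneg) auto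
    then show "norm (norm (\<bar>c (Suc n)\<bar> * (t ^ Suc n / (1 - t ^ Suc n)))) \<le> t ^ Suc n / (1 - t)"
      using bound[of "Suc n"] by (simp only: real_norm_def abs_of_nonneg)
  qed
  have shift: "(f has_sum S) ?A \<longleftrightarrow> ((\<lambda>n. f (Suc n)) has_sum S) UNIV" for f :: "nat \<Rightarrow> real" and S
    by (rule has_sum_reindex_bij_witness[of _ Suc "\<lambda>n. n - 1"]) auto
  have summ: "(\<lambda>n. norm (\<bar>c n\<bar> * (t ^ n / (1 - t ^ n)))) summable_on ?A"
    using norm_summable_imp_summable_on[of "\<lambda>n. norm (\<bar>c (Suc n)\<bar> * (t ^ Suc n / (1 - t ^ Suc n)))"] outer
    unfolding summable_on_def shift by simp
  have "(\<lambda>x. norm (case x of (n, k) \<Rightarrow> c n * t ^ (n * k))) summable_on (?A \<times> ?A)"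
  proof (subst Infinite_Sum.abs_summable_on_Sigma_iff, intro conjI ballI)
    show "(\<lambda>k. norm (case (n, k) of (n, k) \<Rightarrow> c n * t ^ (n * k))) summable_on ?A" if "n \<in> ?A" for n
      using inner'[of n] that by (auto simp: summable_on_def)
    have "(\<Sum>\<^sub>\<infinity>k\<in>?A. norm (case (n, k) of (n, k) \<Rightarrow> c n * t ^ (n * k))) = \<bar>c n\<bar> * (t ^ n / (1 - t ^ n))" if "n \<in> ?A" for n
      using inner'[of n] that by (auto simp: infsumI)
    then show "(\<lambda>n. norm (\<Sum>\<^sub>\<infinity>k\<in>?A. norm (case (n, k) of (n, k) \<Rightarrow> c n * t ^ (n * k)))) summable_on ?A"
      using summ by (subst summable_on_cong) auto
  qed
  then have s: "(\<lambda>(n, k). c n * t ^ (n * k)) summable_on (?A \<times> ?A)"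
    by (rule abs_summable_summable)
  have "((\<lambda>n. c n * (t ^ n / (1 - t ^ n))) has_sum (\<Sum>n. c (Suc n) * (t ^ Suc n / (1 - t ^ Suc n)))) ?A"
    unfolding shift
  proof (rule norm_summable_imp_has_sum)
    show "summable (\<lambda>n. norm (c (Suc n) * (t ^ Suc n / (1 - t ^ Suc n))))"
      using outer by (simp add: abs_mult)
    then show "(\<lambda>n. c (Suc n) * (t ^ Suc n / (1 - t ^ Suc n))) sums (\<Sum>n. c (Suc n) * (t ^ Suc n / (1 - t ^ Suc n)))"
      by (rule summable_sums[OF summable_norm_cancel])
  qed
  then have "((\<lambda>(n, k). c n * t ^ (n * k)) has_sum (\<Sum>n. c (Suc n) * (t ^ Suc n / (1 - t ^ Suc n)))) (?A \<times> ?A)"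
    using inner by (intro has_sum_SigmaI[OF _ _ s, where g = "\<lambda>n. c n * (t ^ n / (1 - t ^ n))"]) auto
  also have "?this \<longleftrightarrow> ((\<lambda>(n, d). c d * t ^ n) has_sum (\<Sum>n. c (Suc n) * (t ^ Suc n / (1 - t ^ Suc n))))
                    (SIGMA n:?A. {d. d dvd n})"
  proof -
    have A: "?A = {0<..}" by auto
    show ?thesis unfolding A
      by (rule has_sum_reindex_bij_witness[of _ "\<lambda>(n,d). (d, n div d)" "\<lambda>(m,k). (m * k, m)"])
         (auto elim!: dvdE)
  qed
  finally have "((\<lambda>n. \<Sum>d | d dvd n. c d * t ^ n) has_sum (\<Sum>n. c (Suc n) * (t ^ Suc n / (1 - t ^ Suc n)))) ?A"
    by (rule has_sum_SigmaD) (auto intro!: has_sum_finite)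
  then show ?thesis by (simp add: sum_distrib_right)
qed

end

section \<open>Monotone weights for Monsky's argument\<close>

lemma abs_sum_mult_decseq_le:
  fixes c b :: "nat \<Rightarrow> real"
  assumes "\<And>N. \<bar>\<Sum>n<N. c n\<bar> \<le> D" "\<And>n. b (Suc n) \<le> b n" "\<And>n. b n \<ge> 0"
  shows "\<bar>\<Sum>n<N. c n * b n\<bar> \<le> D * b 0"
proof -
  let ?C = "\<lambda>N. \<Sum>n<N. c n"
  have "(\<Sum>n<N. c n * b n) = ?C N * b N + (\<Sum>n<N. ?C (Suc n) * (b n - b (Suc n)))"
    by (induction N) (simp_all add: algebra_simps)
  also have "\<bar>\<dots>\<bar> \<le> \<bar>?C N * b N\<bar> + (\<Sum>n<N. \<bar>?C (Suc n) * (b n - b (Suc n))\<bar>)"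
    by (intro order_trans[OF abs_triangle_ineq] add_mono sum_abs order_refl)
  also have "\<dots> \<le> D * b N + (\<Sum>n<N. D * (b n - b (Suc n)))"
    unfolding abs_mult using assms(2,3) order_trans[OF abs_ge_zero assms(1)]
    by (intro add_mono sum_mono mult_mono assms(1)) auto
  also have "\<dots> = D * b 0"
    by (simp only: sum_distrib_left[symmetric] sum_lessThan_telescope') (simp add: algebra_simps)
  finally show ?thesis .
qed

text \<open>By the inequality of the means, pairing t^i with t^(n-1-i) gives at least n t^((n-1)/2)
  for each geometric sum. The two exponents add up to n - 1/2, and t^n \<le> t^(n-1/2).\<close>

lemma geometric_sum_ge:
  fixes t :: real
  assumes t: "0 < t" "t < 1" and n: "n \<ge> 1"
  shows "real n * real (Suc n) * t ^ n \<le> (\<Sum>i<n. t ^ i) * (\<Sum>i<Suc n. t ^ i)"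
proof -
  have am: "real n * t powr ((real n - 1) / 2) \<le> (\<Sum>i<n. t ^ i)" if "n \<ge> 1" for n
  proof -
    have "2 * t powr ((real n - 1) / 2) \<le> t ^ i + t ^ (n - Suc i)" if "i < n" for i
    proof -
      have "t ^ i = t powr real i" "t ^ (n - Suc i) = t powr (real n - 1 - real i)"
        using t that by (auto simp: powr_realpow[symmetric] of_nat_diff algebra_simps)
      moreover have "2 * (t powr (real i / 2) * t powr ((real n - 1 - real i) / 2)) \<le>
         (t powr (real i / 2)) ^ 2 + (t powr ((real n - 1 - real i) / 2)) ^ 2"
        using sum_squares_bound[of "t powr (real i / 2)" "t powr ((real n - 1 - real i) / 2)"] by simp
      moreover have "t powr (real i / 2) * t powr ((real n - 1 - real i) / 2) = t powr ((real n - 1) / 2)"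
        by (simp add: powr_add[symmetric] add_divide_distrib[symmetric])
      moreover have "(t powr (real i / 2)) ^ 2 = t powr real i"
        "(t powr ((real n - 1 - real i) / 2)) ^ 2 = t powr (real n - 1 - real i)"
        by (simp_all add: power2_eq_square powr_add[symmetric])
      ultimately show ?thesis by simp
    qed
    then have "(\<Sum>i<n. 2 * t powr ((real n - 1) / 2)) \<le> (\<Sum>i<n. t ^ i + t ^ (n - Suc i))"
      by (intro sum_mono) auto
    also have "\<dots> = 2 * (\<Sum>i<n. t ^ i)"
      using sum.nat_diff_reindex[of "\<lambda>i. t ^ i" n] by (simp add: sum.distrib)
    finally show ?thesis by simp
  qed
  have "real n * real (Suc n) * t ^ n \<le> real n * real (Suc n) * t powr (real n - 1 / 2)"
    using t powr_mono'[of "real n - 1/2" "real n" t] by (intro mult_left_mono) (auto simp: powr_realpow)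
  also have "\<dots> = (real n * t powr ((real n - 1) / 2)) * (real (Suc n) * t powr ((real (Suc n) - 1) / 2))"
    by (simp add: powr_add[symmetric] algebra_simps flip: add_divide_distrib) (simp add: field_simps)
  also have "\<dots> \<le> (\<Sum>i<n. t ^ i) * (\<Sum>i<Suc n. t ^ i)"
    using am[of n] am[of "Suc n"] n t by (intro mult_mono) (auto intro!: sum_nonneg)
  finally show ?thesis .
qed

text \<open>With p, q the geometric sums of lengths n and n + 1, the Lambert quotients differ by t^n
  / ((1-t) p q) and the harmonic terms by 1 / ((1-t) n (n+1)), so the claim is
  \<open>geometric_sum_ge\<close>.\<close>

lemma lambert_difference_antimono:
  fixes t :: real
  assumes t: "0 < t" "t < 1" and n: "n \<ge> 1"
  defines "b \<equiv> \<lambda>n. 1 / (real n * (1 - t)) - t ^ n / (1 - t ^ n)"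
  shows "b (Suc n) \<le> b n"
proof -
  define p q where "p = (\<Sum>i<n. t ^ i)" and "q = (\<Sum>i<Suc n. t ^ i)"
  have p: "1 - t ^ n = (1 - t) * p" and q: "1 - t ^ Suc n = (1 - t) * q"
    using one_diff_power_eq[of t n] one_diff_power_eq[of t "Suc n"] by (simp_all only: p_def q_def)
  have tn: "t ^ n < 1" "t ^ Suc n < 1" using t n by (simp_all add: power_less_one_iff del: power_Suc)
  have pos: "p > 0" "q > 0"
    using p q tn t by (smt (verit, best) zero_less_mult_pos)+
  have "t ^ n / (1 - t ^ n) - t ^ Suc n / (1 - t ^ Suc n) = t ^ n / ((1 - t) * (p * q))"
  proof -
    have "t ^ n / (1 - t ^ n) - t ^ Suc n / (1 - t ^ Suc n) = 1 / (1 - t ^ n) - 1 / (1 - t ^ Suc n)"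
    proof -
      have "x / (1 - x) = 1 / (1 - x) - 1" if "x < 1" for x :: real
        using that by (simp add: field_simps)
      then show ?thesis using tn by simp
    qed
    also have "\<dots> = ((1 - t ^ Suc n) - (1 - t ^ n)) / ((1 - t ^ n) * (1 - t ^ Suc n))"
      using tn by (subst diff_frac_eq) (auto simp del: power_Suc)
    also have "(1 - t ^ Suc n) - (1 - t ^ n) = (1 - t) * t ^ n" by (simp add: algebra_simps)
    finally show ?thesis unfolding p q using t by simp
  qed
  also have "\<dots> \<le> 1 / ((1 - t) * (real n * real (Suc n)))"
  proof -
    have "real n * real (Suc n) * t ^ n \<le> p * q"
      using geometric_sum_ge[OF t n] by (simp add: p_def q_def)
    then have "t ^ n / (p * q) \<le> 1 / (real n * real (Suc n))"
      using pos n by (simp add: divide_simps mult_ac del: of_nat_Suc)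
    then have "1 / (1 - t) * (t ^ n / (p * q)) \<le> 1 / (1 - t) * (1 / (real n * real (Suc n)))"
      using t by (intro mult_left_mono) auto
    then show ?thesis by simp
  qed
  also have "\<dots> = 1 / (real n * (1 - t)) - 1 / (real (Suc n) * (1 - t))"
  proof -
    define x v w where "x = 1 - t" and "v = real n" and "w = real (Suc n)"
    have pos: "x > 0" "v > 0" "w > 0" and vw: "w - v = 1"
      using t n by (simp_all add: x_def v_def w_def)
    from pos have "1 / (v * x) - 1 / (w * x) = (w - v) / (x * (v * w))"
      by (simp add: field_simps)
    then show ?thesis unfolding vw unfolding x_def v_def w_def by simp
  qed
  finally show ?thesis by (simp add: b_def del: power_Suc of_nat_Suc)
qed

context nonprincipal_character
begin

text \<open>Monsky's argument: if \<open>L(1) = 0\<close> then the Lambert series of \<open>c\<close> stays bounded as \<open>t \<rightarrow> 1\<close>,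
  whereas its power series has nonnegative coefficients that are at least 1 at the squares.\<close>

theorem value_at_1_nonzero: "value_at_1 \<noteq> 0"
proof
  assume zero: "value_at_1 = 0"
  have bounded: "(\<Sum>j=1..J. t ^ (j ^ 2)) \<le> D" if t: "0 < t" "t < 1" for t :: real and J :: nat
  proof -
    \<comment> \<open>The first summand contributes L(1) / (1 - t), which is zero by assumption, so
      it turns the Lambert weights into a decreasing null sequence at no cost. Since b(1) = 1 for
      every t, Abel's inequality gives the bound D uniformly in t.\<close>
    define b where "b = (\<lambda>n. 1 / (real n * (1 - t)) - t ^ n / (1 - t ^ n))"
    have tn: "t ^ n < 1" if "n \<ge> 1" for n using t that by (simp add: power_less_one_iff)
    have mono: "b (Suc n) \<le> b n" if "n \<ge> 1" for n
      unfolding b_def by (rule lambert_difference_antimono[OF t that])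
    have lim: "b \<longlonglongrightarrow> 0"
      unfolding b_def using t by real_asymp
    have dec: "decseq (\<lambda>n. b (Suc n))" by (intro decseq_SucI mono) auto
    have nonneg: "b (Suc n) \<ge> 0" for n
      using decseq_ge[OF dec LIMSEQ_Suc[OF lim]] by simp
    have b1: "b (Suc 0) = 1" using t by (simp add: b_def field_simps)
    have le: "\<bar>\<Sum>n<N. c (Suc n) * b (Suc n)\<bar> \<le> D * 1" for N
      using abs_sum_mult_decseq_le[of "\<lambda>n. c (Suc n)" D "\<lambda>n. b (Suc n)" N] partial_sums mono nonneg b1
      by simp
    have hs: "((\<lambda>n. (\<Sum>d | d dvd n. c d) * t ^ n) has_sum (\<Sum>n. c (Suc n) * (t ^ Suc n / (1 - t ^ Suc n)))) {1..}"
      by (rule lambert_has_sum[OF t])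
    have geo: "summable (\<lambda>n. t ^ Suc n / (1 - t))"
      using t by (intro summable_divide, subst summable_Suc_iff) (simp add: summable_geometric)
    have "summable (\<lambda>n. c (Suc n) * (t ^ Suc n / (1 - t ^ Suc n)))"
    proof (rule summable_comparison_test'[OF geo])
      fix n :: nat
      have "t ^ Suc n \<le> t ^ 1" using t by (intro power_decreasing) auto
      then have "t ^ Suc n / (1 - t ^ Suc n) \<le> t ^ Suc n / (1 - t)"
        using t tn[of "Suc n"] by (intro divide_left_mono) auto
      moreover have "\<bar>c (Suc n)\<bar> * (t ^ Suc n / (1 - t ^ Suc n)) \<le> 1 * (t ^ Suc n / (1 - t ^ Suc n))"
        using abs_le_1 t tn[of "Suc n"] by (intro mult_right_mono) auto
      moreover have "norm (c (Suc n) * (t ^ Suc n / (1 - t ^ Suc n))) = \<bar>c (Suc n)\<bar> * (t ^ Suc n / (1 - t ^ Suc n))"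
        using t tn[of "Suc n"] by (simp add: abs_mult del: power_Suc)
      ultimately show "norm (c (Suc n) * (t ^ Suc n / (1 - t ^ Suc n))) \<le> t ^ Suc n / (1 - t)"
        by linarith
    qed
    then have "(\<lambda>n. c (Suc n) / real (Suc n) * (1 / (1 - t)) - c (Suc n) * (t ^ Suc n / (1 - t ^ Suc n))) sums
        (value_at_1 * (1 / (1 - t)) - (\<Sum>n. c (Suc n) * (t ^ Suc n / (1 - t ^ Suc n))))"
      by (intro sums_diff sums_mult2 sums_value_at_1 summable_sums)
    then have "(\<lambda>n. c (Suc n) * b (Suc n)) sums (- (\<Sum>n. c (Suc n) * (t ^ Suc n / (1 - t ^ Suc n))))"
      by (simp add: zero b_def right_diff_distrib del: power_Suc of_nat_Suc)
    then have "\<bar>- (\<Sum>n. c (Suc n) * (t ^ Suc n / (1 - t ^ Suc n)))\<bar> \<le> D"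
      unfolding sums_def using le by (intro LIMSEQ_le_const2[OF tendsto_rabs]) auto
    then have upper: "(\<Sum>n. c (Suc n) * (t ^ Suc n / (1 - t ^ Suc n))) \<le> D" by linarith
    have "(\<Sum>j=1..J. t ^ (j ^ 2)) \<le> (\<Sum>j=1..J. (\<Sum>d | d dvd j ^ 2. c d) * t ^ (j ^ 2))"
    proof (rule sum_mono)
      fix j assume "j \<in> {1..J}"
      then have "1 * t ^ (j ^ 2) \<le> (\<Sum>d | d dvd j ^ 2. c d) * t ^ (j ^ 2)"
        using t by (intro mult_right_mono sum_divisors_square) auto
      then show "t ^ (j ^ 2) \<le> (\<Sum>d | d dvd j ^ 2. c d) * t ^ (j ^ 2)" by simp
    qed
    also have "\<dots> = (\<Sum>n\<in>(\<lambda>j. j ^ 2) ` {1..J}. (\<Sum>d | d dvd n. c d) * t ^ n)"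
      by (subst sum.reindex) (auto intro!: inj_onI simp: power2_eq_iff)
    also have "\<dots> \<le> (\<Sum>n. c (Suc n) * (t ^ Suc n / (1 - t ^ Suc n)))"
      using t by (intro finite_sum_le_has_sum[OF hs] mult_nonneg_nonneg sum_divisors_nonneg) auto
    finally show ?thesis using upper by simp
  qed
  \<comment> \<open>As t tends to 1 the bound becomes J \<le> D, and J is taken to be larger than
    D.\<close>
  define J where "J = nat \<lceil>D\<rceil> + 1"
  have "(\<Sum>j=1..J. (1::real) ^ (j ^ 2)) \<le> D"
  proof (rule tendsto_upperbound)
    show "((\<lambda>t::real. \<Sum>j=1..J. t ^ (j ^ 2)) \<longlongrightarrow> (\<Sum>j=1..J. 1 ^ (j ^ 2))) (at_left 1)"
      by (intro tendsto_intros)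
    have "eventually (\<lambda>t::real. t \<in> {0<..<1}) (at_left 1)" by (rule eventually_at_left_real) simp
    then show "eventually (\<lambda>t::real. (\<Sum>j=1..J. t ^ (j ^ 2)) \<le> D) (at_left 1)"
      by eventually_elim (use bounded in auto)
  qed auto
  then show False unfolding J_def by simp linarith
qed

end

section \<open>Perron's formula\<close>

lemma contour_integral_rectpath_split:
  assumes f: "continuous_on (path_image (rectpath a1 a3)) f"
  defines "a2 \<equiv> Complex (Re a3) (Im a1)" and "a4 \<equiv> Complex (Re a1) (Im a3)"
  shows "contour_integral (rectpath a1 a3) f =
    contour_integral (linepath a1 a2) f + contour_integral (linepath a2 a3) f +
    contour_integral (linepath a3 a4) f + contour_integral (linepath a4 a1) f"
    and "f contour_integrable_on linepath a1 a2" "f contour_integrable_on linepath a2 a3"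
    "f contour_integrable_on linepath a3 a4" "f contour_integrable_on linepath a4 a1"
proof -
  have img: "path_image (rectpath a1 a3) = closed_segment a1 a2 \<union> closed_segment a2 a3 \<union>
      closed_segment a3 a4 \<union> closed_segment a4 a1"
    by (simp add: rectpath_def Let_def path_image_join Un_assoc a2_def a4_def)
  show i: "f contour_integrable_on linepath a1 a2" "f contour_integrable_on linepath a2 a3"
    "f contour_integrable_on linepath a3 a4" "f contour_integrable_on linepath a4 a1"
    by (rule contour_integrable_continuous_linepath, rule continuous_on_subset[OF f], unfold img, blast)+
  show "contour_integral (rectpath a1 a3) f =
    contour_integral (linepath a1 a2) f + contour_integral (linepath a2 a3) f +
    contour_integral (linepath a3 a4) f + contour_integral (linepath a4 a1) f"
    unfolding rectpath_def Let_def a2_def[symmetric] a4_def[symmetric]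
    using i by (simp add: contour_integrable_join valid_path_join)
qed

definition perron_integrand :: "nat \<Rightarrow> real \<Rightarrow> complex \<Rightarrow> complex" where
  "perron_integrand k y z = exp (of_real y * z) / z ^ Suc k"

text \<open>For k = 0 this is the indicator of u \<ge> 0, as \<open>0 ^ 0 = 1\<close>, so order 0 is
  the ordinary summatory function.\<close>

definition riesz_kernel :: "nat \<Rightarrow> real \<Rightarrow> real" where
  "riesz_kernel k u = (if u \<ge> 0 then u ^ k / fact k else 0)"

lemma residue_perron_integrand: "residue (perron_integrand k y) 0 = of_real (y ^ k / fact k)"
proof -
  have "residue (\<lambda>z. exp (of_real y * z) / z ^ Suc k) 0 = fps_nth (fps_exp (of_real y :: complex)) k"
    by (rule residue_fps_expansion_over_power_at_0) (rule has_fps_expansion_exp)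
  then show ?thesis by (simp add: perron_integrand_def[abs_def] del: power_Suc)
qed

lemma norm_perron_integrand_le:
  assumes "y * Re z \<le> y * \<sigma>" "R \<le> norm z" "R \<ge> 1" "k \<ge> 1"
  shows "norm (perron_integrand k y z) \<le> exp (y * \<sigma>) / R ^ 2"
proof -
  have "R ^ 2 \<le> norm z ^ 2" using assms by (intro power_mono) auto
  also have "\<dots> \<le> norm z ^ Suc k" using assms by (intro power_increasing) auto
  finally have "R ^ 2 \<le> norm z ^ Suc k" .
  then show ?thesis
    unfolding perron_integrand_def norm_divide norm_power using assms
    by (intro frac_le) (auto simp del: power_Suc)
qed

text \<open>The rectangle is closed to the left for y \<ge> 0, where the pole at 0 yields the
  kernel, and to the right for y < 0, where nothing is enclosed. Either way |z| \<ge> R on the three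
  extra sides, of total length 2 \<sigma> + 4 R, and k \<ge> 1 supplies the decay R^-2.\<close>

lemma perron_truncated:
  assumes \<sigma>: "\<sigma> > 0" and R: "R \<ge> 1" and k: "k \<ge> 1"
  shows "norm (integral {-R..R} (\<lambda>t. perron_integrand k y (Complex \<sigma> t)) - 2 * pi * of_real (riesz_kernel k y)) \<le>
           exp (y * \<sigma>) / R ^ 2 * (2 * \<sigma> + 4 * R)"
proof -
  let ?g = "perron_integrand k y"
  have hol: "?g holomorphic_on S" if "0 \<notin> S" for S
    unfolding perron_integrand_def[abs_def] by (intro holomorphic_intros) (use that in auto)
  have line: "contour_integral (linepath (Complex \<sigma> (-R)) (Complex \<sigma> R)) ?g =
      \<i> * integral {-R..R} (\<lambda>t. ?g (Complex \<sigma> t))"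
    by (rule contour_integral_linepath_same_Re) (use R in auto)
  have side: "norm (contour_integral (linepath u v) ?g) \<le> exp (y * \<sigma>) / R ^ 2 * L"
    if "?g contour_integrable_on linepath u v"
      "\<And>z. z \<in> closed_segment u v \<Longrightarrow> y * Re z \<le> y * \<sigma> \<and> R \<le> norm z" "norm (v - u) \<le> L" for u v L
  proof -
    have "norm (contour_integral (linepath u v) ?g) \<le> exp (y * \<sigma>) / R ^ 2 * norm (v - u)"
      using that(2) R k
      by (intro contour_integral_bound_linepath that(1) norm_perron_integrand_le) auto
    also have "\<dots> \<le> exp (y * \<sigma>) / R ^ 2 * L"
      using that(3) by (intro mult_left_mono) auto
    finally show ?thesis .
  qed
  have imR: "R \<le> norm z" if "\<bar>Im z\<bar> = R" for z using abs_Im_le_cmod[of z] that by simp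
  have reR: "R \<le> norm z" if "R \<le> \<bar>Re z\<bar>" for z using abs_Re_le_cmod[of z] that by simp
  have "norm (\<i> * integral {-R..R} (\<lambda>t. ?g (Complex \<sigma> t)) - 2 * pi * \<i> * of_real (riesz_kernel k y)) \<le>
      exp (y * \<sigma>) / R ^ 2 * (2 * \<sigma> + 4 * R)"
  proof (cases "y \<ge> 0")
    case True
    define a1 a2 a3 a4 where "a1 = Complex (-R) (-R)" and "a2 = Complex \<sigma> (-R)"
      and "a3 = Complex \<sigma> R" and "a4 = Complex (-R) R"
    have box: "0 \<in> box a1 a3" using \<sigma> R by (auto simp: a1_def a3_def in_box_complex_iff)
    have path: "path_image (rectpath a1 a3) \<subseteq> UNIV - {0}"
      using box \<sigma> R by (subst path_image_rectpath_cbox_minus_box) (auto simp: a1_def a3_def)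
    have "contour_integral (rectpath a1 a3) ?g = 2 * pi * \<i> * (\<Sum>p\<in>{0}. winding_number (rectpath a1 a3) p * residue ?g p)"
      by (rule Residue_theorem) (use path hol in auto)
    then have total: "contour_integral (rectpath a1 a3) ?g = 2 * pi * \<i> * of_real (riesz_kernel k y)"
      using winding_number_rectpath[OF box] True
      by (simp add: residue_perron_integrand riesz_kernel_def)
    have cont: "continuous_on (path_image (rectpath a1 a3)) ?g"
      using path by (intro holomorphic_on_imp_continuous_on hol) auto
    have a24: "Complex (Re a3) (Im a1) = a2" "Complex (Re a1) (Im a3) = a4"
      by (simp_all add: a1_def a2_def a3_def a4_def)
    note split = contour_integral_rectpath_split[OF cont, unfolded a24]
    have "norm (contour_integral (linepath a1 a2) ?g) \<le> exp (y * \<sigma>) / R ^ 2 * (\<sigma> + R)"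
    proof (rule side[OF split(2)])
      show "norm (a2 - a1) \<le> \<sigma> + R" using \<sigma> R by (simp add: a1_def a2_def cmod_def)
      fix z assume "z \<in> closed_segment a1 a2"
      then have "Im z = -R" "Re z \<le> \<sigma>"
        using \<sigma> R by (auto simp: a1_def a2_def closed_segment_same_Im closed_segment_eq_real_ivl)
      then show "y * Re z \<le> y * \<sigma> \<and> R \<le> norm z" using True R imR[of z] by (auto intro: mult_left_mono)
    qed
    moreover have "norm (contour_integral (linepath a3 a4) ?g) \<le> exp (y * \<sigma>) / R ^ 2 * (\<sigma> + R)"
    proof (rule side[OF split(4)])
      show "norm (a4 - a3) \<le> \<sigma> + R" using \<sigma> R by (simp add: a3_def a4_def cmod_def)
      fix z assume "z \<in> closed_segment a3 a4"
      then have "Im z = R" "Re z \<le> \<sigma>"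
        using \<sigma> R by (auto simp: a3_def a4_def closed_segment_same_Im closed_segment_eq_real_ivl split: if_splits)
      then show "y * Re z \<le> y * \<sigma> \<and> R \<le> norm z" using True R imR[of z] by (auto intro: mult_left_mono)
    qed
    moreover have "norm (contour_integral (linepath a4 a1) ?g) \<le> exp (y * \<sigma>) / R ^ 2 * (2 * R)"
    proof (rule side[OF split(5)])
      show "norm (a1 - a4) \<le> 2 * R" using R by (simp add: a1_def a4_def cmod_def real_sqrt_mult)
      fix z assume "z \<in> closed_segment a4 a1"
      then have "Re z = -R" by (auto simp: a4_def a1_def closed_segment_same_Re)
      then show "y * Re z \<le> y * \<sigma> \<and> R \<le> norm z" using True R \<sigma> reR[of z] mult_left_mono[of "Re z" \<sigma> y] by auto
    qed
    moreover have "\<i> * integral {-R..R} (\<lambda>t. ?g (Complex \<sigma> t)) - 2 * pi * \<i> * of_real (riesz_kernel k y) =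
        - (contour_integral (linepath a1 a2) ?g + contour_integral (linepath a3 a4) ?g + contour_integral (linepath a4 a1) ?g)"
      unfolding total[symmetric] split(1) line[folded a2_def a3_def, symmetric] by simp
    moreover have "norm (- (X + Y + Z)) \<le> norm X + norm Y + norm Z" for X Y Z :: complex
      unfolding norm_minus_cancel by (intro order_trans[OF norm_triangle_ineq] add_mono order_refl)
    moreover have "exp (y * \<sigma>) / R ^ 2 * (2 * \<sigma> + 4 * R) = exp (y * \<sigma>) / R ^ 2 * (\<sigma> + R) +
       exp (y * \<sigma>) / R ^ 2 * (\<sigma> + R) + exp (y * \<sigma>) / R ^ 2 * (2 * R)"
      by (simp only: distrib_left[symmetric]) simp
    ultimately show ?thesis by (smt (verit))
  next
    case False
    define a1 a2 a3 a4 where "a1 = Complex \<sigma> (-R)" and "a2 = Complex (\<sigma> + R) (-R)"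
      and "a3 = Complex (\<sigma> + R) R" and "a4 = Complex \<sigma> R"
    have path: "path_image (rectpath a1 a3) \<subseteq> {z. Re z > 0}"
    proof -
      have "path_image (rectpath a1 a3) \<subseteq> cbox a1 a3"
        using R by (intro path_image_rectpath_subset_cbox) (auto simp: a1_def a3_def)
      also have "\<dots> \<subseteq> {z. Re z > 0}" using \<sigma> by (auto simp: a1_def a3_def in_cbox_complex_iff)
      finally show ?thesis .
    qed
    have "(?g has_contour_integral 0) (rectpath a1 a3)"
      by (rule Cauchy_theorem_convex_simple[of _ "{z. Re z > 0}"])
         (use path in \<open>auto intro!: hol convex_halfspace_Re_gt\<close>)
    then have total: "contour_integral (rectpath a1 a3) ?g = 0" by (rule contour_integral_unique)
    have cont: "continuous_on (path_image (rectpath a1 a3)) ?g"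
      using path by (intro holomorphic_on_imp_continuous_on hol) auto
    have a24: "Complex (Re a3) (Im a1) = a2" "Complex (Re a1) (Im a3) = a4"
      by (simp_all add: a1_def a2_def a3_def a4_def)
    note split = contour_integral_rectpath_split[OF cont, unfolded a24]
    have ym: "y * Re z \<le> y * \<sigma>" if "Re z \<ge> \<sigma>" for z
      using False that by (intro mult_left_mono_neg) auto
    have "norm (contour_integral (linepath a1 a2) ?g) \<le> exp (y * \<sigma>) / R ^ 2 * (\<sigma> + R)"
    proof (rule side[OF split(2)])
      show "norm (a2 - a1) \<le> \<sigma> + R" using \<sigma> R by (simp add: a1_def a2_def cmod_def)
      fix z assume "z \<in> closed_segment a1 a2"
      then have "Im z = -R" "Re z \<ge> \<sigma>"
        using \<sigma> R by (auto simp: a1_def a2_def closed_segment_same_Im closed_segment_eq_real_ivl)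
      then show "y * Re z \<le> y * \<sigma> \<and> R \<le> norm z" using R imR[of z] ym by auto
    qed
    moreover have "norm (contour_integral (linepath a3 a4) ?g) \<le> exp (y * \<sigma>) / R ^ 2 * (\<sigma> + R)"
    proof (rule side[OF split(4)])
      show "norm (a4 - a3) \<le> \<sigma> + R" using \<sigma> R by (simp add: a3_def a4_def cmod_def)
      fix z assume "z \<in> closed_segment a3 a4"
      then have "Im z = R" "Re z \<ge> \<sigma>"
        using \<sigma> R by (auto simp: a3_def a4_def closed_segment_same_Im closed_segment_eq_real_ivl split: if_splits)
      then show "y * Re z \<le> y * \<sigma> \<and> R \<le> norm z" using R imR[of z] ym by auto
    qed
    moreover have "norm (contour_integral (linepath a2 a3) ?g) \<le> exp (y * \<sigma>) / R ^ 2 * (2 * R)"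
    proof (rule side[OF split(3)])
      show "norm (a3 - a2) \<le> 2 * R" using R by (simp add: a3_def a2_def cmod_def real_sqrt_mult)
      fix z assume "z \<in> closed_segment a2 a3"
      then have "Re z = \<sigma> + R" by (auto simp: a2_def a3_def closed_segment_same_Re)
      then show "y * Re z \<le> y * \<sigma> \<and> R \<le> norm z" using R \<sigma> reR[of z] ym[of z] by auto
    qed
    moreover have "contour_integral (linepath a4 a1) ?g = - contour_integral (linepath a1 a4) ?g"
      by (metis contour_integral_reversepath reversepath_linepath valid_path_linepath)
    then have "\<i> * integral {-R..R} (\<lambda>t. ?g (Complex \<sigma> t)) - 2 * pi * \<i> * of_real (riesz_kernel k y) =
        contour_integral (linepath a1 a2) ?g + contour_integral (linepath a3 a4) ?g + contour_integral (linepath a2 a3) ?g"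
      using split(1) False unfolding total line[folded a1_def a4_def, symmetric]
      by (simp add: riesz_kernel_def algebra_simps)
    moreover have "norm (X + Y + Z) \<le> norm X + norm Y + norm Z" for X Y Z :: complex
      by (intro order_trans[OF norm_triangle_ineq] add_mono order_refl)
    moreover have "exp (y * \<sigma>) / R ^ 2 * (2 * \<sigma> + 4 * R) = exp (y * \<sigma>) / R ^ 2 * (\<sigma> + R) +
       exp (y * \<sigma>) / R ^ 2 * (\<sigma> + R) + exp (y * \<sigma>) / R ^ 2 * (2 * R)"
      by (simp only: distrib_left[symmetric]) simp
    ultimately show ?thesis by (smt (verit))
  qed
  also have "\<i> * integral {-R..R} (\<lambda>t. ?g (Complex \<sigma> t)) - 2 * pi * \<i> * of_real (riesz_kernel k y) =
      \<i> * (integral {-R..R} (\<lambda>t. ?g (Complex \<sigma> t)) - 2 * pi * of_real (riesz_kernel k y))"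
    by (simp add: algebra_simps)
  finally show ?thesis by (simp add: norm_mult)
qed

lemma integrable_inverse_1_plus_square_lborel: "integrable lborel (\<lambda>x::real. 1 / (1 + x\<^sup>2))"
  using integrable_inverse_1_plus_square by (simp add: set_integrable_def divide_inverse)

lemma perron_denominator_bound:
  assumes "\<sigma> \<ge> 1" "k \<ge> 1"
  shows "norm (1 / Complex \<sigma> t ^ Suc k) \<le> 1 / (1 + t\<^sup>2)"
proof -
  have n2: "norm (Complex \<sigma> t) ^ 2 = \<sigma>\<^sup>2 + t\<^sup>2" by (simp add: cmod_def)
  have "1 + t\<^sup>2 \<le> \<sigma>\<^sup>2 + t\<^sup>2" using assms by simp
  then have *: "1 + t\<^sup>2 \<le> norm (Complex \<sigma> t) ^ 2" using n2 by simp
  have "1 \<le> norm (Complex \<sigma> t)" using abs_Re_le_cmod[of "Complex \<sigma> t"] assms by simp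
  then have "norm (Complex \<sigma> t) ^ 2 \<le> norm (Complex \<sigma> t) ^ Suc k"
    using assms by (intro power_increasing) auto
  with * have "1 + t\<^sup>2 \<le> norm (Complex \<sigma> t) ^ Suc k" by linarith
  then show ?thesis
    unfolding norm_divide norm_power by (intro frac_le) (auto simp: add_pos_nonneg simp del: power_Suc)
qed

lemma integrable_perron_integrand:
  assumes "\<sigma> \<ge> 1" "k \<ge> 1"
  shows "integrable lborel (\<lambda>t. perron_integrand k y (Complex \<sigma> t))"
proof (rule Bochner_Integration.integrable_bound)
  show "integrable lborel (\<lambda>t. exp (y * \<sigma>) * (1 / (1 + t\<^sup>2)))"
    by (intro integrable_mult_right integrable_inverse_1_plus_square_lborel)
  have "Complex \<sigma> t \<noteq> 0" for t using assms by (auto simp: complex_eq_iff)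
  then have "continuous_on UNIV (\<lambda>t. perron_integrand k y (Complex \<sigma> t))"
    unfolding perron_integrand_def
    by (intro continuous_intros continuous_on_Complex) (auto simp del: power_Suc)
  then show "(\<lambda>t. perron_integrand k y (Complex \<sigma> t)) \<in> borel_measurable lborel"
    by (simp add: borel_measurable_continuous_onI)
  have "norm (perron_integrand k y (Complex \<sigma> t)) \<le> norm (exp (y * \<sigma>) * (1 / (1 + t\<^sup>2)))" for t
  proof -
    have "norm (perron_integrand k y (Complex \<sigma> t)) = exp (y * \<sigma>) * norm (1 / Complex \<sigma> t ^ Suc k)"
      by (simp add: perron_integrand_def norm_divide norm_mult norm_power)
    also have "\<dots> \<le> exp (y * \<sigma>) * (1 / (1 + t\<^sup>2))"
      by (intro mult_left_mono perron_denominator_bound assms) auto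
    finally show ?thesis by simp
  qed
  then show "AE t in lborel. norm (perron_integrand k y (Complex \<sigma> t)) \<le> norm (exp (y * \<sigma>) * (1 / (1 + t\<^sup>2)))"
    by simp
qed

theorem perron_formula:
  assumes \<sigma>: "\<sigma> \<ge> 1" and k: "k \<ge> 1"
  shows "(\<integral>t. perron_integrand k y (Complex \<sigma> t) \<partial>lborel) = 2 * pi * of_real (riesz_kernel k y)"
proof -
  let ?g = "\<lambda>t. perron_integrand k y (Complex \<sigma> t)"
  have int: "integrable lborel ?g" by (rule integrable_perron_integrand[OF assms])
  \<comment> \<open>Heights n + 1 are used because the truncated formula requires R \<ge> 1.\<close>
  have "((\<lambda>n. \<integral>t. indicator {-real (Suc n)..real (Suc n)} t *\<^sub>R ?g t \<partial>lborel) \<longlonglongrightarrow> (\<integral>t. ?g t \<partial>lborel))"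
  proof (rule integral_dominated_convergence[where w = "\<lambda>t. norm (?g t)"])
    show "AE t in lborel. (\<lambda>n. indicator {-real (Suc n)..real (Suc n)} t *\<^sub>R ?g t) \<longlonglongrightarrow> ?g t"
    proof (rule AE_I2, rule tendsto_eventually)
      fix t :: real
      obtain n where n: "\<bar>t\<bar> \<le> real n" using real_arch_simple by blast
      show "eventually (\<lambda>n. indicator {-real (Suc n)..real (Suc n)} t *\<^sub>R ?g t = ?g t) sequentially"
        using eventually_ge_at_top[of n] by eventually_elim (use n in \<open>auto simp: indicator_def abs_le_iff\<close>)
    qed
    show "integrable lborel (\<lambda>t. norm (?g t))" using int by simp
  qed (use int in \<open>auto simp: indicator_def\<close>)
  also have "(\<lambda>n. \<integral>t. indicator {-real (Suc n)..real (Suc n)} t *\<^sub>R ?g t \<partial>lborel) =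
      (\<lambda>n. integral {-real (Suc n)..real (Suc n)} ?g)"
  proof
    fix n
    have "set_integrable lborel {-real (Suc n)..real (Suc n)} ?g"
      unfolding set_integrable_def by (rule integrable_mult_indicator[OF _ int]) auto
    from set_borel_integral_eq_integral(2)[OF this]
    show "(\<integral>t. indicator {-real (Suc n)..real (Suc n)} t *\<^sub>R ?g t \<partial>lborel) = integral {-real (Suc n)..real (Suc n)} ?g"
      by (simp add: set_lebesgue_integral_def)
  qed
  finally have 1: "(\<lambda>n. integral {-real (Suc n)..real (Suc n)} ?g) \<longlonglongrightarrow> (\<integral>t. ?g t \<partial>lborel)" .
  have "(\<lambda>n. integral {-real (Suc n)..real (Suc n)} ?g - 2 * pi * of_real (riesz_kernel k y)) \<longlonglongrightarrow> 0"
  proof (rule Lim_null_comparison)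
    show "eventually (\<lambda>n. norm (integral {-real (Suc n)..real (Suc n)} ?g - 2 * pi * of_real (riesz_kernel k y)) \<le>
        exp (y * \<sigma>) / real (Suc n) ^ 2 * (2 * \<sigma> + 4 * real (Suc n))) sequentially"
      using \<sigma> by (intro always_eventually allI perron_truncated k) auto
    show "(\<lambda>n. exp (y * \<sigma>) / real (Suc n) ^ 2 * (2 * \<sigma> + 4 * real (Suc n))) \<longlonglongrightarrow> 0"
      by real_asymp
  qed
  then have "(\<lambda>n. integral {-real (Suc n)..real (Suc n)} ?g) \<longlonglongrightarrow> 2 * pi * of_real (riesz_kernel k y)"
    by (simp add: LIM_zero_iff)
  with 1 show ?thesis by (rule LIMSEQ_unique)
qed

section \<open>Riesz means\<close>

text \<open>The logarithmic Riesz mean at x = exp y, with the kernel divided by k! so that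
  consecutive orders are related by differentiation in y.\<close>

definition riesz_mean :: "(nat \<Rightarrow> real) \<Rightarrow> nat \<Rightarrow> real \<Rightarrow> real" where
  "riesz_mean b k y = (\<Sum>n=1..nat \<lfloor>exp y\<rfloor>. b n * riesz_kernel k (y - ln (real n)))"

lemma riesz_kernel_neg: "u < 0 \<Longrightarrow> riesz_kernel k u = 0"
  by (simp add: riesz_kernel_def)

lemma ln_gt_of_floor_exp_lt:
  assumes "nat \<lfloor>exp y\<rfloor> < n"
  shows "y < ln (real n)"
proof -
  have "exp y < real n" using assms by linarith
  moreover have "n > 0" using assms by simp
  ultimately show ?thesis by (simp add: ln_less_cancel_iff[of "exp y", symmetric] del: ln_less_cancel_iff)
qed

lemma riesz_mean_eq_sum:
  assumes "nat \<lfloor>exp y\<rfloor> \<le> N"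
  shows "riesz_mean b k y = (\<Sum>n=1..N. b n * riesz_kernel k (y - ln (real n)))"
  unfolding riesz_mean_def
proof (rule sum.mono_neutral_left)
  show "\<forall>n\<in>{1..N} - {1..nat \<lfloor>exp y\<rfloor>}. b n * riesz_kernel k (y - ln (real n)) = 0"
    using ln_gt_of_floor_exp_lt[of y] by (auto intro!: riesz_kernel_neg simp: not_le)
qed (use assms in auto)

lemma riesz_mean_sums:
  "(\<lambda>n. if n = 0 then 0 else b n * riesz_kernel k (y - ln (real n))) sums riesz_mean b k y"
proof -
  have "(\<lambda>n. if n = 0 then 0 else b n * riesz_kernel k (y - ln (real n))) sums
      (\<Sum>n=1..nat \<lfloor>exp y\<rfloor>. if n = 0 then 0 else b n * riesz_kernel k (y - ln (real n)))"
  proof (rule sums_finite)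
    fix n assume "n \<notin> {1..nat \<lfloor>exp y\<rfloor>}"
    then show "(if n = 0 then 0 else b n * riesz_kernel k (y - ln (real n))) = 0"
      using ln_gt_of_floor_exp_lt[of y n] by (auto intro!: riesz_kernel_neg simp: not_le)
  qed auto
  also have "(\<Sum>n=1..nat \<lfloor>exp y\<rfloor>. if n = 0 then 0 else b n * riesz_kernel k (y - ln (real n))) = riesz_mean b k y"
    unfolding riesz_mean_def by (intro sum.cong) auto
  finally show ?thesis .
qed

text \<open>Sum and integral are interchanged: the integrand of each term is at most a summable
  factor in n times the integrable 1 / (1 + t^2), and only finitely many kernels are
  nonzero.\<close>

lemma riesz_mean_perron:
  assumes b: "abs_conv b" and \<sigma>: "\<sigma> > 1" and k: "k \<ge> 1"
  shows "2 * pi * of_real (riesz_mean b k y) =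
      (\<integral>t. dirichlet_series b (Complex \<sigma> t) * (exp (of_real y * Complex \<sigma> t) * (1 / Complex \<sigma> t ^ Suc k)) \<partial>lborel)"
    and "integrable lborel (\<lambda>t. dirichlet_series b (Complex \<sigma> t) * (exp (of_real y * Complex \<sigma> t) * (1 / Complex \<sigma> t ^ Suc k)))"
proof -
  define f where "f n t = (of_real (b n) * of_nat n powr (- Complex \<sigma> t)) *
      (exp (of_real y * Complex \<sigma> t) * (1 / Complex \<sigma> t ^ Suc k))" for n t
  have f_eq: "f n t = (if n = 0 then 0 else of_real (b n) * perron_integrand k (y - ln (real n)) (Complex \<sigma> t))" for n t
  proof (cases "n = 0")
    case False
    have "Ln (of_nat n) = of_real (ln (real n))"
      using False Ln_of_real[of "real n"] by simp
    then have "of_nat n powr (- Complex \<sigma> t) = exp (- Complex \<sigma> t * of_real (ln (real n)))"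
      using False by (simp add: powr_def)
    then show ?thesis using False
      by (simp add: f_def perron_integrand_def exp_add[symmetric] algebra_simps exp_diff exp_minus divide_inverse)
  qed (simp add: f_def)
  have int: "integrable lborel (f n)" for n
    using integrable_perron_integrand[of \<sigma> k] \<sigma> k by (cases "n = 0") (auto simp: f_eq[abs_def])
  have val: "(\<integral>t. f n t \<partial>lborel) = of_real (2 * pi * (if n = 0 then 0 else b n * riesz_kernel k (y - ln (real n))))" for n
    using perron_formula[of \<sigma> k] \<sigma> k by (cases "n = 0") (auto simp: f_eq)
  have nf: "norm (f n t) \<le> (\<bar>b n\<bar> * real n powr (-\<sigma>)) * exp (y * \<sigma>) * (1 / (1 + t\<^sup>2))" for n t
  proof -
    have "norm (f n t) = (\<bar>b n\<bar> * real n powr (-\<sigma>)) * exp (y * \<sigma>) * norm (1 / Complex \<sigma> t ^ Suc k)"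
      unfolding f_def norm_mult by (simp add: norm_powr_real_powr norm_mult)
    also have "\<dots> \<le> (\<bar>b n\<bar> * real n powr (-\<sigma>)) * exp (y * \<sigma>) * (1 / (1 + t\<^sup>2))"
      using \<sigma> k by (intro mult_left_mono perron_denominator_bound) auto
    finally show ?thesis .
  qed
  have sb: "summable (\<lambda>n. \<bar>b n\<bar> * real n powr (-\<sigma>))" using b \<sigma> by (simp add: abs_conv_def)
  have AE: "AE t in lborel. summable (\<lambda>n. norm (f n t))"
  proof (rule AE_I2)
    fix t :: real
    have "summable (\<lambda>n. (\<bar>b n\<bar> * real n powr (-\<sigma>)) * exp (y * \<sigma>) * (1 / (1 + t\<^sup>2)))"
      by (intro summable_mult2 sb)
    then show "summable (\<lambda>n. norm (f n t))"
      by (rule summable_comparison_test') (use nf in auto)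
  qed
  define J where "J = (\<integral>t. 1 / (1 + t\<^sup>2) \<partial>lborel :: real)"
  have sums: "summable (\<lambda>n. \<integral>t. norm (f n t) \<partial>lborel)"
  proof (rule summable_comparison_test')
    show "summable (\<lambda>n. (\<bar>b n\<bar> * real n powr (-\<sigma>)) * exp (y * \<sigma>) * J)"
      by (intro summable_mult2 sb)
    fix n :: nat
    have "(\<integral>t. norm (f n t) \<partial>lborel) \<le> (\<integral>t. (\<bar>b n\<bar> * real n powr (-\<sigma>)) * exp (y * \<sigma>) * (1 / (1 + t\<^sup>2)) \<partial>lborel)"
      by (intro integral_mono integrable_norm int integrable_mult_right integrable_inverse_1_plus_square_lborel nf)
    also have "\<dots> = (\<bar>b n\<bar> * real n powr (-\<sigma>)) * exp (y * \<sigma>) * J"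
      unfolding J_def by (rule integral_mult_right_zero)
    finally show "norm (\<integral>t. norm (f n t) \<partial>lborel) \<le> (\<bar>b n\<bar> * real n powr (-\<sigma>)) * exp (y * \<sigma>) * J"
      by (simp add: integral_nonneg_AE)
  qed
  have suminf: "(\<Sum>n. f n t) = dirichlet_series b (Complex \<sigma> t) * (exp (of_real y * Complex \<sigma> t) * (1 / Complex \<sigma> t ^ Suc k))" for t
  proof -
    have "summable (\<lambda>n. of_real (b n) * of_nat n powr (- Complex \<sigma> t))"
      using b \<sigma> by (intro abs_conv_summable) auto
    from suminf_mult2[OF this] show ?thesis unfolding f_def dirichlet_series_def by (rule sym)
  qed
  have "(\<lambda>n. \<integral>t. f n t \<partial>lborel) sums (\<integral>t. (\<Sum>n. f n t) \<partial>lborel)"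
    by (rule sums_integral[OF int AE sums])
  moreover have "(\<lambda>n. \<integral>t. f n t \<partial>lborel) sums of_real (2 * pi * riesz_mean b k y)"
    unfolding val by (intro sums_of_real sums_mult riesz_mean_sums)
  ultimately show "2 * pi * of_real (riesz_mean b k y) =
      (\<integral>t. dirichlet_series b (Complex \<sigma> t) * (exp (of_real y * Complex \<sigma> t) * (1 / Complex \<sigma> t ^ Suc k)) \<partial>lborel)"
    unfolding suminf using sums_unique2 by fastforce
  show "integrable lborel (\<lambda>t. dirichlet_series b (Complex \<sigma> t) * (exp (of_real y * Complex \<sigma> t) * (1 / Complex \<sigma> t ^ Suc k)))"
    using integrable_suminf[OF int AE sums] by (simp add: suminf)
qed

text \<open>The origin of the order 11: |s|^12 absorbs the growth (1 + |t|)^10 and leaves two powers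
  for integrability.\<close>

lemma height_power_bound:
  assumes "\<sigma> \<ge> 1" "k \<ge> 11"
  shows "(1 + \<bar>t\<bar>) ^ 10 * norm (1 / Complex \<sigma> t ^ Suc k) \<le> 2 ^ 10 * (1 / (1 + t\<^sup>2))"
proof -
  define z where "z = norm (Complex \<sigma> t)"
  have z1: "z \<ge> 1" "z \<ge> \<bar>t\<bar>"
    using abs_Re_le_cmod[of "Complex \<sigma> t"] abs_Im_le_cmod[of "Complex \<sigma> t"] assms by (auto simp: z_def)
  have "z ^ 2 = \<sigma>\<^sup>2 + t\<^sup>2" by (simp add: z_def cmod_def)
  then have z2: "1 + t\<^sup>2 \<le> z ^ 2" using assms by simp
  have "(1 + \<bar>t\<bar>) ^ 10 \<le> (2 * z) ^ 10" using z1 by (intro power_mono) auto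
  then have "(1 + \<bar>t\<bar>) ^ 10 * norm (1 / Complex \<sigma> t ^ Suc k) \<le> (2 * z) ^ 10 * (1 / z ^ 12)"
  proof (rule mult_mono)
    have "z ^ 12 \<le> z ^ Suc k" using z1 assms by (intro power_increasing) auto
    then show "norm (1 / Complex \<sigma> t ^ Suc k) \<le> 1 / z ^ 12"
      unfolding norm_divide norm_power z_def[symmetric] using z1 by (intro frac_le) (auto simp del: power_Suc)
  qed (use z1 in auto)
  also have "\<dots> = 2 ^ 10 * (1 / z ^ 2)"
  proof -
    have "z ^ 10 * (1 / z ^ 12) = 1 / z ^ 2" using z1 by (simp add: field_simps flip: power_add)
    then show ?thesis by (simp only: power_mult_distrib mult.assoc)
  qed
  also have "\<dots> \<le> 2 ^ 10 * (1 / (1 + t\<^sup>2))"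
    using z2 by (intro mult_left_mono frac_le) (auto simp: add_pos_nonneg)
  finally show ?thesis .
qed

lemma riesz_mean_bound:
  assumes b: "abs_conv b" and C: "C \<ge> 0" and r: "0 < r" "r \<le> 1"
    and D: "\<And>s. 1 < Re s \<Longrightarrow> Re s \<le> 1 + r \<Longrightarrow> norm (dirichlet_series b s) \<le> C * (1 + \<bar>Im s\<bar>) ^ 10"
    and k: "k \<ge> 11" and y: "y \<ge> 1 / r"
  shows "\<bar>riesz_mean b k y\<bar> \<le> C * 2 ^ 10 * exp 1 * (\<integral>t. 1 / (1 + t\<^sup>2) \<partial>lborel) * exp y"
proof -
  define J where "J = (\<integral>t. 1 / (1 + t\<^sup>2) \<partial>lborel :: real)"
  have J: "J \<ge> 0" unfolding J_def by (intro integral_nonneg_AE AE_I2) (auto simp: add_pos_nonneg)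
  have "1 / r \<ge> 1" using r by simp
  then have y1: "y \<ge> 1" using y by simp
  \<comment> \<open>At this abscissa exp (y \<sigma>) = e * exp y, so working right of the line
    costs only a constant; y \<ge> 1/r keeps it in the strip where the bound is known.\<close>
  define \<sigma> where "\<sigma> = 1 + 1 / y"
  have "1 / y \<le> r" using y r y1 by (simp add: field_simps)
  then have \<sigma>: "1 < \<sigma>" "\<sigma> \<le> 1 + r" using y1 by (auto simp: \<sigma>_def)
  have "y * \<sigma> = 1 + y" using y1 by (simp add: \<sigma>_def distrib_left)
  then have ey: "exp (y * \<sigma>) = exp 1 * exp y" by (simp add: exp_add)
  have k1: "k \<ge> 1" using k by simp
  let ?g = "\<lambda>t. dirichlet_series b (Complex \<sigma> t) * (exp (of_real y * Complex \<sigma> t) * (1 / Complex \<sigma> t ^ Suc k))"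
  have "2 * pi * \<bar>riesz_mean b k y\<bar> = norm (2 * pi * complex_of_real (riesz_mean b k y))"
    by (simp add: norm_mult)
  also have "\<dots> = norm (\<integral>t. ?g t \<partial>lborel)"
    unfolding riesz_mean_perron(1)[OF b \<sigma>(1) k1, symmetric] by simp
  also have "\<dots> \<le> (\<integral>t. norm (?g t) \<partial>lborel)" by (rule integral_norm_bound)
  also have "\<dots> \<le> (\<integral>t. (C * 2 ^ 10 * exp 1 * exp y) * (1 / (1 + t\<^sup>2)) \<partial>lborel)"
  proof (intro integral_mono integrable_norm riesz_mean_perron(2)[OF b \<sigma>(1) k1] integrable_mult_right
      integrable_inverse_1_plus_square_lborel)
    fix t :: real
    have "norm (?g t) = norm (dirichlet_series b (Complex \<sigma> t)) * norm (1 / Complex \<sigma> t ^ Suc k) * exp (y * \<sigma>)"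
      unfolding norm_mult by (simp add: mult_ac)
    also have "\<dots> \<le> (C * (1 + \<bar>t\<bar>) ^ 10) * norm (1 / Complex \<sigma> t ^ Suc k) * exp (y * \<sigma>)"
      using D[of "Complex \<sigma> t"] \<sigma> by (intro mult_right_mono) auto
    also have "\<dots> = C * ((1 + \<bar>t\<bar>) ^ 10 * norm (1 / Complex \<sigma> t ^ Suc k)) * exp (y * \<sigma>)" by simp
    also have "\<dots> \<le> C * (2 ^ 10 * (1 / (1 + t\<^sup>2))) * exp (y * \<sigma>)"
      using C \<sigma> k by (intro mult_right_mono mult_left_mono height_power_bound) auto
    finally show "norm (?g t) \<le> (C * 2 ^ 10 * exp 1 * exp y) * (1 / (1 + t\<^sup>2))"
      unfolding ey by (simp only: mult_ac)
  qed
  also have "\<dots> = (C * 2 ^ 10 * exp 1 * exp y) * J" unfolding J_def by (rule integral_mult_right_zero)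
  finally have "2 * pi * \<bar>riesz_mean b k y\<bar> \<le> C * 2 ^ 10 * exp 1 * exp y * J" .
  moreover have "1 * \<bar>riesz_mean b k y\<bar> \<le> 2 * pi * \<bar>riesz_mean b k y\<bar>"
    using pi_gt3 by (intro mult_right_mono) auto
  ultimately show ?thesis by (simp add: J_def mult_ac)
qed

lemma riesz_kernel_mult: "u * riesz_kernel k u = real (Suc k) * riesz_kernel (Suc k) u"
  by (simp add: riesz_kernel_def divide_simps)

text \<open>Splitting \<open>y = ln n + (y - ln n)\<close> gains a factor \<open>y\<close> without integrating by parts.\<close>

lemma riesz_mean_ln:
  "y * riesz_mean b k y = riesz_mean (\<lambda>n. b n * ln (real n)) k y + real (Suc k) * riesz_mean b (Suc k) y"
proof -
  have "y * (b n * riesz_kernel k (y - ln (real n))) = b n * ln (real n) * riesz_kernel k (y - ln (real n)) +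
      real (Suc k) * (b n * riesz_kernel (Suc k) (y - ln (real n)))" for n
  proof -
    have "y * (b n * riesz_kernel k (y - ln (real n))) = b n * ln (real n) * riesz_kernel k (y - ln (real n)) +
      b n * ((y - ln (real n)) * riesz_kernel k (y - ln (real n)))" by (simp add: algebra_simps)
    then show ?thesis unfolding riesz_kernel_mult by (simp only: mult_ac)
  qed
  then show ?thesis
    unfolding riesz_mean_def sum_distrib_left sum.distrib[symmetric] by (intro sum.cong refl)
qed

text \<open>Both terms on the right of \<open>riesz_mean_ln\<close> are O(exp y); dividing by y
  gives the saving. The constant is 13 = 1 + 12, the 12 being the coefficient of the mean of order
  12.\<close>

lemma riesz_mean_decay:
  assumes b: "abs_conv b" and C: "C \<ge> 0" and r: "0 < r" "r \<le> 1"
    and D: "\<And>s. 1 < Re s \<Longrightarrow> Re s \<le> 1 + r \<Longrightarrow> norm (dirichlet_series b s) \<le> C * (1 + \<bar>Im s\<bar>) ^ 10"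
    and D': "\<And>s. 1 < Re s \<Longrightarrow> Re s \<le> 1 + r \<Longrightarrow>
        norm (dirichlet_series (\<lambda>n. b n * ln (real n)) s) \<le> C * (1 + \<bar>Im s\<bar>) ^ 10"
  obtains K where "\<And>y. y \<ge> 1 / r \<Longrightarrow> \<bar>riesz_mean b 11 y\<bar> \<le> K * exp y / y"
proof -
  define A where "A = C * 2 ^ 10 * exp 1 * (\<integral>t. 1 / (1 + t\<^sup>2) \<partial>lborel)"
  show ?thesis
  proof (rule that[of "13 * A"])
    fix y :: real assume y: "y \<ge> 1 / r"
    have "1 / r > 0" using r by simp
    then have y0: "y > 0" using y by linarith
    have 1: "\<bar>riesz_mean (\<lambda>n. b n * ln (real n)) 11 y\<bar> \<le> A * exp y"
      unfolding A_def by (rule riesz_mean_bound[OF abs_conv_ln[OF b] C r D' _ y]) auto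
    have 2: "\<bar>riesz_mean b 12 y\<bar> \<le> A * exp y"
      unfolding A_def by (rule riesz_mean_bound[OF b C r D _ y]) auto
    have "y * riesz_mean b 11 y = riesz_mean (\<lambda>n. b n * ln (real n)) 11 y + 12 * riesz_mean b 12 y"
      using riesz_mean_ln[of y b 11] by simp
    then have "\<bar>y * riesz_mean b 11 y\<bar> \<le> 13 * A * exp y" using 1 2 by linarith
    then show "\<bar>riesz_mean b 11 y\<bar> \<le> 13 * A * exp y / y"
      using y0 by (simp add: abs_mult field_simps)
  qed
qed

section \<open>Tauberian descent through the orders\<close>

text \<open>The kernel of order k + 1 is a primitive of the nondecreasing kernel of order k, so its
  increment lies between \<delta> times the end values. The case u < 0 \<le> u + \<delta>, where the
  kernel has a corner or a jump, is computed directly.\<close>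

lemma riesz_kernel_difference:
  assumes \<delta>: "\<delta> > 0"
  shows "\<delta> * riesz_kernel k u \<le> riesz_kernel (Suc k) (u + \<delta>) - riesz_kernel (Suc k) u"
    and "riesz_kernel (Suc k) (u + \<delta>) - riesz_kernel (Suc k) u \<le> \<delta> * riesz_kernel k (u + \<delta>)"
proof -
  have "\<delta> * riesz_kernel k u \<le> riesz_kernel (Suc k) (u + \<delta>) - riesz_kernel (Suc k) u \<and>
    riesz_kernel (Suc k) (u + \<delta>) - riesz_kernel (Suc k) u \<le> \<delta> * riesz_kernel k (u + \<delta>)"
  proof (cases "u \<ge> 0")
    case True
    have "\<exists>z>u. z < u + \<delta> \<and> (u + \<delta>) ^ Suc k / fact (Suc k) - u ^ Suc k / fact (Suc k) = (u + \<delta> - u) * (z ^ k / fact k)"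
    proof (rule MVT2)
      show "((\<lambda>x. x ^ Suc k / fact (Suc k)) has_real_derivative x ^ k / fact k) (at x)" for x :: real
        by (auto intro!: derivative_eq_intros simp: divide_simps simp del: power_Suc)
    qed (use \<delta> in auto)
    then obtain z where z: "z > u" "z < u + \<delta>"
      "(u + \<delta>) ^ Suc k / fact (Suc k) - u ^ Suc k / fact (Suc k) = \<delta> * (z ^ k / fact k)" by auto
    have "\<delta> * (u ^ k / fact k) \<le> \<delta> * (z ^ k / fact k)" "\<delta> * (z ^ k / fact k) \<le> \<delta> * ((u + \<delta>) ^ k / fact k)"
      using z True \<delta> by (auto intro!: mult_left_mono divide_right_mono power_mono)
    then show ?thesis
      using True \<delta> z(3) by (simp add: riesz_kernel_def del: power_Suc fact_Suc)
  next
    case False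
    show ?thesis
    proof (cases "u + \<delta> \<ge> 0")
      case True
      have "(u + \<delta>) ^ Suc k / fact (Suc k) = (u + \<delta>) / real (Suc k) * ((u + \<delta>) ^ k / fact k)" by simp
      also have "\<dots> \<le> \<delta> * ((u + \<delta>) ^ k / fact k)"
      proof (rule mult_right_mono)
        have "(u + \<delta>) / real (Suc k) \<le> (u + \<delta>) / 1" using True by (intro divide_left_mono) auto
        then show "(u + \<delta>) / real (Suc k) \<le> \<delta>" using False by simp
      qed (use True in auto)
      finally show ?thesis using True False \<delta> by (simp add: riesz_kernel_def del: power_Suc fact_Suc)
    qed (use False in \<open>auto simp: riesz_kernel_def\<close>)
  qed
  then show "\<delta> * riesz_kernel k u \<le> riesz_kernel (Suc k) (u + \<delta>) - riesz_kernel (Suc k) u"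
    and "riesz_kernel (Suc k) (u + \<delta>) - riesz_kernel (Suc k) u \<le> \<delta> * riesz_kernel k (u + \<delta>)" by auto
qed

abbreviation riesz_one :: "nat \<Rightarrow> real \<Rightarrow> real" where
  "riesz_one \<equiv> riesz_mean (\<lambda>_. 1)"

text \<open>The kernel inequalities are multiplied by b(n) + 1, which is nonnegative. Undoing the
  shift by 1 costs \<delta> times the increment of the mean of the constant sequence, and that
  increment is small.\<close>

lemma riesz_mean_difference:
  assumes b: "\<And>n. n \<ge> 1 \<Longrightarrow> b n \<ge> -1" and \<delta>: "\<delta> > 0"
  shows "\<delta> * riesz_mean b k y \<le> riesz_mean b (Suc k) (y + \<delta>) - riesz_mean b (Suc k) y +
           \<delta> * (riesz_one k (y + \<delta>) - riesz_one k y)"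
    and "\<delta> * riesz_mean b k (y + \<delta>) \<ge> riesz_mean b (Suc k) (y + \<delta>) - riesz_mean b (Suc k) y -
           \<delta> * (riesz_one k (y + \<delta>) - riesz_one k y)"
proof -
  define N where "N = nat \<lfloor>exp (y + \<delta>)\<rfloor>"
  have N: "nat \<lfloor>exp y\<rfloor> \<le> N" "nat \<lfloor>exp (y + \<delta>)\<rfloor> \<le> N"
    unfolding N_def using \<delta> by (auto intro!: nat_mono floor_mono)
  note eq = riesz_mean_eq_sum[OF N(1)] riesz_mean_eq_sum[OF N(2)]
  define u where "u n = y - ln (real n)" for n
  have u: "y + \<delta> - ln (real n) = u n + \<delta>" "y - ln (real n) = u n" for n by (simp_all add: u_def)
  have "\<delta> * riesz_kernel k (u n) * b n \<le> b n * (riesz_kernel (Suc k) (u n + \<delta>) - riesz_kernel (Suc k) (u n)) +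
      \<delta> * (riesz_kernel k (u n + \<delta>) - riesz_kernel k (u n))" if "n \<ge> 1" for n
  proof -
    have "0 \<le> (b n + 1) * (riesz_kernel (Suc k) (u n + \<delta>) - riesz_kernel (Suc k) (u n) - \<delta> * riesz_kernel k (u n))"
      using b[OF that] riesz_kernel_difference(1)[OF \<delta>, of k "u n"] by (intro mult_nonneg_nonneg) auto
    then show ?thesis using riesz_kernel_difference(2)[OF \<delta>, of k "u n"] by (simp add: algebra_simps)
  qed
  then have "(\<Sum>n=1..N. \<delta> * riesz_kernel k (u n) * b n) \<le>
    (\<Sum>n=1..N. b n * (riesz_kernel (Suc k) (u n + \<delta>) - riesz_kernel (Suc k) (u n)) +
      \<delta> * (riesz_kernel k (u n + \<delta>) - riesz_kernel k (u n)))"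
    by (intro sum_mono) auto
  then show "\<delta> * riesz_mean b k y \<le> riesz_mean b (Suc k) (y + \<delta>) - riesz_mean b (Suc k) y +
           \<delta> * (riesz_one k (y + \<delta>) - riesz_one k y)"
    unfolding eq u by (simp add: sum_distrib_left sum.distrib sum_subtractf algebra_simps)
  have "b n * (riesz_kernel (Suc k) (u n + \<delta>) - riesz_kernel (Suc k) (u n)) -
      \<delta> * (riesz_kernel k (u n + \<delta>) - riesz_kernel k (u n)) \<le> \<delta> * riesz_kernel k (u n + \<delta>) * b n" if "n \<ge> 1" for n
  proof -
    have "0 \<le> (b n + 1) * (\<delta> * riesz_kernel k (u n + \<delta>) - (riesz_kernel (Suc k) (u n + \<delta>) - riesz_kernel (Suc k) (u n)))"
      using b[OF that] riesz_kernel_difference(2)[OF \<delta>, of k "u n"] by (intro mult_nonneg_nonneg) auto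
    then show ?thesis using riesz_kernel_difference(1)[OF \<delta>, of k "u n"] by (simp add: algebra_simps)
  qed
  then have "(\<Sum>n=1..N. b n * (riesz_kernel (Suc k) (u n + \<delta>) - riesz_kernel (Suc k) (u n)) -
      \<delta> * (riesz_kernel k (u n + \<delta>) - riesz_kernel k (u n))) \<le> (\<Sum>n=1..N. \<delta> * riesz_kernel k (u n + \<delta>) * b n)"
    by (intro sum_mono) auto
  then show "\<delta> * riesz_mean b k (y + \<delta>) \<ge> riesz_mean b (Suc k) (y + \<delta>) - riesz_mean b (Suc k) y -
           \<delta> * (riesz_one k (y + \<delta>) - riesz_one k y)"
    unfolding eq u by (simp add: sum_distrib_left sum.distrib sum_subtractf algebra_simps)
qed

lemma sum_inverse_sqrt_le: "(\<Sum>n=1..N. 1 / sqrt (real n)) \<le> 2 * sqrt (real N)"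
proof (induction N)
  case (Suc N)
  have "1 / sqrt (real (Suc N)) \<le> 2 * (sqrt (real (Suc N)) - sqrt (real N))"
  proof -
    define p q where "p = sqrt (real (Suc N))" and "q = sqrt (real N)"
    have p: "p > 0" "p\<^sup>2 = q\<^sup>2 + 1" "q \<ge> 0" by (auto simp: p_def q_def)
    have "0 \<le> (p - q)\<^sup>2" by simp
    then have "1 \<le> 2 * (p - q) * p" using p(2) by (simp add: power2_eq_square algebra_simps)
    then show ?thesis using p(1) unfolding p_def[symmetric] q_def[symmetric] by (simp add: field_simps)
  qed
  with Suc show ?case by simp
qed simp

text \<open>A single term of the exponential series at u/2. The half is deliberate: summed over n
  \<le> exp y it leads to the sum of n^(-1/2), so no logarithm is lost.\<close>

lemma riesz_kernel_le_exp: "riesz_kernel k u \<le> 2 ^ k * exp (u / 2)"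
proof (cases "u \<ge> 0")
  case True
  have "(u / 2) ^ k / fact k \<le> exp (u / 2)"
  proof -
    have S: "(\<lambda>n. (u / 2) ^ n /\<^sub>R fact n) sums exp (u / 2)" by (rule exp_converges)
    have "(\<Sum>n\<in>{k}. (u / 2) ^ n /\<^sub>R fact n) \<le> exp (u / 2)"
      unfolding sums_unique[OF S] using True by (intro sum_le_suminf sums_summable[OF S]) auto
    moreover have "(\<Sum>n\<in>{k}. (u / 2) ^ n /\<^sub>R fact n) = (u / 2) ^ k / fact k"
      by (simp only: sum.insert sum.empty finite.emptyI empty_iff not_False_eq_True add_0_right
          real_scaleR_def divide_inverse_commute)
    ultimately show ?thesis by simp
  qed
  then have "2 ^ k * ((u / 2) ^ k / fact k) \<le> 2 ^ k * exp (u / 2)" by (intro mult_left_mono) auto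
  then show ?thesis using True by (simp add: riesz_kernel_def power_divide)
qed (simp add: riesz_kernel_def)

lemma riesz_one_le: "riesz_one k y \<le> 2 ^ Suc k * exp y"
proof -
  define N where "N = nat \<lfloor>exp y\<rfloor>"
  have N: "real N \<le> exp y" unfolding N_def by simp
  have "riesz_one k y = (\<Sum>n=1..N. riesz_kernel k (y - ln (real n)))"
    by (simp add: riesz_mean_def N_def)
  also have "\<dots> \<le> (\<Sum>n=1..N. 2 ^ k * exp (y / 2) * (1 / sqrt (real n)))"
  proof (rule sum_mono)
    fix n assume n: "n \<in> {1..N}"
    have "exp ((y - ln (real n)) / 2) = exp (y / 2) * (1 / sqrt (real n))"
    proof -
      have "exp (ln (real n) / 2) = sqrt (real n)"
        using n by (simp add: ln_sqrt[symmetric])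
      then show ?thesis by (simp add: diff_divide_distrib exp_diff)
    qed
    then show "riesz_kernel k (y - ln (real n)) \<le> 2 ^ k * exp (y / 2) * (1 / sqrt (real n))"
      using riesz_kernel_le_exp[of k "y - ln (real n)"] by simp
  qed
  also have "\<dots> = 2 ^ k * exp (y / 2) * (\<Sum>n=1..N. 1 / sqrt (real n))"
    by (simp add: sum_distrib_left)
  also have "\<dots> \<le> 2 ^ k * exp (y / 2) * (2 * sqrt (real N))"
    by (intro mult_left_mono sum_inverse_sqrt_le) auto
  also have "\<dots> \<le> 2 ^ k * exp (y / 2) * (2 * sqrt (exp y))"
    using N by (intro mult_left_mono) auto
  also have "sqrt (exp y) = exp (y / 2)"
    by (rule real_sqrt_unique) (auto simp: exp_double[symmetric])
  also have "2 ^ k * exp (y / 2) * (2 * exp (y / 2)) = 2 ^ Suc k * exp y"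
    by (simp add: exp_add[symmetric])
  finally show ?thesis .
qed

text \<open>For positive order the kernel difference reduces to \<open>riesz_one_le\<close> one
  order lower. At order 0 the mean counts integers, and the summand 1 pays for the floor.\<close>

lemma riesz_one_difference:
  assumes \<delta>: "0 < \<delta>" "\<delta> \<le> 1"
  shows "riesz_one k (y + \<delta>) - riesz_one k y \<le> 2 ^ (k + 2) * (\<delta> * exp y) + 1"
proof (cases k)
  case 0
  have eq: "riesz_one 0 z = real (nat \<lfloor>exp z\<rfloor>)" for z
  proof -
    have "riesz_one 0 z = (\<Sum>n=1..nat \<lfloor>exp z\<rfloor>. 1)"
      unfolding riesz_mean_def
    proof (rule sum.cong)
      fix n assume n: "n \<in> {1..nat \<lfloor>exp z\<rfloor>}"
      then have "real n \<le> exp z" "real n > 0" by (auto simp: le_nat_floor le_floor_iff nat_le_iff) linarith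
      then have "ln (real n) \<le> z" by (metis ln_exp ln_le_cancel_iff exp_gt_zero)
      then show "1 * riesz_kernel 0 (z - ln (real n)) = 1" by (simp add: riesz_kernel_def)
    qed simp
    then show ?thesis by simp
  qed
  have "exp \<delta> \<le> 1 + \<delta> + \<delta>\<^sup>2" using \<delta> by (intro exp_bound) auto
  also have "\<delta>\<^sup>2 \<le> \<delta>" using \<delta> by (simp add: power2_eq_square mult_left_le)
  finally have "exp \<delta> - 1 \<le> 2 * \<delta>" by simp
  then have "exp y * (exp \<delta> - 1) \<le> exp y * (2 * \<delta>)" by (intro mult_left_mono) auto
  moreover have "real (nat \<lfloor>exp (y + \<delta>)\<rfloor>) - real (nat \<lfloor>exp y\<rfloor>) \<le> exp (y + \<delta>) - exp y + 1"
  proof -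
    have "real (nat \<lfloor>exp (y + \<delta>)\<rfloor>) \<le> exp (y + \<delta>)" by simp
    moreover have "real (nat \<lfloor>exp y\<rfloor>) = of_int \<lfloor>exp y\<rfloor>" by simp
    moreover have "of_int \<lfloor>exp y\<rfloor> > exp y - 1" by linarith
    ultimately show ?thesis by linarith
  qed
  moreover have "exp y * \<delta> \<ge> 0" using \<delta> by simp
  ultimately show ?thesis unfolding 0 eq by (simp add: exp_add algebra_simps)
next
  case (Suc j)
  have "riesz_one (Suc j) (y + \<delta>) - riesz_one (Suc j) y \<le> \<delta> * riesz_one j (y + \<delta>)"
  proof -
    define N where "N = nat \<lfloor>exp (y + \<delta>)\<rfloor>"
    have N: "nat \<lfloor>exp y\<rfloor> \<le> N" "nat \<lfloor>exp (y + \<delta>)\<rfloor> \<le> N"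
      unfolding N_def using \<delta> by (auto intro!: nat_mono floor_mono)
    have "(\<Sum>n=1..N. 1 * riesz_kernel (Suc j) (y + \<delta> - ln (real n)) - 1 * riesz_kernel (Suc j) (y - ln (real n))) \<le>
        (\<Sum>n=1..N. \<delta> * (1 * riesz_kernel j (y + \<delta> - ln (real n))))"
    proof (rule sum_mono)
      fix n
      show "1 * riesz_kernel (Suc j) (y + \<delta> - ln (real n)) - 1 * riesz_kernel (Suc j) (y - ln (real n)) \<le>
          \<delta> * (1 * riesz_kernel j (y + \<delta> - ln (real n)))"
        using riesz_kernel_difference(2)[OF \<delta>(1), of j "y - ln (real n)"] by (simp add: algebra_simps)
    qed
    then show ?thesis
      unfolding riesz_mean_eq_sum[OF N(1)] riesz_mean_eq_sum[OF N(2)] sum_subtractf sum_distrib_left .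
  qed
  also have "\<dots> \<le> \<delta> * (2 ^ Suc j * exp (y + \<delta>))"
    using \<delta> by (intro mult_left_mono riesz_one_le) auto
  also have "\<dots> \<le> \<delta> * (2 ^ Suc j * (exp y * 4))"
  proof -
    have "exp \<delta> \<le> exp 1" using \<delta> by simp
    also have "\<dots> \<le> 4" using exp_le by simp
    finally show ?thesis using \<delta> by (intro mult_left_mono) (auto simp: exp_add)
  qed
  finally show ?thesis unfolding Suc by (simp add: mult_ac)
qed

definition riesz_saving :: "(nat \<Rightarrow> real) \<Rightarrow> nat \<Rightarrow> bool" where
  "riesz_saving b k \<longleftrightarrow> (\<exists>K y0 \<epsilon>. y0 \<ge> 1 \<and> 0 < \<epsilon> \<and> \<epsilon> \<le> 1 \<and>
     (\<forall>y\<ge>y0. \<bar>riesz_mean b k y\<bar> \<le> K * exp y / y powr \<epsilon>))"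

text \<open>The difference quotient over a step \<delta> costs y^(-\<epsilon>) / \<delta> from order
  k + 1 and \<delta> from the increment of the constant sequence; \<delta> = y^(-\<epsilon>/2)
  balances the two and halves the exponent.\<close>

lemma riesz_saving_Suc:
  assumes b: "\<And>n. n \<ge> 1 \<Longrightarrow> b n \<ge> -1" and sav: "riesz_saving b (Suc k)"
  shows "riesz_saving b k"
proof -
  obtain K y0 \<epsilon> where y0: "y0 \<ge> 1" and \<epsilon>: "0 < \<epsilon>" "\<epsilon> \<le> 1"
    and K: "\<And>y. y \<ge> y0 \<Longrightarrow> \<bar>riesz_mean b (Suc k) y\<bar> \<le> K * exp y / y powr \<epsilon>"
    using sav unfolding riesz_saving_def by blast
  have K0: "K \<ge> 0"
  proof -
    have "0 \<le> K * exp y0 / y0 powr \<epsilon>" by (rule order_trans[OF abs_ge_zero K[of y0]]) simp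
    moreover have "exp y0 / y0 powr \<epsilon> > 0" using y0 by simp
    ultimately show ?thesis by (simp add: zero_le_mult_iff flip: times_divide_eq_right)
  qed
  define A where "A = (2 ^ (k + 2) :: real)"
  have A: "A \<ge> 0" by (simp add: A_def)
  \<comment> \<open>The threshold 2 y0 keeps y - \<delta> \<ge> y/2 \<ge> y0. In 5 K the parts K and
    4 K come from order k + 1 at y and y + \<delta>, A from the increment bound, and 1 from its
    additive constant.\<close>
  have main: "\<bar>riesz_mean b k y\<bar> \<le> (5 * K + A + 1) * exp y / y powr (\<epsilon> / 2)" if y: "y \<ge> 2 * y0" for y
  proof -
    define \<delta> where "\<delta> = y powr (- \<epsilon> / 2)"
    have y2: "y \<ge> 2" "y \<ge> y0" using y y0 by auto
    have \<delta>0: "\<delta> > 0" using y2 by (simp add: \<delta>_def)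
    have "y powr (- \<epsilon> / 2) \<le> y powr 0" using y2 \<epsilon> by (intro powr_mono) auto
    then have \<delta>1: "\<delta> \<le> 1" using y2 by (simp add: \<delta>_def)
    have \<delta>inv: "1 / y powr (\<epsilon> / 2) = \<delta>"
      using powr_minus_divide[of y "\<epsilon> / 2"] by (simp add: \<delta>_def)
    have "\<delta> * \<delta> = y powr (- \<epsilon> / 2 + - \<epsilon> / 2)"
      unfolding \<delta>_def by (rule powr_add[symmetric])
    then have \<delta>\<delta>: "1 / y powr \<epsilon> = \<delta> * \<delta>"
      using powr_minus_divide[of y \<epsilon>] by simp
    have B1: "\<bar>riesz_mean b (Suc k) y\<bar> \<le> K * exp y * (\<delta> * \<delta>)"
      using K[OF y2(2)] by (simp add: \<delta>\<delta>[symmetric])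
    have B2: "\<bar>riesz_mean b (Suc k) (y + \<delta>)\<bar> \<le> 4 * K * exp y * (\<delta> * \<delta>)"
    proof -
      have "\<bar>riesz_mean b (Suc k) (y + \<delta>)\<bar> \<le> K * exp (y + \<delta>) / (y + \<delta>) powr \<epsilon>"
        using y2 \<delta>0 by (intro K) auto
      also have "\<dots> \<le> K * (4 * exp y) / y powr \<epsilon>"
      proof (rule frac_le)
        have "exp \<delta> \<le> exp 1" using \<delta>1 by simp
        also have "\<dots> \<le> 4" using exp_le by simp
        finally show "K * exp (y + \<delta>) \<le> K * (4 * exp y)"
          using K0 by (intro mult_left_mono) (auto simp: exp_add)
        show "y powr \<epsilon> \<le> (y + \<delta>) powr \<epsilon>" using y2 \<delta>0 \<epsilon> by (intro powr_mono2) auto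
      qed (use K0 y2 in auto)
      also have "\<dots> = 4 * K * exp y * (\<delta> * \<delta>)" by (simp add: \<delta>\<delta>[symmetric])
      finally show ?thesis .
    qed
    have B3: "\<bar>riesz_mean b (Suc k) (y - \<delta>)\<bar> \<le> 2 * K * exp y * (\<delta> * \<delta>)"
    proof -
      have yd: "y - \<delta> \<ge> y / 2" using y2 \<delta>1 by simp
      have "\<bar>riesz_mean b (Suc k) (y - \<delta>)\<bar> \<le> K * exp (y - \<delta>) / (y - \<delta>) powr \<epsilon>"
        using yd y by (intro K) auto
      also have "\<dots> \<le> K * exp y / (y powr \<epsilon> / 2)"
      proof (rule frac_le)
        show "K * exp (y - \<delta>) \<le> K * exp y" using K0 \<delta>0 by (intro mult_left_mono) auto
        have "2 powr \<epsilon> \<le> 2 powr 1" using \<epsilon> by (intro powr_mono) auto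
        then have "y powr \<epsilon> / 2 \<le> y powr \<epsilon> / 2 powr \<epsilon>" using y2 by (intro divide_left_mono) auto
        also have "\<dots> = (y / 2) powr \<epsilon>" using y2 by (simp add: powr_divide)
        also have "\<dots> \<le> (y - \<delta>) powr \<epsilon>" using yd y2 \<epsilon> by (intro powr_mono2) auto
        finally show "y powr \<epsilon> / 2 \<le> (y - \<delta>) powr \<epsilon>" .
      qed (use K0 y2 in auto)
      also have "\<dots> = 2 * K * exp y * (\<delta> * \<delta>)" by (simp add: \<delta>\<delta>[symmetric])
      finally show ?thesis .
    qed
    \<comment> \<open>This absorbs the additive 1 of \<open>riesz_one_difference\<close>.\<close>
    have e1: "1 \<le> exp y * \<delta>"
    proof -
      have "y powr (\<epsilon> / 2) \<le> y powr 1" using y2 \<epsilon> by (intro powr_mono) auto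
      also have "\<dots> = y" using y2 by simp
      also have "\<dots> \<le> exp y" using exp_ge_add_one_self[of y] by linarith
      finally have "y powr (\<epsilon> / 2) * \<delta> \<le> exp y * \<delta>" using \<delta>0 by (intro mult_right_mono) auto
      moreover have "y powr (\<epsilon> / 2) * \<delta> = 1" using y2 by (simp add: \<delta>inv[symmetric])
      ultimately show ?thesis by simp
    qed
    have up: "riesz_mean b k y \<le> (5 * K + A + 1) * exp y * \<delta>"
    proof -
      have "\<delta> * riesz_mean b k y \<le> riesz_mean b (Suc k) (y + \<delta>) - riesz_mean b (Suc k) y +
           \<delta> * (riesz_one k (y + \<delta>) - riesz_one k y)"
        by (rule riesz_mean_difference(1)[OF b \<delta>0])
      also have "\<delta> * (riesz_one k (y + \<delta>) - riesz_one k y) \<le> \<delta> * (A * (\<delta> * exp y) + exp y * \<delta>)"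
        using riesz_one_difference[OF \<delta>0 \<delta>1, of k y] \<delta>0 e1 unfolding A_def by (intro mult_left_mono) auto
      finally have "\<delta> * riesz_mean b k y \<le> \<delta> * ((5 * K + A + 1) * exp y * \<delta>)"
        using B1 B2 by (simp add: algebra_simps)
      then show ?thesis using \<delta>0 by simp
    qed
    have low: "- riesz_mean b k y \<le> (5 * K + A + 1) * exp y * \<delta>"
    proof -
      have "\<delta> * riesz_mean b k (y - \<delta> + \<delta>) \<ge> riesz_mean b (Suc k) (y - \<delta> + \<delta>) - riesz_mean b (Suc k) (y - \<delta>) -
           \<delta> * (riesz_one k (y - \<delta> + \<delta>) - riesz_one k (y - \<delta>))"
        by (rule riesz_mean_difference(2)[OF b \<delta>0])
      then have 1: "\<delta> * (- riesz_mean b k y) \<le> \<bar>riesz_mean b (Suc k) y\<bar> + \<bar>riesz_mean b (Suc k) (y - \<delta>)\<bar> +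
           \<delta> * (riesz_one k (y - \<delta> + \<delta>) - riesz_one k (y - \<delta>))"
        by simp
      have "riesz_one k (y - \<delta> + \<delta>) - riesz_one k (y - \<delta>) \<le> A * (\<delta> * exp (y - \<delta>)) + 1"
        using riesz_one_difference[OF \<delta>0 \<delta>1, of k "y - \<delta>"] unfolding A_def .
      also have "\<dots> \<le> A * (\<delta> * exp y) + exp y * \<delta>"
        using A \<delta>0 e1 by (intro add_mono mult_left_mono) auto
      finally have "\<delta> * (riesz_one k (y - \<delta> + \<delta>) - riesz_one k (y - \<delta>)) \<le> \<delta> * (A * (\<delta> * exp y) + exp y * \<delta>)"
        using \<delta>0 by (intro mult_left_mono) auto
      moreover have "K * exp y * (\<delta> * \<delta>) \<ge> 0" using K0 by simp
      ultimately have "\<delta> * (- riesz_mean b k y) \<le> \<delta> * ((5 * K + A + 1) * exp y * \<delta>)"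
        using 1 B1 B3 by (simp add: algebra_simps)
      then show ?thesis unfolding mult_le_cancel_left_pos[OF \<delta>0] .
    qed
    have "(5 * K + A + 1) * exp y / y powr (\<epsilon> / 2) = (5 * K + A + 1) * exp y * \<delta>"
      by (simp add: \<delta>inv[symmetric])
    with up low show ?thesis by (simp add: abs_le_iff)
  qed
  show ?thesis
    unfolding riesz_saving_def
    by (rule exI[of _ "5 * K + A + 1"], rule exI[of _ "2 * y0"], rule exI[of _ "\<epsilon> / 2"])
       (use main y0 \<epsilon> in auto)
qed

theorem power_saving:
  assumes b: "abs_conv b" "\<And>n. n \<ge> 1 \<Longrightarrow> b n \<ge> -1" and C: "C \<ge> 0" and r: "0 < r" "r \<le> 1"
    and D: "\<And>s. 1 < Re s \<Longrightarrow> Re s \<le> 1 + r \<Longrightarrow> norm (dirichlet_series b s) \<le> C * (1 + \<bar>Im s\<bar>) ^ 10"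
    and D': "\<And>s. 1 < Re s \<Longrightarrow> Re s \<le> 1 + r \<Longrightarrow>
        norm (dirichlet_series (\<lambda>n. b n * ln (real n)) s) \<le> C * (1 + \<bar>Im s\<bar>) ^ 10"
  shows "riesz_saving b 0"
proof -
  obtain K where K: "\<And>y. y \<ge> 1 / r \<Longrightarrow> \<bar>riesz_mean b 11 y\<bar> \<le> K * exp y / y"
    using riesz_mean_decay[OF b(1) C r D D'] by blast
  have "\<bar>riesz_mean b 11 y\<bar> \<le> K * exp y / y powr 1" if y: "y \<ge> 1 / r" for y
  proof -
    have "1 / r > 0" using r by simp
    then have "y > 0" using y by linarith
    then have "y powr 1 = y" by simp
    then show ?thesis using K[OF y] by simp
  qed
  moreover have "1 / r \<ge> 1" using r by simp
  ultimately have "riesz_saving b 11"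
    unfolding riesz_saving_def
    by (intro exI[of _ K] exI[of _ "1 / r"] exI[of _ "1::real"]) auto
  moreover have "riesz_saving b k \<Longrightarrow> riesz_saving b 0" for k
  proof (induction k)
    case (Suc k)
    from riesz_saving_Suc[OF b(2) Suc.prems] show ?case by (rule Suc.IH)
  qed
  ultimately show ?thesis by blast
qed

section \<open>Sums over primes\<close>

text \<open>Sums start at 2 so that \<open>ln n\<close> never vanishes.\<close>

definition log_saving :: "(nat \<Rightarrow> real) \<Rightarrow> real \<Rightarrow> bool" where
  "log_saving f \<epsilon> \<longleftrightarrow> (\<lambda>N. \<Sum>n=2..N. f n) \<in> O(\<lambda>N. real N / ln (real N) powr \<epsilon>)"

text \<open>For N \<ge> 2 the comparison function is positive, so the finitely many early N can be
  absorbed by adding all their ratios to the constant.\<close>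

lemma log_savingE:
  assumes "log_saving f \<epsilon>"
  obtains K where "K \<ge> 0" "\<And>N. N \<ge> 2 \<Longrightarrow> \<bar>\<Sum>n=2..N. f n\<bar> \<le> K * (real N / ln (real N) powr \<epsilon>)"
proof -
  let ?S = "\<lambda>N. \<Sum>n=2..N. f n" and ?g = "\<lambda>N. real N / ln (real N) powr \<epsilon>"
  obtain C where C: "C > 0" "eventually (\<lambda>N. norm (?S N) \<le> C * norm (?g N)) sequentially"
    using assms unfolding log_saving_def by (elim landau_o.bigE)
  then obtain N0 where N0: "\<And>N. N \<ge> N0 \<Longrightarrow> norm (?S N) \<le> C * norm (?g N)"
    by (auto simp: eventually_sequentially)
  have g: "?g N > 0" if "N \<ge> 2" for N using that by simp
  define K where "K = C + (\<Sum>N\<in>{2..N0}. \<bar>?S N\<bar> / ?g N)"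
  have nn: "(\<Sum>N\<in>{2..N0}. \<bar>?S N\<bar> / ?g N) \<ge> 0"
    by (intro sum_nonneg divide_nonneg_nonneg) (use g in \<open>auto simp: less_imp_le\<close>)
  show ?thesis
  proof (rule that[of K])
    show "K \<ge> 0" using C nn by (simp add: K_def)
    fix N :: nat assume N: "N \<ge> 2"
    show "\<bar>?S N\<bar> \<le> K * ?g N"
    proof (cases "N \<ge> N0")
      case True
      have "\<bar>?S N\<bar> \<le> C * ?g N" using N0[OF True] g[OF N] by simp
      also have "\<dots> \<le> K * ?g N"
        using g[OF N] nn by (intro mult_right_mono) (auto simp: K_def)
      finally show ?thesis .
    next
      case False
      have "\<bar>?S N\<bar> / ?g N \<le> (\<Sum>N\<in>{2..N0}. \<bar>?S N\<bar> / ?g N)"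
      proof (rule member_le_sum)
        show "N \<in> {2..N0}" using N False by auto
        show "0 \<le> \<bar>?S M\<bar> / ?g M" if "M \<in> {2..N0} - {N}" for M
          using g[of M] that by (intro divide_nonneg_nonneg) auto
      qed simp
      also have "\<dots> \<le> K" using C by (simp add: K_def)
      finally show ?thesis unfolding pos_divide_le_eq[OF g[OF N]] .
    qed
  qed
qed

lemma log_saving_mono:
  assumes "log_saving f \<epsilon>" "\<epsilon>' \<le> \<epsilon>"
  shows "log_saving f \<epsilon>'"
proof -
  have "eventually (\<lambda>N::nat. ln (real N) \<ge> 1) sequentially" by real_asymp
  then have "eventually (\<lambda>N. norm (real N / ln (real N) powr \<epsilon>) \<le> 1 * norm (real N / ln (real N) powr \<epsilon>')) sequentially"
  proof eventually_elim
    case (elim N)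
    have "ln (real N) powr \<epsilon>' \<le> ln (real N) powr \<epsilon>" using elim assms(2) by (intro powr_mono)
    then show ?case using elim by (auto intro!: divide_left_mono)
  qed
  then have "(\<lambda>N. real N / ln (real N) powr \<epsilon>) \<in> O(\<lambda>N. real N / ln (real N) powr \<epsilon>')"
    by (rule bigoI)
  then show ?thesis using assms(1) unfolding log_saving_def by (rule landau_o.big_trans[rotated])
qed

lemma log_saving_add:
  assumes "log_saving f \<epsilon>" "log_saving g \<epsilon>"
  shows "log_saving (\<lambda>n. f n + g n) \<epsilon>"
  using sum_in_bigo(1)[OF assms[unfolded log_saving_def]] by (simp add: log_saving_def sum.distrib)

lemma log_saving_diff:
  assumes "log_saving f \<epsilon>" "log_saving g \<epsilon>"
  shows "log_saving (\<lambda>n. f n - g n) \<epsilon>"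
  using sum_in_bigo(2)[OF assms[unfolded log_saving_def]] by (simp add: log_saving_def sum_subtractf)

lemma log_saving_cong:
  assumes "log_saving f \<epsilon>" "\<And>n. n \<ge> 2 \<Longrightarrow> f n = g n"
  shows "log_saving g \<epsilon>"
proof -
  have "(\<Sum>n=2..N. f n) = (\<Sum>n=2..N. g n)" for N using assms(2) by (intro sum.cong) auto
  then show ?thesis using assms(1) by (simp add: log_saving_def)
qed

lemma log_saving_riesz:
  assumes "riesz_saving b 0"
  obtains \<epsilon> where "0 < \<epsilon>" "\<epsilon> \<le> 1" "log_saving b \<epsilon>"
proof -
  obtain K y0 \<epsilon> where y0: "y0 \<ge> 1" and \<epsilon>: "0 < \<epsilon>" "\<epsilon> \<le> 1"
    and K: "\<And>y. y \<ge> y0 \<Longrightarrow> \<bar>riesz_mean b 0 y\<bar> \<le> K * exp y / y powr \<epsilon>"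
    using assms unfolding riesz_saving_def by blast
  have rm: "riesz_mean b 0 (ln (real N)) = b 1 + (\<Sum>n=2..N. b n)" if "N \<ge> 1" for N
  proof -
    have "riesz_mean b 0 (ln (real N)) = (\<Sum>n=1..N. b n)"
      unfolding riesz_mean_def using that by (intro sum.cong) (auto simp: riesz_kernel_def)
    also have "\<dots> = b 1 + (\<Sum>n=2..N. b n)"
      using that by (simp add: sum.atLeast_Suc_atMost numeral_2_eq_2)
    finally show ?thesis .
  qed
  have "(\<lambda>N. riesz_mean b 0 (ln (real N))) \<in> O(\<lambda>N. real N / ln (real N) powr \<epsilon>)"
  proof (rule bigoI)
    have "eventually (\<lambda>N::nat. ln (real N) \<ge> y0) sequentially" by real_asymp
    then show "eventually (\<lambda>N. norm (riesz_mean b 0 (ln (real N))) \<le> K * norm (real N / ln (real N) powr \<epsilon>)) sequentially"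
      using eventually_gt_at_top[of 0]
    proof eventually_elim
      case (elim N)
      then show ?case using K[of "ln (real N)"] by simp
    qed
  qed
  moreover have "(\<lambda>_. b 1) \<in> O(\<lambda>N. real N / ln (real N) powr \<epsilon>)"
  proof -
    have "(\<lambda>_. b 1) \<in> O(\<lambda>_. 1 :: real)" by simp
    also have "(\<lambda>_. 1 :: real) \<in> O(\<lambda>N::nat. real N / ln (real N) powr \<epsilon>)" by real_asymp
    finally show ?thesis .
  qed
  ultimately have mem: "(\<lambda>N. riesz_mean b 0 (ln (real N)) - b 1) \<in> O(\<lambda>N. real N / ln (real N) powr \<epsilon>)"
    by (rule sum_in_bigo(2))
  have ev: "eventually (\<lambda>N. riesz_mean b 0 (ln (real N)) - b 1 = (\<Sum>n=2..N. b n)) sequentially"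
    using eventually_ge_at_top[of 1] by eventually_elim (simp add: rm)
  have "log_saving b \<epsilon>"
    unfolding log_saving_def using mem landau_o.big.in_cong[OF ev] by blast
  with \<epsilon> that show ?thesis by blast
qed

lemma log_saving_mangoldt:
  obtains \<epsilon> where "0 < \<epsilon>" "\<epsilon> \<le> 1" "log_saving (\<lambda>n. mangoldt n - 1) \<epsilon>"
proof -
  obtain C r where *: "C > 0" "0 < r" "r \<le> 1"
    "\<And>s. 1 < Re s \<Longrightarrow> Re s \<le> 1 + r \<Longrightarrow>
       norm (dirichlet_series (\<lambda>n. mangoldt n - 1) s) \<le> C * (1 + \<bar>Im s\<bar>) ^ 10 \<and>
       norm (dirichlet_series (\<lambda>n. (mangoldt n - 1) * ln (real n)) s) \<le> C * (1 + \<bar>Im s\<bar>) ^ 10"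
    using zeta_mangoldt_bound by blast
  have "riesz_saving (\<lambda>n. mangoldt n - 1) 0"
  proof (rule power_saving[where C = C and r = r])
    show "abs_conv (\<lambda>n. mangoldt n - 1)" by (intro abs_conv_diff abs_conv_mangoldt abs_conv_const)
  qed (use * mangoldt_nonneg in auto)
  then show ?thesis using that by (rule log_saving_riesz)
qed

text \<open>The descent applies to (1 + c) \<Lambda> - 1, which is at least -1 because |c| \<le> 1;
  subtracting the result for \<Lambda> - 1 isolates the character.\<close>

lemma (in nonprincipal_character) log_saving_char_mangoldt:
  obtains \<epsilon> where "0 < \<epsilon>" "\<epsilon> \<le> 1" "log_saving (\<lambda>n. c n * mangoldt n) \<epsilon>"
proof -
  obtain C r where 1: "C > 0" "0 < r" "r \<le> 1"
    "\<And>s. 1 < Re s \<Longrightarrow> Re s \<le> 1 + r \<Longrightarrow>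
       norm (dirichlet_series (\<lambda>n. mangoldt n - 1) s) \<le> C * (1 + \<bar>Im s\<bar>) ^ 10 \<and>
       norm (dirichlet_series (\<lambda>n. (mangoldt n - 1) * ln (real n)) s) \<le> C * (1 + \<bar>Im s\<bar>) ^ 10"
    using zeta_mangoldt_bound by blast
  obtain C' r' where 2: "C' > 0" "0 < r'" "r' \<le> 1"
    "\<And>s. 1 < Re s \<Longrightarrow> Re s \<le> 1 + r' \<Longrightarrow>
       norm (dirichlet_series (\<lambda>n. c n * mangoldt n) s) \<le> C' * (1 + \<bar>Im s\<bar>) ^ 10 \<and>
       norm (dirichlet_series (\<lambda>n. c n * mangoldt n * ln (real n)) s) \<le> C' * (1 + \<bar>Im s\<bar>) ^ 10"
    using char_mangoldt_bound[OF value_at_1_nonzero] by blast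
  define b where "b n = (mangoldt n - 1) + c n * mangoldt n" for n
  have ac: "abs_conv (\<lambda>n. mangoldt n - 1)" by (intro abs_conv_diff abs_conv_mangoldt abs_conv_const)
  have "riesz_saving b 0"
  proof (rule power_saving[where C = "C + C'" and r = "min r r'"])
    show "abs_conv b" unfolding b_def by (intro abs_conv_add ac abs_conv_char_mangoldt)
    show "b n \<ge> -1" for n
    proof -
      have "\<bar>c n * mangoldt n\<bar> \<le> 1 * mangoldt n"
        unfolding abs_mult using abs_le_1 mangoldt_nonneg by (intro mult_mono) auto
      then show ?thesis by (simp add: b_def abs_le_iff)
    qed
    fix s assume s: "1 < Re s" "Re s \<le> 1 + min r r'"
    then have s': "Re s \<le> 1 + r" "Re s \<le> 1 + r'" by linarith+
    have "dirichlet_series b s = dirichlet_series (\<lambda>n. mangoldt n - 1) s + dirichlet_series (\<lambda>n. c n * mangoldt n) s"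
      unfolding b_def by (rule dirichlet_series_add[OF ac abs_conv_char_mangoldt s(1)])
    then have "norm (dirichlet_series b s) \<le> norm (dirichlet_series (\<lambda>n. mangoldt n - 1) s) + norm (dirichlet_series (\<lambda>n. c n * mangoldt n) s)"
      by (simp add: norm_triangle_ineq)
    then show "norm (dirichlet_series b s) \<le> (C + C') * (1 + \<bar>Im s\<bar>) ^ 10"
      using 1(4)[OF s(1) s'(1)] 2(4)[OF s(1) s'(2)] by (simp add: distrib_right)
    have "dirichlet_series (\<lambda>n. b n * ln (real n)) s = dirichlet_series (\<lambda>n. (mangoldt n - 1) * ln (real n)) s +
        dirichlet_series (\<lambda>n. c n * mangoldt n * ln (real n)) s"
      unfolding b_def distrib_right
      by (rule dirichlet_series_add[OF abs_conv_ln[OF ac] abs_conv_ln[OF abs_conv_char_mangoldt] s(1)])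
    then have "norm (dirichlet_series (\<lambda>n. b n * ln (real n)) s) \<le>
        norm (dirichlet_series (\<lambda>n. (mangoldt n - 1) * ln (real n)) s) +
        norm (dirichlet_series (\<lambda>n. c n * mangoldt n * ln (real n)) s)"
      by (simp add: norm_triangle_ineq)
    then show "norm (dirichlet_series (\<lambda>n. b n * ln (real n)) s) \<le> (C + C') * (1 + \<bar>Im s\<bar>) ^ 10"
      using 1(4)[OF s(1) s'(1)] 2(4)[OF s(1) s'(2)] by (simp add: distrib_right)
  qed (use 1 2 in auto)
  then obtain \<epsilon> where \<epsilon>: "0 < \<epsilon>" "\<epsilon> \<le> 1" "log_saving b \<epsilon>" by (rule log_saving_riesz)
  obtain \<epsilon>' where \<epsilon>': "0 < \<epsilon>'" "\<epsilon>' \<le> 1" "log_saving (\<lambda>n. mangoldt n - 1) \<epsilon>'"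
    by (rule log_saving_mangoldt)
  show ?thesis
  proof (rule that[of "min \<epsilon> \<epsilon>'"])
    have "log_saving (\<lambda>n. b n - (mangoldt n - 1)) (min \<epsilon> \<epsilon>')"
      by (intro log_saving_diff log_saving_mono[OF \<epsilon>(3)] log_saving_mono[OF \<epsilon>'(3)]) auto
    then show "log_saving (\<lambda>n. c n * mangoldt n) (min \<epsilon> \<epsilon>')" by (simp add: b_def)
  qed (use \<epsilon> \<epsilon>' in auto)
qed

text \<open>The exponent is at least 2, so the base is at most sqrt N, and the exponent is at most
  log 2 N because the base is at least 2; such pairs are counted.\<close>

lemma card_proper_prime_powers_le:
  "real (card {n\<in>{2..N}. primepow n \<and> \<not> prime n}) \<le> (sqrt (real N) + 1) * (log 2 (real N) + 1)" if N: "N \<ge> 2"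
proof -
  let ?A = "{0..nat \<lfloor>sqrt (real N)\<rfloor>} \<times> {0..nat \<lfloor>log 2 (real N)\<rfloor>}"
  have "{n\<in>{2..N}. primepow n \<and> \<not> prime n} \<subseteq> (\<lambda>(p, k). p ^ k) ` ?A"
  proof
    fix n assume n: "n \<in> {n\<in>{2..N}. primepow n \<and> \<not> prime n}"
    then obtain p k where pk: "prime p" "k > 0" "n = p ^ k" by (auto simp: primepow_def)
    have "k \<noteq> 1" using n pk by auto
    then have k: "k \<ge> 2" using pk by simp
    have p2: "p \<ge> 2" using pk prime_ge_2_nat by blast
    have "p ^ 2 \<le> p ^ k" using k p2 by (intro power_increasing) auto
    also have "\<dots> \<le> N" using n pk by simp
    finally have "real p ^ 2 \<le> real N" by (metis of_nat_le_iff of_nat_power)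
    then have "real p \<le> sqrt (real N)" by (rule real_le_rsqrt)
    then have 1: "p \<le> nat \<lfloor>sqrt (real N)\<rfloor>" by (rule le_nat_floor)
    have "2 ^ k \<le> p ^ k" using p2 by (intro power_mono) auto
    also have "\<dots> \<le> N" using n pk by simp
    finally have "2 ^ k \<le> real N" by (metis of_nat_le_iff of_nat_numeral of_nat_power)
    then have "real k \<le> log 2 (real N)" using N by (simp add: le_log_iff powr_realpow)
    then have 2: "k \<le> nat \<lfloor>log 2 (real N)\<rfloor>" by (rule le_nat_floor)
    show "n \<in> (\<lambda>(p, k). p ^ k) ` ?A" using 1 2 pk by (intro image_eqI[of _ _ "(p, k)"]) auto
  qed
  then have "card {n\<in>{2..N}. primepow n \<and> \<not> prime n} \<le> card ?A"
    by (rule surj_card_le[rotated]) auto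
  also have "card ?A = (nat \<lfloor>sqrt (real N)\<rfloor> + 1) * (nat \<lfloor>log 2 (real N)\<rfloor> + 1)" by simp
  finally have "real (card {n\<in>{2..N}. primepow n \<and> \<not> prime n}) \<le>
      (real (nat \<lfloor>sqrt (real N)\<rfloor>) + 1) * (real (nat \<lfloor>log 2 (real N)\<rfloor>) + 1)"
    by (simp only: of_nat_le_iff[where ?'a = real, symmetric] of_nat_mult of_nat_add of_nat_1)
  also have "\<dots> \<le> (sqrt (real N) + 1) * (log 2 (real N) + 1)"
    using N by (intro mult_mono add_mono) (auto simp: of_nat_floor)
  finally show ?thesis .
qed

lemma log_saving_prime_powers:
  assumes c: "\<And>n. \<bar>c n\<bar> \<le> 1"
  shows "log_saving (\<lambda>n. if prime n then 0 else c n * mangoldt n) 1"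
proof -
  have "eventually (\<lambda>N. norm (\<Sum>n=2..N. if prime n then 0 else c n * mangoldt n) \<le>
      1 * norm ((sqrt (real N) + 1) * (log 2 (real N) + 1) * ln (real N))) sequentially"
    using eventually_ge_at_top[of 2]
  proof eventually_elim
    case (elim N)
    have "norm (\<Sum>n=2..N. if prime n then 0 else c n * mangoldt n) \<le> (\<Sum>n=2..N. if primepow n \<and> \<not> prime n then ln (real N) else 0)"
    proof (rule sum_norm_le)
      fix n assume n: "n \<in> {2..N}"
      have "\<bar>c n * mangoldt n\<bar> \<le> 1 * mangoldt n"
        unfolding abs_mult using c mangoldt_nonneg by (intro mult_mono) auto
      moreover have "mangoldt n \<le> ln (real N)"
      proof -
        have "mangoldt n \<le> ln (real n)" by (rule mangoldt_le_ln)
        also have "\<dots> \<le> ln (real N)" using n by simp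
        finally show ?thesis .
      qed
      ultimately show "norm (if prime n then 0 else c n * mangoldt n) \<le> (if primepow n \<and> \<not> prime n then ln (real N) else 0)"
        by (auto simp: mangoldt_def)
    qed
    also have "\<dots> = real (card {n\<in>{2..N}. primepow n \<and> \<not> prime n}) * ln (real N)"
      by (subst sum.inter_filter[symmetric]) auto
    also have "\<dots> \<le> (sqrt (real N) + 1) * (log 2 (real N) + 1) * ln (real N)"
      using elim by (intro mult_right_mono card_proper_prime_powers_le) auto
    finally show ?case by simp
  qed
  then have "(\<lambda>N. \<Sum>n=2..N. if prime n then 0 else c n * mangoldt n) \<in>
      O(\<lambda>N. (sqrt (real N) + 1) * (log 2 (real N) + 1) * ln (real N))" by (rule bigoI)
  also have "(\<lambda>N::nat. (sqrt (real N) + 1) * (log 2 (real N) + 1) * ln (real N)) \<in> O(\<lambda>N. real N / ln (real N) powr 1)"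
    by real_asymp
  finally show ?thesis by (simp add: log_saving_def)
qed

section \<open>Partial summation with logarithmic weights\<close>

lemma ln_square_le_sqrt:
  assumes "x \<ge> 1"
  shows "ln x ^ 2 \<le> 16 * sqrt x"
proof -
  have "ln x \<le> x powr (1 / 4) / (1 / 4)" using assms by (intro ln_powr_bound) auto
  then have "ln x ^ 2 \<le> (4 * x powr (1 / 4)) ^ 2" using assms by (intro power_mono) auto
  also have "\<dots> = 16 * (x powr (1 / 4) * x powr (1 / 4))" by (simp add: power2_eq_square)
  also have "x powr (1 / 4) * x powr (1 / 4) = sqrt x"
    using assms by (simp add: powr_add[symmetric] powr_half_sqrt)
  finally show ?thesis .
qed

text \<open>The sum is cut at sqrt N. Above it ln n \<ge> (ln N)/2 gives 4 / (ln N)^2 per term;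
  below it there are at most sqrt N terms, each at most 4, and sqrt N \<le> 16 N / (ln N)^2. Hence
  68 = 4 + 64.\<close>

lemma sum_inverse_ln_square_le:
  assumes N: "N \<ge> 2"
  shows "(\<Sum>n=2..N. 1 / ln (real n) ^ 2) \<le> 68 * (real N / ln (real N) ^ 2)"
proof -
  define L where "L = ln (real N)"
  have L: "L > 0" using N by (simp add: L_def)
  have ln2: "ln 2 \<ge> (1/2 :: real)" using ln2_ge_two_thirds by simp
  have "1 / ln (real n) ^ 2 \<le> 4 / L ^ 2 + (if real n \<le> sqrt (real N) then 4 else 0)" if n: "n \<in> {2..N}" for n
  proof (cases "real n \<le> sqrt (real N)")
    case True
    have "ln 2 \<le> ln (real n)" using n by simp
    then have "1 / 2 \<le> ln (real n)" using ln2 by linarith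
    then have "1 / ln (real n) ^ 2 \<le> 1 / (1 / 2) ^ 2" by (intro frac_le power_mono) auto
    then show ?thesis using True by (simp add: power2_eq_square add_increasing)
  next
    case False
    then have "ln (sqrt (real N)) \<le> ln (real n)" using N n by simp
    then have "L / 2 \<le> ln (real n)" using N by (simp add: L_def ln_sqrt)
    then have "1 / ln (real n) ^ 2 \<le> 1 / (L / 2) ^ 2" using L by (intro frac_le power_mono) auto
    then show ?thesis using False by (simp add: power_divide)
  qed
  then have "(\<Sum>n=2..N. 1 / ln (real n) ^ 2) \<le> (\<Sum>n=2..N. 4 / L ^ 2 + (if real n \<le> sqrt (real N) then 4 else 0))"
    by (rule sum_mono)
  also have "\<dots> = real (N - 1) * (4 / L ^ 2) + 4 * real (card {n\<in>{2..N}. real n \<le> sqrt (real N)})"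
    by (simp add: sum.distrib sum.inter_filter[symmetric])
  also have "\<dots> \<le> real N * (4 / L ^ 2) + 4 * (16 * (real N / L ^ 2))"
  proof (intro add_mono mult_left_mono mult_right_mono)
    have "real (card {n\<in>{2..N}. real n \<le> sqrt (real N)}) \<le> real (card {1..nat \<lfloor>sqrt (real N)\<rfloor>})"
      by (intro of_nat_mono card_mono) (auto intro: le_nat_floor)
    also have "\<dots> \<le> sqrt (real N)" by simp
    also have "\<dots> \<le> 16 * (real N / L ^ 2)"
    proof -
      have "sqrt (real N) * L ^ 2 \<le> sqrt (real N) * (16 * sqrt (real N))"
        unfolding L_def using N by (intro mult_left_mono ln_square_le_sqrt) auto
      also have "sqrt (real N) * (16 * sqrt (real N)) = 16 * real N"
        using real_sqrt_mult_self[of "real N"] by (simp add: mult.left_commute)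
      finally have "sqrt (real N) * L ^ 2 \<le> 16 * real N" .
      then show ?thesis using L by (simp add: field_simps)
    qed
    finally show "real (card {n\<in>{2..N}. real n \<le> sqrt (real N)}) \<le> 16 * (real N / L ^ 2)" .
  qed auto
  finally show ?thesis by (simp add: L_def)
qed

lemma abel_sum_from_2:
  fixes f w :: "nat \<Rightarrow> real"
  shows "(\<Sum>n=2..N. f n * w n) = (\<Sum>n=2..N. f n) * w (Suc N) + (\<Sum>n=2..N. (\<Sum>i=2..n. f i) * (w n - w (Suc n)))"
proof (induction N)
  case (Suc N)
  show ?case
  proof (cases "N \<ge> 1")
    case True
    then have "{2..Suc N} = insert (Suc N) {2..N}" by auto
    then show ?thesis using Suc by (simp add: algebra_simps)
  next
    case False
    then show ?thesis by simp
  qed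
qed simp

lemma ln_powr_ge_half:
  assumes "n \<ge> 2" "0 \<le> a" "a \<le> 2"
  shows "1 / ln (real n) powr a \<le> 4"
proof -
  have "ln 2 \<le> ln (real n)" using assms by simp
  then have h: "1 / 2 \<le> ln (real n)" using ln2_ge_two_thirds by linarith
  have "(1 / 4 :: real) = (1 / 2) powr 2" by (simp add: power2_eq_square)
  also have "\<dots> \<le> (1 / 2) powr a" using assms by (intro powr_mono') auto
  also have "\<dots> \<le> ln (real n) powr a" using h assms by (intro powr_mono2) auto
  finally show ?thesis using h by (simp add: divide_simps)
qed

lemma inverse_ln_diff:
  assumes "n \<ge> 2"
  shows "0 \<le> 1 / ln (real n) - 1 / ln (real (Suc n))"
    and "1 / ln (real n) - 1 / ln (real (Suc n)) \<le> 1 / (real n * ln (real n) ^ 2)"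
proof -
  define p q where "p = ln (real n)" and "q = ln (real (Suc n))"
  have p: "p > 0" using assms by (simp add: p_def)
  have pq: "p \<le> q" using assms by (simp add: p_def q_def)
  have "1 + 1 / real n = real (Suc n) / real n" using assms by (simp add: field_simps)
  then have "q - p = ln (1 + 1 / real n)"
    using assms by (simp add: p_def q_def ln_div)
  also have "\<dots> \<le> 1 / real n" using assms by (intro ln_add_one_self_le_self) auto
  finally have qp: "q - p \<le> 1 / real n" .
  have eq: "1 / p - 1 / q = (q - p) / (p * q)" using p pq by (simp add: field_simps)
  show "0 \<le> 1 / ln (real n) - 1 / ln (real (Suc n))"
    unfolding p_def[symmetric] q_def[symmetric] eq using p pq by simp
  have "(q - p) / (p * q) \<le> (1 / real n) / (p * p)"
    using p pq qp assms by (intro frac_le mult_left_mono) auto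
  then show "1 / ln (real n) - 1 / ln (real (Suc n)) \<le> 1 / (real n * ln (real n) ^ 2)"
    unfolding p_def[symmetric] q_def[symmetric] eq by (simp add: power2_eq_square)
qed

text \<open>Removing the weight ln n by Abel summation gains one logarithm in the boundary term. The
  remaining sum is O(N / (ln N)^2), which is good enough exactly because \<epsilon> \<le> 1.\<close>

theorem log_saving_divide_ln:
  assumes f: "log_saving f \<epsilon>" and \<epsilon>: "0 \<le> \<epsilon>" "\<epsilon> \<le> 1"
  shows "log_saving (\<lambda>n. f n / ln (real n)) (1 + \<epsilon>)"
proof -
  obtain K where K: "K \<ge> 0" "\<And>N. N \<ge> 2 \<Longrightarrow> \<bar>\<Sum>n=2..N. f n\<bar> \<le> K * (real N / ln (real N) powr \<epsilon>)"
    using log_savingE[OF f] by blast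
  let ?F = "\<lambda>N. \<Sum>n=2..N. f n"
  have "eventually (\<lambda>N. norm (\<Sum>n=2..N. f n / ln (real n)) \<le> (K + 4 * K * 68) * norm (real N / ln (real N) powr (1 + \<epsilon>))) sequentially"
    \<comment> \<open>Since 3 > e, here ln N \<ge> 1, so powers of ln N increase with the
      exponent.\<close>
    using eventually_ge_at_top[of 3]
  proof eventually_elim
    case (elim N)
    have N2: "N \<ge> 2" using elim by simp
    have "exp 1 \<le> real N" using exp_le elim by linarith
    then have lnN: "ln (real N) \<ge> 1" using ln_ge_iff[of "real N" 1] elim by simp
    have "(\<Sum>n=2..N. f n / ln (real n)) = ?F N * (1 / ln (real (Suc N))) +
        (\<Sum>n=2..N. ?F n * (1 / ln (real n) - 1 / ln (real (Suc n))))"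
      using abel_sum_from_2[of f "\<lambda>n. 1 / ln (real n)" N] by simp
    also have "norm \<dots> \<le> norm (?F N * (1 / ln (real (Suc N)))) +
        (\<Sum>n=2..N. norm (?F n * (1 / ln (real n) - 1 / ln (real (Suc n)))))"
      by (intro order_trans[OF norm_triangle_ineq] add_mono norm_sum order_refl)
    also have "\<dots> \<le> K * (real N / ln (real N) powr (1 + \<epsilon>)) + (\<Sum>n=2..N. 4 * K * (1 / ln (real n) ^ 2))"
    proof (rule add_mono)
      have "norm (?F N * (1 / ln (real (Suc N)))) \<le> K * (real N / ln (real N) powr \<epsilon>) * (1 / ln (real N))"
        unfolding norm_mult using K N2 lnN by (intro mult_mono) (auto intro!: divide_left_mono)
      also have "\<dots> = K * (real N / ln (real N) powr (1 + \<epsilon>))"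
        using lnN by (simp add: powr_add)
      finally show "norm (?F N * (1 / ln (real (Suc N)))) \<le> K * (real N / ln (real N) powr (1 + \<epsilon>))" .
      show "(\<Sum>n=2..N. norm (?F n * (1 / ln (real n) - 1 / ln (real (Suc n))))) \<le> (\<Sum>n=2..N. 4 * K * (1 / ln (real n) ^ 2))"
      proof (rule sum_mono)
        fix n assume n: "n \<in> {2..N}"
        have "norm (?F n * (1 / ln (real n) - 1 / ln (real (Suc n)))) \<le>
            (K * (real n / ln (real n) powr \<epsilon>)) * (1 / (real n * ln (real n) ^ 2))"
          unfolding norm_mult using K n inverse_ln_diff[of n] by (intro mult_mono) auto
        also have "\<dots> = K * (1 / ln (real n) ^ 2) * (1 / ln (real n) powr \<epsilon>)" using n by simp
        also have "\<dots> \<le> K * (1 / ln (real n) ^ 2) * 4"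
          using K n \<epsilon> by (intro mult_left_mono ln_powr_ge_half) auto
        finally show "norm (?F n * (1 / ln (real n) - 1 / ln (real (Suc n)))) \<le> 4 * K * (1 / ln (real n) ^ 2)"
          by (simp add: mult_ac)
      qed
    qed
    also have "(\<Sum>n=2..N. 4 * K * (1 / ln (real n) ^ 2)) = 4 * K * (\<Sum>n=2..N. 1 / ln (real n) ^ 2)"
      by (simp only: sum_distrib_left)
    also have "K * (real N / ln (real N) powr (1 + \<epsilon>)) + 4 * K * (\<Sum>n=2..N. 1 / ln (real n) ^ 2) \<le>
        K * (real N / ln (real N) powr (1 + \<epsilon>)) + 4 * K * (68 * (real N / ln (real N) powr (1 + \<epsilon>)))"
    proof (intro add_left_mono mult_left_mono)
      have "(\<Sum>n=2..N. 1 / ln (real n) ^ 2) \<le> 68 * (real N / ln (real N) ^ 2)"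
        by (rule sum_inverse_ln_square_le[OF N2])
      also have "\<dots> \<le> 68 * (real N / ln (real N) powr (1 + \<epsilon>))"
      proof -
        have "ln (real N) powr (1 + \<epsilon>) \<le> ln (real N) powr 2" using lnN \<epsilon> by (intro powr_mono) auto
        also have "\<dots> = ln (real N) ^ 2" using lnN by simp
        finally show ?thesis using lnN by (intro mult_left_mono divide_left_mono) auto
      qed
      finally show "(\<Sum>n=2..N. 1 / ln (real n) ^ 2) \<le> 68 * (real N / ln (real N) powr (1 + \<epsilon>))" .
    qed (use K in auto)
    finally show ?case by (simp add: algebra_simps)
  qed
  then show ?thesis unfolding log_saving_def by (rule bigoI)
qed

text \<open>Comparison with the telescoping differences of (ln n)^(-\<epsilon>), by the mean value
  theorem; indices start at 2 so that the logarithms are positive.\<close>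

lemma summable_inverse_n_ln_powr:
  assumes "\<epsilon> > 0"
  shows "summable (\<lambda>n. 1 / (real n * ln (real n) powr (1 + \<epsilon>)))"
proof -
  define w where "w n = ln (real (n + 2)) powr (-\<epsilon>)" for n
  have "w \<longlonglongrightarrow> 0" unfolding w_def using assms by real_asymp
  then have "summable (\<lambda>n. w n - w (Suc n))" by (rule telescope_summable')
  then have "summable (\<lambda>n. (1 / \<epsilon>) * (w n - w (Suc n)))" by (rule summable_mult)
  then have "summable (\<lambda>n. 1 / (real (n + 3) * ln (real (n + 3)) powr (1 + \<epsilon>)))"
  proof (rule summable_comparison_test')
    fix n :: nat
    define x where "x = real (n + 2)"
    have x: "x \<ge> 2" by (simp add: x_def)
    have "\<exists>z>x. z < x + 1 \<and> ln (x + 1) powr (-\<epsilon>) - ln x powr (-\<epsilon>) =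
        (x + 1 - x) * (-\<epsilon> * ln z powr (-\<epsilon> - 1) * (1 / z))"
    proof (rule MVT2)
      fix z assume "x \<le> z" "z \<le> x + 1"
      then have "z > 1" using x by simp
      then show "((\<lambda>x. ln x powr (-\<epsilon>)) has_real_derivative -\<epsilon> * ln z powr (-\<epsilon> - 1) * (1 / z)) (at z)"
        by (auto intro!: derivative_eq_intros simp: field_simps)
    qed simp
    then obtain z where z: "z > x" "z < x + 1"
      "ln x powr (-\<epsilon>) - ln (x + 1) powr (-\<epsilon>) = \<epsilon> * (ln z powr (-\<epsilon> - 1) * (1 / z))" by auto
    have "w n - w (Suc n) = \<epsilon> * (ln z powr (-\<epsilon> - 1) * (1 / z))"
      using z(3) by (simp add: w_def x_def add_ac)
    moreover have "1 / (real (n + 3) * ln (real (n + 3)) powr (1 + \<epsilon>)) \<le> ln z powr (-\<epsilon> - 1) * (1 / z)"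
    proof -
      have x1: "real (n + 3) = x + 1" by (simp add: x_def)
      have "ln z > 0" using z x by simp
      have "z * ln z powr (1 + \<epsilon>) \<le> (x + 1) * ln (x + 1) powr (1 + \<epsilon>)"
        using z x assms by (intro mult_mono powr_mono2) auto
      then have "1 / ((x + 1) * ln (x + 1) powr (1 + \<epsilon>)) \<le> 1 / (z * ln z powr (1 + \<epsilon>))"
        using z x \<open>ln z > 0\<close> by (intro frac_le) auto
      also have "\<dots> = ln z powr (- (1 + \<epsilon>)) * (1 / z)"
        by (simp only: powr_minus_divide) simp
      also have "- (1 + \<epsilon>) = - \<epsilon> - 1" by simp
      finally show ?thesis unfolding x1 .
    qed
    ultimately show "norm (1 / (real (n + 3) * ln (real (n + 3)) powr (1 + \<epsilon>))) \<le> (1 / \<epsilon>) * (w n - w (Suc n))"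
      using assms by simp
  qed
  then show ?thesis by (subst (asm) summable_iff_shift)
qed

text \<open>Abel summation turns the saving into the summable majorant 1 / (n (ln
  n)^(1+\<epsilon>)). This gives convergence of the prime sum of \<chi>(p)/p in increasing
  order.\<close>

theorem log_saving_summable:
  assumes g: "log_saving g (1 + \<epsilon>)" and \<epsilon>: "\<epsilon> > 0"
  shows "summable (\<lambda>n. g n / real n)"
proof -
  obtain K where K: "K \<ge> 0" "\<And>N. N \<ge> 2 \<Longrightarrow> \<bar>\<Sum>n=2..N. g n\<bar> \<le> K * (real N / ln (real N) powr (1 + \<epsilon>))"
    using log_savingE[OF g] by blast
  let ?G = "\<lambda>N. \<Sum>n=2..N. g n"
  let ?t = "\<lambda>n. ?G n * (1 / real n - 1 / real (Suc n))"
  have "summable ?t"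
  proof (rule summable_comparison_test'[of "\<lambda>n. K * (1 / (real n * ln (real n) powr (1 + \<epsilon>)))" 2])
    show "summable (\<lambda>n. K * (1 / (real n * ln (real n) powr (1 + \<epsilon>))))"
      by (intro summable_mult summable_inverse_n_ln_powr \<epsilon>)
    fix n :: nat assume n: "n \<ge> 2"
    have d: "1 / real n - 1 / real (Suc n) = 1 / (real n * real (Suc n))"
      using n by (simp add: field_simps)
    also have "\<dots> \<le> 1 / (real n * real n)" using n by (intro frac_le mult_left_mono) auto
    finally have "norm (?t n) \<le> (K * (real n / ln (real n) powr (1 + \<epsilon>))) * (1 / (real n * real n))"
      unfolding norm_mult using K n d by (intro mult_mono) auto
    also have "\<dots> = K * (1 / (real n * ln (real n) powr (1 + \<epsilon>)))" using n by (simp add: field_simps)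
    finally show "norm (?t n) \<le> K * (1 / (real n * ln (real n) powr (1 + \<epsilon>)))" .
  qed
  then have "(\<lambda>N. \<Sum>n<Suc N. ?t n) \<longlonglongrightarrow> suminf ?t" by (intro LIMSEQ_Suc summable_LIMSEQ)
  moreover have "(\<lambda>N. ?G N * (1 / real (Suc N))) \<longlonglongrightarrow> 0"
  proof (rule Lim_null_comparison)
    show "eventually (\<lambda>N. norm (?G N * (1 / real (Suc N))) \<le> K * (1 / ln (real N) powr (1 + \<epsilon>))) sequentially"
      using eventually_ge_at_top[of 2]
    proof eventually_elim
      case (elim N)
      have "norm (?G N * (1 / real (Suc N))) \<le> K * (real N / ln (real N) powr (1 + \<epsilon>)) * (1 / real N)"
        unfolding norm_mult using K elim by (intro mult_mono) (auto intro!: divide_left_mono)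
      also have "\<dots> = K * (1 / ln (real N) powr (1 + \<epsilon>))" using elim by simp
      finally show ?case .
    qed
    show "(\<lambda>N::nat. K * (1 / ln (real N) powr (1 + \<epsilon>))) \<longlonglongrightarrow> 0" using \<epsilon> by real_asymp
  qed
  ultimately have "(\<lambda>N. ?G N * (1 / real (Suc N)) + (\<Sum>n<Suc N. ?t n)) \<longlonglongrightarrow> 0 + suminf ?t"
    by (intro tendsto_add)
  moreover have "?G N * (1 / real (Suc N)) + (\<Sum>n<Suc N. ?t n) = (\<Sum>n=2..N. g n / real n)" for N
  proof -
    have "(\<Sum>n<Suc N. ?t n) = (\<Sum>n=2..N. ?t n)"
      by (rule sum.mono_neutral_right) auto
    then show ?thesis using abel_sum_from_2[of g "\<lambda>n. 1 / real n" N] by simp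
  qed
  ultimately have lim: "(\<lambda>N. \<Sum>n=2..N. g n / real n) \<longlonglongrightarrow> suminf ?t" by simp
  have "(\<lambda>N. g 1 + (\<Sum>n=2..N. g n / real n)) \<longlonglongrightarrow> g 1 + suminf ?t"
    by (intro tendsto_intros lim)
  moreover have "eventually (\<lambda>N. g 1 + (\<Sum>n=2..N. g n / real n) = (\<Sum>n<Suc N. g n / real n)) sequentially"
    using eventually_ge_at_top[of 1]
  proof eventually_elim
    case (elim N)
    have "{..<Suc N} = insert 0 (insert 1 {2..N})" using elim by auto
    then show ?case by simp
  qed
  ultimately have "(\<lambda>N. \<Sum>n<Suc N. g n / real n) \<longlonglongrightarrow> g 1 + suminf ?t"
    by (rule Lim_transform_eventually)
  then have "(\<lambda>N. \<Sum>n<N. g n / real n) \<longlonglongrightarrow> g 1 + suminf ?t" by (rule LIMSEQ_imp_Suc)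
  then show ?thesis unfolding summable_def sums_def by blast
qed

section \<open>The hyperbola method\<close>

definition psum :: "(nat \<Rightarrow> real) \<Rightarrow> real \<Rightarrow> real" where
  "psum f y = (\<Sum>n=2..nat \<lfloor>y\<rfloor>. f n)"

text \<open>Ordered pairs, so that the sum is bilinear and the expansion of the indicators applies
  directly; the passage to unordered products is made at the end.\<close>

definition pair_sum :: "(nat \<Rightarrow> real) \<Rightarrow> (nat \<Rightarrow> real) \<Rightarrow> real \<Rightarrow> real" where
  "pair_sum f g x = (\<Sum>(p, q) | 2 \<le> p \<and> 2 \<le> q \<and> real (p * q) \<le> x. f p * g q)"

lemma le_nat_floor_iff: "y \<ge> 0 \<Longrightarrow> n \<le> nat \<lfloor>y\<rfloor> \<longleftrightarrow> real n \<le> y"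
  by (simp add: le_nat_iff le_floor_iff)

lemma finite_pairs: "finite {(p, q). 2 \<le> p \<and> 2 \<le> q \<and> real (p * q) \<le> x}"
proof (rule finite_subset)
  show "{(p, q). 2 \<le> p \<and> 2 \<le> q \<and> real (p * q) \<le> x} \<subseteq> {0..nat \<lfloor>x\<rfloor>} \<times> {0..nat \<lfloor>x\<rfloor>}"
  proof
    fix z assume "z \<in> {(p, q). 2 \<le> p \<and> 2 \<le> q \<and> real (p * q) \<le> x}"
    then obtain p q where z: "z = (p, q)" and pq: "2 \<le> p" "2 \<le> q" "real (p * q) \<le> x" by auto
    from pq(3) have "p * q \<le> nat \<lfloor>x\<rfloor>" by (intro le_nat_floor)
    moreover have "p \<le> p * q" "q \<le> p * q" using pq by auto
    ultimately have "p \<le> nat \<lfloor>x\<rfloor>" "q \<le> nat \<lfloor>x\<rfloor>" by linarith+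
    then show "z \<in> {0..nat \<lfloor>x\<rfloor>} \<times> {0..nat \<lfloor>x\<rfloor>}" by (simp add: z)
  qed
qed auto

theorem hyperbola:
  assumes x: "x \<ge> 0"
  shows "pair_sum f g x = (\<Sum>p=2..nat \<lfloor>sqrt x\<rfloor>. f p * psum g (x / real p)) +
     (\<Sum>q=2..nat \<lfloor>sqrt x\<rfloor>. g q * psum f (x / real q)) - psum f (sqrt x) * psum g (sqrt x)"
proof -
  define N where "N = nat \<lfloor>sqrt x\<rfloor>"
  have N: "n \<le> N \<longleftrightarrow> real n \<le> sqrt x" for n unfolding N_def using x by (intro le_nat_floor_iff) auto
  let ?h = "\<lambda>(p, q). f p * g q"
  let ?A = "{(p, q). 2 \<le> p \<and> 2 \<le> q \<and> real (p * q) \<le> x}"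
  let ?A1 = "{(p, q). 2 \<le> p \<and> 2 \<le> q \<and> real (p * q) \<le> x \<and> p \<le> N}"
  let ?A2 = "{(p, q). 2 \<le> p \<and> 2 \<le> q \<and> real (p * q) \<le> x \<and> q \<le> N}"
  have fin: "finite ?A1" "finite ?A2" by (auto intro: finite_subset[OF _ finite_pairs[of x]])
  have un: "?A = ?A1 \<union> ?A2"
  proof -
    have "p \<le> N \<or> q \<le> N" if "real (p * q) \<le> x" for p q
    proof (rule ccontr)
      assume "\<not> (p \<le> N \<or> q \<le> N)"
      then have "sqrt x < real p" "sqrt x < real q" using N by auto
      then have "sqrt x * sqrt x < real p * real q" using x by (intro mult_strict_mono') auto
      then show False using that x by simp
    qed
    then show ?thesis by auto
  qed
  have int: "?A1 \<inter> ?A2 = {2..N} \<times> {2..N}"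
  proof -
    have "real (p * q) \<le> x" if "p \<le> N" "q \<le> N" for p q
    proof -
      have "real p * real q \<le> sqrt x * sqrt x" using that x N by (intro mult_mono) auto
      then show ?thesis using x by simp
    qed
    then show ?thesis by auto
  qed
  have A1: "?A1 = (SIGMA p:{2..N}. {2..nat \<lfloor>x / real p\<rfloor>})"
    using x by (auto simp: le_nat_floor_iff field_simps)
  have A2: "?A2 = (\<lambda>(q, p). (p, q)) ` (SIGMA q:{2..N}. {2..nat \<lfloor>x / real q\<rfloor>})"
  proof -
    have "(p, q) \<in> ?A2 \<longleftrightarrow> (q, p) \<in> (SIGMA q:{2..N}. {2..nat \<lfloor>x / real q\<rfloor>})" for p q
      using x by (auto simp: le_nat_floor_iff field_simps)
    then show ?thesis by (auto simp: image_iff) 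
  qed
  have "pair_sum f g x + sum ?h (?A1 \<inter> ?A2) = sum ?h ?A1 + sum ?h ?A2"
    unfolding pair_sum_def un using sum.union_inter[OF fin, of ?h] by simp
  moreover have "sum ?h ?A1 = (\<Sum>p=2..N. f p * psum g (x / real p))"
    unfolding A1 by (subst sum.Sigma[symmetric]) (auto simp: psum_def sum_distrib_left)
  moreover have "sum ?h ?A2 = (\<Sum>q=2..N. g q * psum f (x / real q))"
  proof -
    have "sum ?h ?A2 = (\<Sum>(q, p)\<in>(SIGMA q:{2..N}. {2..nat \<lfloor>x / real q\<rfloor>}). f p * g q)"
      unfolding A2 by (subst sum.reindex) (auto simp: inj_on_def intro!: sum.cong)
    also have "\<dots> = (\<Sum>q=2..N. \<Sum>p=2..nat \<lfloor>x / real q\<rfloor>. f p * g q)"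
      by (subst sum.Sigma) auto
    finally show ?thesis by (simp add: psum_def sum_distrib_left mult.commute)
  qed
  moreover have "sum ?h (?A1 \<inter> ?A2) = psum f (sqrt x) * psum g (sqrt x)"
    unfolding int psum_def N_def[symmetric] sum_product by (simp add: sum.cartesian_product)
  ultimately show ?thesis unfolding N_def[symmetric] by linarith
qed

lemma ln_le_twice_ln_floor:
  assumes "y \<ge> 2"
  shows "ln y \<le> 2 * ln (real (nat \<lfloor>y\<rfloor>))" "nat \<lfloor>y\<rfloor> \<ge> 2" "real (nat \<lfloor>y\<rfloor>) \<le> y"
proof -
  define N where "N = nat \<lfloor>y\<rfloor>"
  show N2: "nat \<lfloor>y\<rfloor> \<ge> 2" using assms le_nat_floor[of 2 y] by simp
  show "real (nat \<lfloor>y\<rfloor>) \<le> y" using assms by simp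
  have "y < real N + 1" unfolding N_def using assms by linarith
  also have "\<dots> \<le> real N * real N"
  proof -
    have "real N \<ge> 2" using N2 by (simp add: N_def)
    moreover from this have "2 * real N \<le> real N * real N" by (intro mult_right_mono) auto
    ultimately show ?thesis by linarith
  qed
  finally have "ln y \<le> ln (real N * real N)" using assms by simp
  also have "\<dots> = 2 * ln (real N)" using N2 by (simp add: N_def[symmetric] ln_mult)
  finally show "ln y \<le> 2 * ln (real (nat \<lfloor>y\<rfloor>))" by (simp add: N_def)
qed

lemma psum_bound:
  assumes g: "log_saving g a" and a: "0 \<le> a" "a \<le> 2"
  obtains K where "K \<ge> 0" "\<And>y. y \<ge> 2 \<Longrightarrow> \<bar>psum g y\<bar> \<le> K * (y / ln y powr a)"
proof -
  obtain K where K: "K \<ge> 0" "\<And>N. N \<ge> 2 \<Longrightarrow> \<bar>\<Sum>n=2..N. g n\<bar> \<le> K * (real N / ln (real N) powr a)"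
    using log_savingE[OF g] by blast
  show ?thesis
  proof (rule that[of "4 * K"])
    fix y :: real assume y: "y \<ge> 2"
    define N where "N = nat \<lfloor>y\<rfloor>"
    have lny: "ln y > 0" using y by simp
    have N: "ln y \<le> 2 * ln (real N)" "N \<ge> 2" "real N \<le> y"
      using ln_le_twice_ln_floor[OF y] by (auto simp: N_def)
    have "\<bar>psum g y\<bar> \<le> K * (real N / ln (real N) powr a)"
      unfolding psum_def N_def[symmetric] by (rule K(2)[OF N(2)])
    also have "\<dots> \<le> K * (y / (ln y / 2) powr a)"
      using N K lny a by (intro mult_left_mono frac_le powr_mono2) auto
    also have "(ln y / 2) powr a = ln y powr a / 2 powr a" using lny by (simp add: powr_divide)
    also have "K * (y / (ln y powr a / 2 powr a)) = K * (y / ln y powr a) * 2 powr a" by simp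
    also have "\<dots> \<le> K * (y / ln y powr a) * 4"
    proof (rule mult_left_mono)
      have "2 powr a \<le> 2 powr 2" using a by (intro powr_mono) auto
      then show "2 powr a \<le> 4" by simp
    qed (use K y in auto)
    finally show "\<bar>psum g y\<bar> \<le> 4 * K * (y / ln y powr a)" by (simp add: mult_ac)
  qed (use K in auto)
qed

text \<open>Lets bounded errors be absorbed into the error term. The 17 exceeds the 16 of
  \<open>ln_square_le_sqrt\<close>.\<close>

lemma ln_powr_le_linear:
  fixes y a :: real
  assumes "y \<ge> 2" "0 \<le> a" "a \<le> 2"
  shows "1 \<le> 17 * (y / ln y powr a)"
proof -
  have l: "ln y > 0" using assms by simp
  have "ln y powr a \<le> 17 * y"
  proof (cases "ln y \<le> 1")
    case True
    then have "ln y powr a \<le> 1" using l assms by (intro powr_le1) auto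
    then show ?thesis using assms by linarith
  next
    case False
    then have "ln y powr a \<le> ln y powr 2" using assms by (intro powr_mono) auto
    also have "\<dots> = ln y ^ 2" using l by simp
    also have "\<dots> \<le> 16 * sqrt y" using assms by (intro ln_square_le_sqrt) auto
    also have "sqrt y \<le> y" using assms by (intro real_le_lsqrt) (auto simp: power2_eq_square)
    finally show ?thesis using assms by simp
  qed
  then show ?thesis using l assms by (simp add: divide_simps)
qed

text \<open>The value at 1 is \<open>1 / ln 1 = 1 / 0 = 0\<close>, so no boundary term remains.\<close>

lemma sum_div_ln_telescope:
  "(\<Sum>n=2..N. real n / ln (real n) - real (n - 1) / ln (real (n - 1))) = real N / ln (real N)"
proof (induction N)
  case (Suc N)
  show ?case
  proof (cases "N \<ge> 1")
    case True
    then have "{2..Suc N} = insert (Suc N) {2..N}" by auto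
    then show ?thesis using Suc by simp
  qed simp
qed simp

text \<open>The sum of 1 / ln n differs from N / ln N by O(N / (ln N)^2). As 1 + \<epsilon> \<le> 2
  this is admissible, and the elementary y / ln y can serve as main term instead of the logarithmic
  integral.\<close>

lemma log_saving_inverse_ln:
  "log_saving (\<lambda>n. 1 / ln (real n) - (real n / ln (real n) - real (n - 1) / ln (real (n - 1)))) 2"
proof -
  let ?v = "\<lambda>n::nat. real n / ln (real n)"
  have tel: "(\<Sum>n=2..N. ?v n - ?v (n - 1)) = ?v N" for N
    by (rule sum_div_ln_telescope)
  have main: "(\<lambda>N. (real N - 1) * (1 / ln (real (Suc N))) - ?v N) \<in> O(\<lambda>N. real N / ln (real N) powr 2)"
    by real_asymp
  have rest: "(\<lambda>N. \<Sum>n=2..N. (real n - 1) * (1 / ln (real n) - 1 / ln (real (Suc n)))) \<in> O(\<lambda>N. real N / ln (real N) powr 2)"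
  proof (rule bigoI)
    show "eventually (\<lambda>N. norm (\<Sum>n=2..N. (real n - 1) * (1 / ln (real n) - 1 / ln (real (Suc n)))) \<le>
       68 * norm (real N / ln (real N) powr 2)) sequentially"
      using eventually_ge_at_top[of 2]
    proof eventually_elim
      case (elim N)
      have "norm (\<Sum>n=2..N. (real n - 1) * (1 / ln (real n) - 1 / ln (real (Suc n)))) \<le> (\<Sum>n=2..N. 1 / ln (real n) ^ 2)"
      proof (rule sum_norm_le)
        fix n assume n: "n \<in> {2..N}"
        have "norm ((real n - 1) * (1 / ln (real n) - 1 / ln (real (Suc n)))) \<le> real n * (1 / (real n * ln (real n) ^ 2))"
          unfolding norm_mult using n inverse_ln_diff[of n] by (intro mult_mono) auto
        then show "norm ((real n - 1) * (1 / ln (real n) - 1 / ln (real (Suc n)))) \<le> 1 / ln (real n) ^ 2"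
          using n by simp
      qed
      also have "\<dots> \<le> 68 * (real N / ln (real N) ^ 2)" by (rule sum_inverse_ln_square_le[OF elim])
      finally show ?case using elim by simp
    qed
  qed
  have "eventually (\<lambda>N. (real N - 1) * (1 / ln (real (Suc N))) - ?v N +
      (\<Sum>n=2..N. (real n - 1) * (1 / ln (real n) - 1 / ln (real (Suc n)))) =
      (\<Sum>n=2..N. 1 / ln (real n) - (?v n - ?v (n - 1)))) sequentially"
    using eventually_ge_at_top[of 2]
  proof eventually_elim
    case (elim N)
    have cnt: "(\<Sum>n=2..M. 1) = real M - 1" if "M \<ge> 1" for M :: nat using that by (simp add: of_nat_diff)
    have "(\<Sum>n=2..N. 1 * (1 / ln (real n))) = (\<Sum>n=2..N. 1) * (1 / ln (real (Suc N))) +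
      (\<Sum>n=2..N. (\<Sum>i=2..n. 1) * (1 / ln (real n) - 1 / ln (real (Suc n))))"
      by (rule abel_sum_from_2)
    also have "(\<Sum>n=2..N. (\<Sum>i=2..n. 1) * (1 / ln (real n) - 1 / ln (real (Suc n)))) =
        (\<Sum>n=2..N. (real n - 1) * (1 / ln (real n) - 1 / ln (real (Suc n))))"
      by (intro sum.cong refl) (auto simp: of_nat_diff)
    finally have "(\<Sum>n=2..N. 1 / ln (real n)) = (real N - 1) * (1 / ln (real (Suc N))) +
      (\<Sum>n=2..N. (real n - 1) * (1 / ln (real n) - 1 / ln (real (Suc n))))"
      using elim cnt[of N] by simp
    then show ?case unfolding sum_subtractf[of "\<lambda>n. 1 / ln (real n)"] tel by simp
  qed
  from landau_o.big.in_cong[OF this] show ?thesis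
    unfolding log_saving_def using sum_in_bigo(1)[OF main rest] by blast
qed

text \<open>On y \<ge> 2 the derivative of y / ln y is at most 2 + 4 in size because ln y \<ge> 1/2,
  and the floor moves y by at most 1.\<close>

lemma div_ln_floor_diff:
  assumes y: "y \<ge> 2"
  shows "\<bar>real (nat \<lfloor>y\<rfloor>) / ln (real (nat \<lfloor>y\<rfloor>)) - y / ln y\<bar> \<le> 6"
proof -
  define N where "N = real (nat \<lfloor>y\<rfloor>)"
  have N: "2 \<le> N" "N \<le> y" "y - N \<le> 1"
    using ln_le_twice_ln_floor(2,3)[OF y] y unfolding N_def by (auto, linarith)
  have "norm (y / ln y - N / ln N) \<le> 6 * norm (y - N)"
  proof (rule field_differentiable_bound[where S = "{2..}"])
    fix z :: real assume z: "z \<in> {2..}"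
    have "ln 2 \<le> ln z" using z by simp
    then have l: "ln z \<ge> 1 / 2" using ln2_ge_two_thirds by linarith
    show "((\<lambda>z. z / ln z) has_field_derivative (1 / ln z - 1 / ln z ^ 2)) (at z within {2..})"
      using z l by (auto intro!: derivative_eq_intros simp: field_simps power2_eq_square)
    have "1 / ln z \<le> 1 / (1 / 2)" using l by (intro frac_le) auto
    then have "1 / ln z \<le> 2" by simp
    moreover have "1 / ln z ^ 2 \<le> 1 / (1 / 2) ^ 2" using l by (intro frac_le power_mono) auto
    then have "1 / ln z ^ 2 \<le> 4" by (simp add: power2_eq_square)
    moreover have "0 \<le> 1 / ln z" "0 \<le> 1 / ln z ^ 2" using l by auto
    ultimately show "norm (1 / ln z - 1 / ln z ^ 2) \<le> 6" unfolding real_norm_def by linarith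
  qed (use N y in auto)
  also have "\<dots> \<le> 6" using N by simp
  finally show ?thesis by (simp add: N_def abs_minus_commute)
qed

lemma sum_inverse_le_ln: "N \<ge> 1 \<Longrightarrow> (\<Sum>n=2..N. 1 / real n) \<le> ln (real N)"
proof (induction N rule: nat_induct_at_least)
  case (Suc N)
  have "ln (real N / real (Suc N)) \<le> real N / real (Suc N) - 1" using Suc.hyps by (intro ln_le_minus_one) auto
  also have "\<dots> = - (1 / real (Suc N))" by (simp add: field_simps)
  finally have "1 / real (Suc N) \<le> ln (real (Suc N)) - ln (real N)" using Suc.hyps by (simp add: ln_div)
  moreover have "{2..Suc N} = insert (Suc N) {2..N}" using Suc.hyps by auto
  ultimately show ?case using Suc.IH by simp
qed simp

lemma ln_ln_diff:
  assumes "n \<ge> 2"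
  shows "ln (ln (real (Suc n))) - ln (ln (real n)) \<le> 1 / (real n * ln (real n))"
    and "1 / (real (Suc n) * ln (real (Suc n))) \<le> ln (ln (real (Suc n))) - ln (ln (real n))"
proof -
  define x where "x = real n"
  have x: "x \<ge> 2" using assms by (simp add: x_def)
  have "\<exists>z>x. z < x + 1 \<and> ln (ln (x + 1)) - ln (ln x) = (x + 1 - x) * (1 / (z * ln z))"
  proof (rule MVT2)
    fix z assume "x \<le> z" "z \<le> x + 1"
    then have "z > 1" using x by simp
    then show "((\<lambda>x. ln (ln x)) has_real_derivative 1 / (z * ln z)) (at z)"
      by (auto intro!: derivative_eq_intros simp: field_simps)
  qed simp
  then obtain z where z: "z > x" "z < x + 1" "ln (ln (x + 1)) - ln (ln x) = 1 / (z * ln z)" by auto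
  have "x * ln x \<le> z * ln z" "z * ln z \<le> (x + 1) * ln (x + 1)" using x z by (auto intro!: mult_mono)
  moreover have "x * ln x > 0" "z * ln z > 0" using x z by auto
  ultimately have "1 / (z * ln z) \<le> 1 / (x * ln x)" "1 / ((x + 1) * ln (x + 1)) \<le> 1 / (z * ln z)"
    by (auto intro!: frac_le)
  then show "ln (ln (real (Suc n))) - ln (ln (real n)) \<le> 1 / (real n * ln (real n))"
    and "1 / (real (Suc n) * ln (real (Suc n))) \<le> ln (ln (real (Suc n))) - ln (ln (real n))"
    using z(3) by (simp_all add: x_def add_ac)
qed

lemma sum_inverse_n_ln_bounds:
  assumes "N \<ge> 2"
  shows "ln (ln (real (Suc N))) - ln (ln 2) \<le> (\<Sum>n=2..N. 1 / (real n * ln (real n)))"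
    and "(\<Sum>n=2..N. 1 / (real n * ln (real n))) \<le> 1 / (2 * ln 2) + ln (ln (real N)) - ln (ln 2)"
proof -
  have "ln (ln (real (Suc N))) - ln (ln 2) \<le> (\<Sum>n=2..N. 1 / (real n * ln (real n))) \<and>
    (\<Sum>n=2..N. 1 / (real n * ln (real n))) \<le> 1 / (2 * ln 2) + ln (ln (real N)) - ln (ln 2)"
    using assms
  proof (induction N rule: nat_induct_at_least)
    case base
    show ?case using ln_ln_diff(1)[of 2] by simp
  next
    case (Suc N)
    have "{2..Suc N} = insert (Suc N) {2..N}" using Suc.hyps by auto
    then show ?case using Suc ln_ln_diff(1)[of "Suc N"] ln_ln_diff(2)[of N] by simp
  qed
  then show "ln (ln (real (Suc N))) - ln (ln 2) \<le> (\<Sum>n=2..N. 1 / (real n * ln (real n)))"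
    and "(\<Sum>n=2..N. 1 / (real n * ln (real n))) \<le> 1 / (2 * ln 2) + ln (ln (real N)) - ln (ln 2)" by auto
qed

lemma psum_inverse_n_ln:
  obtains C where "\<And>y. y \<ge> 2 \<Longrightarrow> \<bar>psum (\<lambda>n. 1 / (real n * ln (real n))) y - ln (ln y)\<bar> \<le> C"
proof (rule that[of "1 / (2 * ln 2) + \<bar>ln (ln 2)\<bar>"])
  fix y :: real assume y: "y \<ge> 2"
  define N where "N = nat \<lfloor>y\<rfloor>"
  have N: "N \<ge> 2" "real N \<le> y" using ln_le_twice_ln_floor[OF y] by (auto simp: N_def)
  have "y \<le> real (Suc N)" unfolding N_def using y by linarith
  then have "ln (ln y) \<le> ln (ln (real (Suc N)))" using y by simp
  moreover have "ln (ln (real N)) \<le> ln (ln y)" using y N by simp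
  moreover have "1 / (2 * ln 2) > (0::real)" by simp
  ultimately show "\<bar>psum (\<lambda>n. 1 / (real n * ln (real n))) y - ln (ln y)\<bar> \<le> 1 / (2 * ln 2) + \<bar>ln (ln 2)\<bar>"
    using sum_inverse_n_ln_bounds[OF N(1)] unfolding psum_def N_def[symmetric] by linarith
qed

lemma abs_sum_mult_incseq_le:
  fixes a b :: "nat \<Rightarrow> real"
  assumes D: "\<And>k. \<bar>\<Sum>i<k. a i\<bar> \<le> D" and b: "\<And>i. b i \<le> b (Suc i)" "\<And>i. 0 \<le> b i" "b k \<le> 1"
  shows "\<bar>\<Sum>i<k. a i * b i\<bar> \<le> 2 * D"
proof -
  let ?C = "\<lambda>k. \<Sum>i<k. a i"
  have D0: "D \<ge> 0" using D[of 0] by simp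
  have "(\<Sum>i<k. a i * b i) = ?C k * b k + (\<Sum>i<k. ?C (Suc i) * (b i - b (Suc i)))"
    by (induction k) (simp_all add: algebra_simps)
  also have "\<bar>\<dots>\<bar> \<le> \<bar>?C k * b k\<bar> + (\<Sum>i<k. \<bar>?C (Suc i) * (b i - b (Suc i))\<bar>)"
    by (intro order_trans[OF abs_triangle_ineq] add_mono sum_abs order_refl)
  also have "\<dots> \<le> D * b k + (\<Sum>i<k. D * (b (Suc i) - b i))"
    unfolding abs_mult using b D0 by (intro add_mono sum_mono mult_mono D) (auto simp: abs_if)
  also have "(\<Sum>i<k. D * (b (Suc i) - b i)) = D * (b k - b 0)"
    by (simp only: sum_distrib_left[symmetric] sum_lessThan_telescope)
  also have "D * b k + D * (b k - b 0) \<le> D * 1 + D * 1"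
  proof -
    have "b k - b 0 \<le> 1" using b(2)[of 0] b(3) by linarith
    then show ?thesis using b(3) D0 by (intro add_mono mult_left_mono) auto
  qed
  finally show ?thesis by simp
qed

text \<open>The quotient is the excess in ln x / ln (x/n) = 1 + ln n / (ln x - ln n). The cut at
  sqrt x is what bounds it by 1.\<close>

lemma log_weight_bounds:
  assumes x: "x \<ge> 4" and n: "1 \<le> n" "n \<le> m" "m \<le> sqrt x"
  shows "ln x - ln m \<ge> ln x / 2" "0 \<le> ln n / (ln x - ln n)" "ln n / (ln x - ln n) \<le> ln m / (ln x - ln m)"
    "ln m / (ln x - ln m) \<le> 1" "ln x > 0"
proof -
  show lx: "ln x > 0" using x by simp
  have "ln m \<le> ln (sqrt x)" using n x by simp
  then have m: "ln m \<le> ln x / 2" using x by (simp add: ln_sqrt)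
  then show lm: "ln x - ln m \<ge> ln x / 2" by simp
  have nm: "0 \<le> ln n" "ln n \<le> ln m" using n by auto
  show "0 \<le> ln n / (ln x - ln n)" using nm m lx by (intro divide_nonneg_nonneg) auto
  show "ln n / (ln x - ln n) \<le> ln m / (ln x - ln m)" using nm m lx by (intro frac_le) auto
  show "ln m / (ln x - ln m) \<le> 1" using m lx by (simp add: divide_le_eq)
qed

lemma filterlim_nat_floor_sqrt: "filterlim (\<lambda>x. nat \<lfloor>sqrt x\<rfloor>) at_top at_top"
  by (intro filterlim_compose[OF filterlim_nat_sequentially]
      filterlim_compose[OF filterlim_floor_sequentially] sqrt_at_top)

text \<open>A Toeplitz-type statement: each weight tends to 0, and the weights are increasing in \<open>n\<close>
  and bounded by 1, so only the tail of the convergent series could contribute.\<close>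

theorem toeplitz_log_weights:
  assumes r: "summable r"
  shows "((\<lambda>x. \<Sum>n=2..nat \<lfloor>sqrt x\<rfloor>. r n * (ln (real n) / (ln x - ln (real n)))) \<longlongrightarrow> (0::real)) at_top"
proof (rule tendstoI)
  fix e :: real assume e: "e > 0"
  obtain M0 where M0: "\<And>m n. m \<ge> M0 \<Longrightarrow> norm (\<Sum>k=m..n. r k) < e / 8"
    using summable_partial_sum_bound[OF r, of "e / 8"] e by auto
  define M where "M = max M0 2"
  have M: "M \<ge> 2" "M \<ge> M0" by (auto simp: M_def)
  let ?V = "\<lambda>x n. ln (real n) / (ln x - ln (real n))"
  have "((\<lambda>x. \<Sum>n=2..<M. r n * ?V x n) \<longlongrightarrow> (\<Sum>n=2..<M. r n * 0)) at_top"
  proof (intro tendsto_intros)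
    show "((\<lambda>x. ?V x n) \<longlongrightarrow> 0) at_top" for n :: nat by real_asymp
  qed
  then have "eventually (\<lambda>x. norm (\<Sum>n=2..<M. r n * ?V x n) < e / 2) at_top"
    using e by (auto dest!: tendstoD[where e = "e / 2"] simp: dist_norm)
  moreover have "eventually (\<lambda>x. nat \<lfloor>sqrt x\<rfloor> \<ge> M) at_top"
    using filterlim_nat_floor_sqrt unfolding filterlim_at_top by blast
  ultimately show "eventually (\<lambda>x. dist (\<Sum>n=2..nat \<lfloor>sqrt x\<rfloor>. r n * ?V x n) 0 < e) at_top"
    using eventually_ge_at_top[of 4]
  proof eventually_elim
    case (elim x)
    define N where "N = nat \<lfloor>sqrt x\<rfloor>"
    have N: "N \<ge> M" "real N \<le> sqrt x" using elim by (auto simp: N_def)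
    have Nx: "real n \<le> sqrt x" if "n \<le> N" for n using that N(2) by linarith
    \<comment> \<open>The index is frozen at N so that the weights are increasing and nonnegative
      for all i, as Abel's inequality demands. The tail then contributes at most 2 e/8 and the head
      less than e/2.\<close>
    define b where "b i = ?V x (min (M + i) N)" for i
    have "\<bar>\<Sum>i<Suc (N - M). r (M + i) * b i\<bar> \<le> 2 * (e / 8)"
    proof (rule abs_sum_mult_incseq_le)
      show "\<bar>\<Sum>i<k. r (M + i)\<bar> \<le> e / 8" for k
      proof (cases k)
        case (Suc j)
        have "(\<Sum>i<Suc j. r (M + i)) = (\<Sum>n=M..M + j. r n)"
          by (rule sum.reindex_bij_witness[of _ "\<lambda>n. n - M" "\<lambda>i. M + i"]) auto
        then show ?thesis using M0[OF M(2), of "M + j"] Suc by simp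
      qed (use e in simp)
      fix i
      have *: "1 \<le> real (min (M + i) N)" "real (min (M + i) N) \<le> real (min (M + Suc i) N)"
        "real (min (M + Suc i) N) \<le> sqrt x"
        using M N Nx by auto
      show "b i \<le> b (Suc i)" "0 \<le> b i"
        unfolding b_def using log_weight_bounds(2,3)[OF elim(3) *] by auto
      have "1 \<le> real (min (M + Suc (N - M)) N)" "real (min (M + Suc (N - M)) N) \<le> sqrt x" using M N by auto
      then show "b (Suc (N - M)) \<le> 1"
        unfolding b_def by (intro log_weight_bounds(4)[OF elim(3) _ order_refl]) auto
    qed
    moreover have "(\<Sum>i<Suc (N - M). r (M + i) * b i) = (\<Sum>n=M..N. r n * ?V x n)"
      using N(1) by (intro sum.reindex_bij_witness[of _ "\<lambda>n. n - M" "\<lambda>i. M + i"]) (auto simp: b_def min_def)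
    moreover have "(\<Sum>n=2..N. r n * ?V x n) = (\<Sum>n=2..<M. r n * ?V x n) + (\<Sum>n=M..N. r n * ?V x n)"
    proof -
      have "{2..N} = {2..<M} \<union> {M..N}" using M N by auto
      then show ?thesis by (simp only:) (rule sum.union_disjoint, auto)
    qed
    ultimately show ?case using elim(1) e unfolding N_def[symmetric] by (simp add: dist_norm)
  qed
qed

lemma summable_partial_sums_bounded:
  fixes r :: "nat \<Rightarrow> real"
  assumes "summable r"
  obtains B where "\<And>N. \<bar>\<Sum>n=2..N. r n\<bar> \<le> B"
proof -
  obtain M0 where M0: "\<And>m n. m \<ge> M0 \<Longrightarrow> norm (\<Sum>k=m..n. r k) < 1"
    using summable_partial_sum_bound[OF assms, of 1] by auto
  show ?thesis
  proof (rule that[of "(\<Sum>n=2..<M0 + 2. \<bar>r n\<bar>) + 1"])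
    fix N
    show "\<bar>\<Sum>n=2..N. r n\<bar> \<le> (\<Sum>n=2..<M0 + 2. \<bar>r n\<bar>) + 1"
    proof (cases "N \<ge> M0 + 2")
      case True
      have "{2..N} = {2..<M0 + 2} \<union> {M0 + 2..N}" using True by auto
      then have "(\<Sum>n=2..N. r n) = (\<Sum>n=2..<M0 + 2. r n) + (\<Sum>n=M0 + 2..N. r n)"
        by (simp only:) (rule sum.union_disjoint, auto)
      moreover have "\<bar>\<Sum>n=2..<M0 + 2. r n\<bar> \<le> (\<Sum>n=2..<M0 + 2. \<bar>r n\<bar>)" by (rule sum_abs)
      ultimately show ?thesis using M0[of "M0 + 2" N] by simp
    next
      case False
      have "\<bar>\<Sum>n=2..N. r n\<bar> \<le> (\<Sum>n=2..N. \<bar>r n\<bar>)" by (rule sum_abs)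
      also have "\<dots> \<le> (\<Sum>n=2..<M0 + 2. \<bar>r n\<bar>)" using False by (intro sum_mono2) auto
      finally show ?thesis by simp
    qed
  qed
qed

lemma psum_tendsto:
  fixes r :: "nat \<Rightarrow> real"
  assumes "summable r" "r 0 = 0" "r 1 = 0"
  shows "((\<lambda>x. psum r (sqrt x)) \<longlongrightarrow> suminf r) at_top"
proof -
  have "(\<lambda>N. \<Sum>n<Suc N. r n) \<longlonglongrightarrow> suminf r"
    by (intro LIMSEQ_Suc summable_LIMSEQ assms)
  moreover have "(\<Sum>n<Suc N. r n) = (\<Sum>n=2..N. r n)" for N
  proof (rule sum.mono_neutral_right)
    show "\<forall>i\<in>{..<Suc N} - {2..N}. r i = 0"
    proof
      fix i assume "i \<in> {..<Suc N} - {2..N}"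
      then have "i = 0 \<or> i = 1" by auto
      then show "r i = 0" using assms by auto
    qed
  qed auto
  ultimately have "(\<lambda>N. \<Sum>n=2..N. r n) \<longlonglongrightarrow> suminf r" by simp
  from filterlim_compose[OF this filterlim_nat_floor_sqrt] show ?thesis by (simp add: psum_def)
qed

section \<open>The three pair sums over primes\<close>

abbreviation prime_ind :: "nat \<Rightarrow> real" where
  "prime_ind n \<equiv> (if prime n then 1 else 0)"

text \<open>In the application \<rho> is the character on primes and \<kappa> the indicator of
  primes coprime to the modulus d. Only the savings enter from the analytic part.\<close>

locale prime_asymptotics =
  fixes \<rho> \<kappa> :: "nat \<Rightarrow> real" and \<epsilon> :: real and d :: nat
  assumes \<epsilon>: "0 < \<epsilon>" "\<epsilon> \<le> 1"
    and \<rho>: "\<And>n. \<bar>\<rho> n\<bar> \<le> prime_ind n"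
    and \<kappa>: "\<And>n. 0 \<le> \<kappa> n" "\<And>n. \<kappa> n \<le> prime_ind n" "\<And>n. n > d \<Longrightarrow> \<kappa> n = prime_ind n"
    and saving_prime: "log_saving (\<lambda>n. prime_ind n - 1 / ln (real n)) (1 + \<epsilon>)"
    and saving_\<rho>: "log_saving \<rho> (1 + \<epsilon>)"
begin

lemma \<kappa>_abs: "\<bar>\<kappa> n\<bar> \<le> prime_ind n"
  using \<kappa>(1,2)[of n] by simp

lemma summable_\<rho>: "summable (\<lambda>n. \<rho> n / real n)"
  by (rule log_saving_summable[OF saving_\<rho> \<epsilon>(1)])

lemma psum_\<rho>_bound:
  obtains K where "K \<ge> 0" "\<And>y. y \<ge> 2 \<Longrightarrow> \<bar>psum \<rho> y\<bar> \<le> K * (y / ln y powr (1 + \<epsilon>))"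
  using psum_bound[OF saving_\<rho>] \<epsilon> by auto

text \<open>Three replacements are made: primes by 1 / ln n, that by the telescoping N / ln N, and N
  = floor y by y at cost 6. Discrepancies between \<kappa> and the primes occur only up to d,
  costing at most d.\<close>

lemma psum_\<kappa>_bound:
  obtains K where "K \<ge> 0" "\<And>y. y \<ge> 2 \<Longrightarrow> \<bar>psum \<kappa> y - y / ln y\<bar> \<le> K * (y / ln y powr (1 + \<epsilon>))"
proof -
  let ?v = "\<lambda>n::nat. real n / ln (real n)"
  have tel: "(\<Sum>n=2..N. ?v n - ?v (n - 1)) = ?v N" for N
    by (rule sum_div_ln_telescope)
  have "log_saving (\<lambda>n. (prime_ind n - 1 / ln (real n)) + (1 / ln (real n) - (?v n - ?v (n - 1)))) (1 + \<epsilon>)"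
    using \<epsilon> by (intro log_saving_add saving_prime log_saving_mono[OF log_saving_inverse_ln]) auto
  then have sav: "log_saving (\<lambda>n. prime_ind n - (?v n - ?v (n - 1))) (1 + \<epsilon>)"
    by (rule log_saving_cong) simp
  obtain K where K: "K \<ge> 0"
    "\<And>y. y \<ge> 2 \<Longrightarrow> \<bar>psum (\<lambda>n. prime_ind n - (?v n - ?v (n - 1))) y\<bar> \<le> K * (y / ln y powr (1 + \<epsilon>))"
    using psum_bound[OF sav] \<epsilon> by auto
  show ?thesis
  proof (rule that[of "K + (6 + real d) * 17"])
    show "K + (6 + real d) * 17 \<ge> 0" using K by simp
    fix y :: real assume y: "y \<ge> 2"
    have 1: "psum (\<lambda>n. prime_ind n - (?v n - ?v (n - 1))) y = psum prime_ind y - ?v (nat \<lfloor>y\<rfloor>)"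
      unfolding psum_def sum_subtractf[of prime_ind] tel ..
    have 2: "\<bar>?v (nat \<lfloor>y\<rfloor>) - y / ln y\<bar> \<le> 6" by (rule div_ln_floor_diff[OF y])
    have 3: "\<bar>psum \<kappa> y - psum prime_ind y\<bar> \<le> real d"
    proof -
      have "\<bar>psum \<kappa> y - psum prime_ind y\<bar> = \<bar>\<Sum>n=2..nat \<lfloor>y\<rfloor>. \<kappa> n - prime_ind n\<bar>"
        by (simp add: psum_def sum_subtractf)
      also have "\<dots> \<le> (\<Sum>n=2..nat \<lfloor>y\<rfloor>. if n \<le> d then 1 else 0)"
      proof (rule order_trans[OF sum_abs sum_mono])
        fix n
        show "\<bar>\<kappa> n - prime_ind n\<bar> \<le> (if n \<le> d then 1 else 0)"
          using \<kappa>(1,2)[of n] \<kappa>(3)[of n] by (auto split: if_splits)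
      qed
      also have "\<dots> = real (card {n\<in>{2..nat \<lfloor>y\<rfloor>}. n \<le> d})"
        by (simp add: sum.inter_filter[symmetric])
      also have "\<dots> \<le> real (card {1..d})"
        by (intro of_nat_mono card_mono) auto
      finally show ?thesis by simp
    qed
    have "\<bar>psum \<kappa> y - y / ln y\<bar> \<le> K * (y / ln y powr (1 + \<epsilon>)) + (6 + real d)"
      using K(2)[OF y] 1 2 3 by linarith
    also have "6 + real d \<le> (6 + real d) * (17 * (y / ln y powr (1 + \<epsilon>)))"
    proof -
      have "(6 + real d) * 1 \<le> (6 + real d) * (17 * (y / ln y powr (1 + \<epsilon>)))"
        using \<epsilon> by (intro mult_left_mono ln_powr_le_linear y) auto
      then show ?thesis by simp
    qed
    finally show "\<bar>psum \<kappa> y - y / ln y\<bar> \<le> (K + (6 + real d) * 17) * (y / ln y powr (1 + \<epsilon>))"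
      by (simp only: distrib_right mult.assoc)
  qed
qed

text \<open>Mertens' estimate: the difference from the sum of 1 / (n ln n) is a convergent series,
  and that sum is ln ln y + O(1).\<close>

lemma prime_reciprocals:
  obtains C where "C \<ge> 0" "\<And>y. y \<ge> 2 \<Longrightarrow> \<bar>psum (\<lambda>n. prime_ind n / real n) y - ln (ln y)\<bar> \<le> C"
proof -
  have sum: "summable (\<lambda>n. (prime_ind n - 1 / ln (real n)) / real n)"
    by (rule log_saving_summable[OF saving_prime \<epsilon>(1)])
  obtain B where B: "\<And>N. \<bar>\<Sum>n=2..N. (prime_ind n - 1 / ln (real n)) / real n\<bar> \<le> B"
    using summable_partial_sums_bounded[OF sum] by blast
  obtain C where C: "\<And>y. y \<ge> 2 \<Longrightarrow> \<bar>psum (\<lambda>n. 1 / (real n * ln (real n))) y - ln (ln y)\<bar> \<le> C"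
    using psum_inverse_n_ln by blast
  have main: "\<bar>psum (\<lambda>n. prime_ind n / real n) y - ln (ln y)\<bar> \<le> B + C" if y: "y \<ge> 2" for y
  proof -
    have "psum (\<lambda>n. prime_ind n / real n) y = psum (\<lambda>n. (prime_ind n - 1 / ln (real n)) / real n) y +
        psum (\<lambda>n. 1 / (real n * ln (real n))) y"
      unfolding psum_def sum.distrib[symmetric] by (intro sum.cong) (auto simp: diff_divide_distrib mult.commute)
    then show ?thesis using B[of "nat \<lfloor>y\<rfloor>"] C[OF y] unfolding psum_def by linarith
  qed
  show ?thesis
    by (rule that[OF _ main]) (use main[of 2] abs_ge_zero order_trans in blast)+
qed

lemma prime_reciprocals_sqrt:
  obtains C where "C \<ge> 0" "\<And>x. x \<ge> 4 \<Longrightarrow> \<bar>psum (\<lambda>n. prime_ind n / real n) (sqrt x) - ln (ln x)\<bar> \<le> C"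
proof -
  obtain C where C: "C \<ge> 0" "\<And>y. y \<ge> 2 \<Longrightarrow> \<bar>psum (\<lambda>n. prime_ind n / real n) y - ln (ln y)\<bar> \<le> C"
    using prime_reciprocals by blast
  show ?thesis
  proof (rule that[of "C + ln 2"])
    fix x :: real assume x: "x \<ge> 4"
    have "sqrt x \<ge> sqrt 4" using x by (intro real_sqrt_le_mono)
    then have s: "sqrt x \<ge> 2" by simp
    have "ln (ln (sqrt x)) = ln (ln x) - ln 2" using x by (simp add: ln_sqrt ln_div)
    then show "\<bar>psum (\<lambda>n. prime_ind n / real n) (sqrt x) - ln (ln x)\<bar> \<le> C + ln 2"
      using C(2)[OF s] ln_gt_zero[of "2::real"] by linarith
  qed (use C in auto)
qed

text \<open>For n \<le> sqrt x the logarithm of x/n is at least half of ln x, so each error is O(x /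
  (n (ln x)^(1+\<epsilon>))). Summing over primes costs ln ln x, which (ln x)^\<epsilon>
  outweighs.\<close>

lemma error_sum_tendsto_0:
  assumes h: "\<And>y. y \<ge> 2 \<Longrightarrow> \<bar>h y\<bar> \<le> K * (y / ln y powr (1 + \<epsilon>))" and K: "K \<ge> 0"
    and g: "\<And>n. \<bar>g n\<bar> \<le> prime_ind n"
  shows "((\<lambda>x. (\<Sum>n=2..nat \<lfloor>sqrt x\<rfloor>. g n * h (x / real n)) * ln x / x) \<longlongrightarrow> 0) at_top"
proof -
  obtain C where C: "C \<ge> 0" "\<And>x. x \<ge> 4 \<Longrightarrow> \<bar>psum (\<lambda>n. prime_ind n / real n) (sqrt x) - ln (ln x)\<bar> \<le> C"
    using prime_reciprocals_sqrt by blast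
  show ?thesis
  proof (rule Lim_null_comparison)
    show "((\<lambda>x. 4 * K * ((ln (ln x) + C) / ln x powr \<epsilon>)) \<longlongrightarrow> 0) at_top"
      using \<epsilon> by real_asymp
    show "eventually (\<lambda>x. norm ((\<Sum>n=2..nat \<lfloor>sqrt x\<rfloor>. g n * h (x / real n)) * ln x / x) \<le>
        4 * K * ((ln (ln x) + C) / ln x powr \<epsilon>)) at_top"
      using eventually_ge_at_top[of 4]
    proof eventually_elim
      case (elim x)
      define a where "a = 1 + \<epsilon>"
      have lx: "ln x > 0" using elim by simp
      have "\<bar>\<Sum>n=2..nat \<lfloor>sqrt x\<rfloor>. g n * h (x / real n)\<bar> \<le> (\<Sum>n=2..nat \<lfloor>sqrt x\<rfloor>. 4 * K * (x / ln x powr a) * (prime_ind n / real n))"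
      proof (rule order_trans[OF sum_abs sum_mono])
        fix n assume n: "n \<in> {2..nat \<lfloor>sqrt x\<rfloor>}"
        have nx: "real n \<le> sqrt x" "n \<ge> 2" using n elim by (auto simp: le_nat_floor_iff)
        have "sqrt x \<ge> sqrt 4" using elim by (intro real_sqrt_le_mono)
        then have s: "sqrt x \<ge> 2" by simp
        have "real n * sqrt x \<le> sqrt x * sqrt x" using nx elim by (intro mult_right_mono) auto
        then have "sqrt x \<le> x / real n" using nx elim by (simp add: field_simps)
        then have y: "x / real n \<ge> 2" using s by linarith
        have l: "ln x / 2 \<le> ln (x / real n)"
          using log_weight_bounds(1)[OF elim _ order_refl nx(1)] nx elim by (simp add: ln_div)
        have "\<bar>h (x / real n)\<bar> \<le> K * ((x / real n) / ln (x / real n) powr a)" unfolding a_def by (rule h[OF y])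
        also have "\<dots> \<le> K * ((x / real n) / (ln x / 2) powr a)"
          using K l lx elim \<epsilon> nx by (intro mult_left_mono frac_le powr_mono2) (auto simp: a_def)
        also have "\<dots> = K * (x / ln x powr a) * (1 / real n) * 2 powr a"
          using lx by (simp add: powr_divide mult_ac)
        also have "\<dots> \<le> K * (x / ln x powr a) * (1 / real n) * 4"
        proof (rule mult_left_mono)
          have "2 powr a \<le> 2 powr 2" using \<epsilon> by (intro powr_mono) (auto simp: a_def)
          then show "2 powr a \<le> 4" by simp
        qed (use K elim in auto)
        finally have "\<bar>h (x / real n)\<bar> \<le> 4 * K * (x / ln x powr a) * (1 / real n)" by (simp add: mult_ac)
        then have "\<bar>g n * h (x / real n)\<bar> \<le> prime_ind n * (4 * K * (x / ln x powr a) * (1 / real n))"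
          unfolding abs_mult using g[of n] by (intro mult_mono) auto
        then show "\<bar>g n * h (x / real n)\<bar> \<le> 4 * K * (x / ln x powr a) * (prime_ind n / real n)"
          by (simp add: mult_ac)
      qed
      also have "\<dots> = 4 * K * (x / ln x powr a) * psum (\<lambda>n. prime_ind n / real n) (sqrt x)"
        by (simp add: psum_def sum_distrib_left)
      also have "\<dots> \<le> 4 * K * (x / ln x powr a) * (ln (ln x) + C)"
        using C(2)[OF elim] K elim by (intro mult_left_mono) auto
      finally have "\<bar>\<Sum>n=2..nat \<lfloor>sqrt x\<rfloor>. g n * h (x / real n)\<bar> * (ln x / x) \<le>
          4 * K * (x / ln x powr a) * (ln (ln x) + C) * (ln x / x)"
        using lx elim by (intro mult_right_mono) auto
      also have "\<dots> = 4 * K * ((ln (ln x) + C) / ln x powr \<epsilon>)"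
        using lx elim by (simp add: a_def powr_add)
      finally show ?case using lx elim by (simp add: abs_mult)
    qed
  qed
qed

text \<open>The trivial bound sqrt x for one factor is enough, because the other already carries the
  exponent 1 + \<epsilon>.\<close>

lemma corner_tendsto_0:
  assumes f: "\<And>y. y \<ge> 2 \<Longrightarrow> \<bar>psum f y\<bar> \<le> K * (y / ln y powr (1 + \<epsilon>))" and K: "K \<ge> 0"
    and g: "\<And>n. \<bar>g n\<bar> \<le> prime_ind n"
  shows "((\<lambda>x. psum f (sqrt x) * psum g (sqrt x) * ln x / x) \<longlongrightarrow> 0) at_top"
proof (rule Lim_null_comparison)
  show "((\<lambda>x. K / (ln x / 2) powr (1 + \<epsilon>) * ln x) \<longlongrightarrow> 0) at_top"
    using \<epsilon> by real_asymp
  show "eventually (\<lambda>x. norm (psum f (sqrt x) * psum g (sqrt x) * ln x / x) \<le> K / (ln x / 2) powr (1 + \<epsilon>) * ln x) at_top"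
    using eventually_ge_at_top[of 4]
  proof eventually_elim
    case (elim x)
    have "sqrt x \<ge> sqrt 4" using elim by (intro real_sqrt_le_mono)
    then have s: "sqrt x \<ge> 2" by simp
    have lx: "ln x > 0" using elim by simp
    have "\<bar>psum g (sqrt x)\<bar> \<le> (\<Sum>n=2..nat \<lfloor>sqrt x\<rfloor>. 1)"
      unfolding psum_def
    proof (rule order_trans[OF sum_abs sum_mono])
      show "\<bar>g n\<bar> \<le> 1" for n using g[of n] by (auto split: if_splits)
    qed
    also have "\<dots> \<le> real (nat \<lfloor>sqrt x\<rfloor>)" by simp
    also have "\<dots> \<le> sqrt x" using elim by simp
    finally have G: "\<bar>psum g (sqrt x)\<bar> \<le> sqrt x" .
    have "\<bar>psum f (sqrt x)\<bar> \<le> K * (sqrt x / (ln x / 2) powr (1 + \<epsilon>))"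
      using f[OF s] elim by (simp add: ln_sqrt)
    then have "\<bar>psum f (sqrt x)\<bar> * \<bar>psum g (sqrt x)\<bar> \<le> K * (sqrt x / (ln x / 2) powr (1 + \<epsilon>)) * sqrt x"
      using G K elim by (intro mult_mono) auto
    also have "\<dots> = K / (ln x / 2) powr (1 + \<epsilon>) * (sqrt x * sqrt x)" by simp
    also have "sqrt x * sqrt x = x" using elim by simp
    finally have "\<bar>psum f (sqrt x)\<bar> * \<bar>psum g (sqrt x)\<bar> * (ln x / x) \<le> K / (ln x / 2) powr (1 + \<epsilon>) * x * (ln x / x)"
      using lx elim by (intro mult_right_mono) auto
    then show ?case using lx elim by (simp add: abs_mult)
  qed
qed

lemma main_sum_eq:
  assumes x: "x \<ge> 4"
  shows "(\<Sum>n=2..nat \<lfloor>sqrt x\<rfloor>. g n * ((x / real n) / ln (x / real n))) * ln x / x =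
    psum (\<lambda>n. g n / real n) (sqrt x) +
    (\<Sum>n=2..nat \<lfloor>sqrt x\<rfloor>. g n / real n * (ln (real n) / (ln x - ln (real n))))"
proof -
  have "g n * ((x / real n) / ln (x / real n)) * ln x / x = g n / real n + g n / real n * (ln (real n) / (ln x - ln (real n)))"
    if n: "n \<in> {2..nat \<lfloor>sqrt x\<rfloor>}" for n
  proof -
    have nx: "real n \<le> sqrt x" "n \<ge> 2" using n x by (auto simp: le_nat_floor_iff)
    define u where "u = ln x - ln (real n)"
    have u: "u > 0" using log_weight_bounds(1,5)[OF x _ order_refl nx(1)] nx by (simp add: u_def)
    have "ln (x / real n) = u" using nx x by (simp add: ln_div u_def)
    then have "g n * ((x / real n) / ln (x / real n)) * ln x / x = g n / real n * (ln x / u)"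
      using x by simp
    also have "ln x / u = 1 + ln (real n) / u" using u by (simp add: u_def field_simps)
    finally show ?thesis by (simp add: u_def distrib_left)
  qed
  then show ?thesis
    unfolding psum_def sum.distrib[symmetric] sum_distrib_right sum_divide_distrib by (intro sum.cong refl) auto
qed

lemma half_sum_split:
  "(\<Sum>n=2..nat \<lfloor>sqrt x\<rfloor>. g n * psum \<kappa> (x / real n)) * ln x / x =
   (\<Sum>n=2..nat \<lfloor>sqrt x\<rfloor>. g n * ((x / real n) / ln (x / real n))) * ln x / x +
   (\<Sum>n=2..nat \<lfloor>sqrt x\<rfloor>. g n * (psum \<kappa> (x / real n) - (x / real n) / ln (x / real n))) * ln x / x"
  unfolding add_divide_distrib[symmetric] distrib_right[symmetric] sum.distrib[symmetric]
  by (simp add: algebra_simps)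

text \<open>Only the half of the hyperbola sum with \<rho> outside and the main term of \<kappa>
  inside survives. Its weight ln x / ln (x/n) splits into 1, which gives the series, and an excess
  removed by \<open>toeplitz_log_weights\<close>.\<close>

theorem pair_sum_\<rho>_\<kappa>:
  "((\<lambda>x. pair_sum \<rho> \<kappa> x * ln x / x) \<longlongrightarrow> (\<Sum>n. \<rho> n / real n)) at_top"
proof -
  obtain K where K: "K \<ge> 0" "\<And>y. y \<ge> 2 \<Longrightarrow> \<bar>psum \<rho> y\<bar> \<le> K * (y / ln y powr (1 + \<epsilon>))"
    using psum_\<rho>_bound by blast
  obtain K' where K': "K' \<ge> 0" "\<And>y. y \<ge> 2 \<Longrightarrow> \<bar>psum \<kappa> y - y / ln y\<bar> \<le> K' * (y / ln y powr (1 + \<epsilon>))"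
    using psum_\<kappa>_bound by blast
  have \<rho>01: "\<rho> 0 / real 0 = 0" "\<rho> 1 / real 1 = 0" using \<rho>[of 1] by auto
  let ?N = "\<lambda>x. nat \<lfloor>sqrt x\<rfloor>"
  have "((\<lambda>x. (psum (\<lambda>n. \<rho> n / real n) (sqrt x) +
      (\<Sum>n=2..?N x. \<rho> n / real n * (ln (real n) / (ln x - ln (real n))))) +
      (\<Sum>n=2..?N x. \<rho> n * (psum \<kappa> (x / real n) - (x / real n) / ln (x / real n))) * ln x / x +
      (\<Sum>n=2..?N x. \<kappa> n * psum \<rho> (x / real n)) * ln x / x -
      psum \<rho> (sqrt x) * psum \<kappa> (sqrt x) * ln x / x) \<longlongrightarrow> ((\<Sum>n. \<rho> n / real n) + 0) + 0 + 0 - 0) at_top"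
    by (intro tendsto_add tendsto_diff psum_tendsto summable_\<rho> \<rho>01 toeplitz_log_weights
        error_sum_tendsto_0[OF K'(2) K'(1) \<rho>] error_sum_tendsto_0[OF K(2) K(1) \<kappa>_abs]
        corner_tendsto_0[OF K(2) K(1) \<kappa>_abs])
  moreover have "eventually (\<lambda>x. (psum (\<lambda>n. \<rho> n / real n) (sqrt x) +
      (\<Sum>n=2..?N x. \<rho> n / real n * (ln (real n) / (ln x - ln (real n))))) +
      (\<Sum>n=2..?N x. \<rho> n * (psum \<kappa> (x / real n) - (x / real n) / ln (x / real n))) * ln x / x +
      (\<Sum>n=2..?N x. \<kappa> n * psum \<rho> (x / real n)) * ln x / x -
      psum \<rho> (sqrt x) * psum \<kappa> (sqrt x) * ln x / x = pair_sum \<rho> \<kappa> x * ln x / x) at_top"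
    using eventually_ge_at_top[of 4]
  proof eventually_elim
    case (elim x)
    then have "x \<ge> 0" by simp
    then show ?case
      unfolding hyperbola[OF \<open>x \<ge> 0\<close>] main_sum_eq[OF elim, symmetric] half_sum_split[symmetric]
      by (simp add: algebra_simps add_divide_distrib diff_divide_distrib)
  qed
  ultimately show ?thesis by (simp add: Lim_transform_eventually)
qed

text \<open>Here the inner sum has no main term, so both halves of the hyperbola formula are error
  sums.\<close>

theorem pair_sum_\<rho>_\<rho>:
  "((\<lambda>x. pair_sum \<rho> \<rho> x * ln x / x) \<longlongrightarrow> 0) at_top"
proof -
  obtain K where K: "K \<ge> 0" "\<And>y. y \<ge> 2 \<Longrightarrow> \<bar>psum \<rho> y\<bar> \<le> K * (y / ln y powr (1 + \<epsilon>))"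
    using psum_\<rho>_bound by blast
  let ?N = "\<lambda>x. nat \<lfloor>sqrt x\<rfloor>"
  have "((\<lambda>x. (\<Sum>n=2..?N x. \<rho> n * psum \<rho> (x / real n)) * ln x / x +
      (\<Sum>n=2..?N x. \<rho> n * psum \<rho> (x / real n)) * ln x / x -
      psum \<rho> (sqrt x) * psum \<rho> (sqrt x) * ln x / x) \<longlongrightarrow> 0 + 0 - 0) at_top"
    by (intro tendsto_add tendsto_diff error_sum_tendsto_0[OF K(2) K(1) \<rho>] corner_tendsto_0[OF K(2) K(1) \<rho>])
  moreover have "eventually (\<lambda>x. (\<Sum>n=2..?N x. \<rho> n * psum \<rho> (x / real n)) * ln x / x +
      (\<Sum>n=2..?N x. \<rho> n * psum \<rho> (x / real n)) * ln x / x -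
      psum \<rho> (sqrt x) * psum \<rho> (sqrt x) * ln x / x = pair_sum \<rho> \<rho> x * ln x / x) at_top"
    using eventually_ge_at_top[of 0]
    by eventually_elim (simp add: hyperbola algebra_simps add_divide_distrib diff_divide_distrib)
  ultimately show ?thesis by (simp add: Lim_transform_eventually)
qed

lemma psum_\<kappa>_asymptotic: "((\<lambda>y. psum \<kappa> y * ln y / y) \<longlongrightarrow> 1) at_top"
proof -
  obtain K' where K': "K' \<ge> 0" "\<And>y. y \<ge> 2 \<Longrightarrow> \<bar>psum \<kappa> y - y / ln y\<bar> \<le> K' * (y / ln y powr (1 + \<epsilon>))"
    using psum_\<kappa>_bound by blast
  have "((\<lambda>y. psum \<kappa> y * ln y / y - 1) \<longlongrightarrow> 0) at_top"
  proof (rule Lim_null_comparison)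
    show "((\<lambda>y. K' / ln y powr \<epsilon>) \<longlongrightarrow> 0) at_top" using \<epsilon> by real_asymp
    show "eventually (\<lambda>y. norm (psum \<kappa> y * ln y / y - 1) \<le> K' / ln y powr \<epsilon>) at_top"
      using eventually_ge_at_top[of 2]
    proof eventually_elim
      case (elim y)
      have l: "ln y > 0" using elim by simp
      have "psum \<kappa> y * ln y / y - 1 = (psum \<kappa> y - y / ln y) * (ln y / y)"
        using l elim by (simp add: field_simps)
      then have "norm (psum \<kappa> y * ln y / y - 1) = \<bar>psum \<kappa> y - y / ln y\<bar> * (ln y / y)"
        using l elim by (simp add: abs_mult)
      also have "\<dots> \<le> K' * (y / ln y powr (1 + \<epsilon>)) * (ln y / y)"
        using K'(2)[OF elim] l elim by (intro mult_right_mono) auto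
      also have "\<dots> = K' / ln y powr \<epsilon>" using l elim by (simp add: powr_add)
      finally show ?case .
    qed
  qed
  then show ?thesis by (rule LIM_zero_cancel)
qed

text \<open>Each half of the hyperbola formula contributes ln ln x from the prime reciprocals, hence
  the limit 2; the corner and the excess weights are of smaller order.\<close>

theorem pair_sum_\<kappa>_\<kappa>:
  "((\<lambda>x. pair_sum \<kappa> \<kappa> x * ln x / (x * ln (ln x))) \<longlongrightarrow> 2) at_top"
proof -
  obtain K' where K': "K' \<ge> 0" "\<And>y. y \<ge> 2 \<Longrightarrow> \<bar>psum \<kappa> y - y / ln y\<bar> \<le> K' * (y / ln y powr (1 + \<epsilon>))"
    using psum_\<kappa>_bound by blast
  obtain C where C: "C \<ge> 0" "\<And>x. x \<ge> 4 \<Longrightarrow> \<bar>psum (\<lambda>n. prime_ind n / real n) (sqrt x) - ln (ln x)\<bar> \<le> C"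
    using prime_reciprocals_sqrt by blast
  let ?N = "\<lambda>x. nat \<lfloor>sqrt x\<rfloor>"
  let ?V = "\<lambda>x n. ln (real n) / (ln x - ln (real n))"
  have lnln: "((\<lambda>x::real. 1 / ln (ln x)) \<longlongrightarrow> 0) at_top" by real_asymp
  have H: "((\<lambda>x. psum (\<lambda>n. \<kappa> n / real n) (sqrt x) / ln (ln x)) \<longlongrightarrow> 1) at_top"
  proof -
    have "((\<lambda>x. psum (\<lambda>n. \<kappa> n / real n) (sqrt x) / ln (ln x) - 1) \<longlongrightarrow> 0) at_top"
    proof (rule Lim_null_comparison)
      show "((\<lambda>x::real. (C + real d) * (1 / ln (ln x))) \<longlongrightarrow> 0) at_top"
        using tendsto_mult_right_zero[OF lnln] .
      have "eventually (\<lambda>x::real. ln (ln x) > 0) at_top" by real_asymp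
      then show "eventually (\<lambda>x. norm (psum (\<lambda>n. \<kappa> n / real n) (sqrt x) / ln (ln x) - 1) \<le> (C + real d) * (1 / ln (ln x))) at_top"
        using eventually_ge_at_top[of 4]
      proof eventually_elim
        case (elim x)
        have "\<bar>psum (\<lambda>n. \<kappa> n / real n) (sqrt x) - psum (\<lambda>n. prime_ind n / real n) (sqrt x)\<bar> =
            \<bar>\<Sum>n=2..?N x. \<kappa> n / real n - prime_ind n / real n\<bar>"
          by (simp add: psum_def sum_subtractf)
        also have "\<dots> \<le> (\<Sum>n=2..?N x. if n \<le> d then 1 else 0)"
        proof (rule order_trans[OF sum_abs sum_mono])
          fix n assume n: "n \<in> {2..?N x}"
          have "\<bar>\<kappa> n / real n - prime_ind n / real n\<bar> = \<bar>\<kappa> n - prime_ind n\<bar> / real n"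
            by (simp add: diff_divide_distrib[symmetric])
          also have "\<dots> \<le> \<bar>\<kappa> n - prime_ind n\<bar> / 1" using n by (intro divide_left_mono) auto
          also have "\<dots> \<le> (if n \<le> d then 1 else 0)"
            using \<kappa>(1,2)[of n] \<kappa>(3)[of n] by (auto split: if_splits)
          finally show "\<bar>\<kappa> n / real n - prime_ind n / real n\<bar> \<le> (if n \<le> d then 1 else 0)" .
        qed
        also have "\<dots> = real (card {n\<in>{2..?N x}. n \<le> d})" by (simp add: sum.inter_filter[symmetric])
        also have "\<dots> \<le> real (card {1..d})" by (intro of_nat_mono card_mono) auto
        finally have "\<bar>psum (\<lambda>n. \<kappa> n / real n) (sqrt x) - ln (ln x)\<bar> \<le> C + real d"
          using C(2)[OF elim(2)] by simp
        then have "\<bar>psum (\<lambda>n. \<kappa> n / real n) (sqrt x) - ln (ln x)\<bar> / ln (ln x) \<le> (C + real d) / ln (ln x)"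
          using elim(1) by (intro divide_right_mono) auto
        moreover have "psum (\<lambda>n. \<kappa> n / real n) (sqrt x) / ln (ln x) - 1 =
            (psum (\<lambda>n. \<kappa> n / real n) (sqrt x) - ln (ln x)) / ln (ln x)"
          using elim(1) by (simp add: diff_divide_distrib)
        ultimately show ?case using elim(1) by (simp add: abs_divide)
      qed
    qed
    then show ?thesis by (rule LIM_zero_cancel)
  qed
  \<comment> \<open>The series of \<kappa>(n)/n is not summable, so the Toeplitz statement is
    applied to the difference from 1 / ln n. In what is left over the ln n of the weight cancels,
    and the rest is at most (2 / ln x) * ln (sqrt x) = 1.\<close>
  have W: "((\<lambda>x. (\<Sum>n=2..?N x. \<kappa> n / real n * ?V x n) / ln (ln x)) \<longlongrightarrow> 0) at_top"
  proof (rule Lim_null_comparison)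
    let ?T = "\<lambda>x. \<Sum>n=2..?N x. (prime_ind n - 1 / ln (real n)) / real n * ?V x n"
    have "(?T \<longlongrightarrow> 0) at_top"
      by (rule toeplitz_log_weights[OF log_saving_summable[OF saving_prime \<epsilon>(1)]])
    then have "((\<lambda>x. (?T x + 1) * (1 / ln (ln x))) \<longlongrightarrow> (0 + 1) * 0) at_top"
      by (intro tendsto_intros lnln)
    then show "((\<lambda>x. (?T x + 1) * (1 / ln (ln x))) \<longlongrightarrow> 0) at_top" by simp
    have "eventually (\<lambda>x::real. ln (ln x) > 0) at_top" by real_asymp
    then show "eventually (\<lambda>x. norm ((\<Sum>n=2..?N x. \<kappa> n / real n * ?V x n) / ln (ln x)) \<le> (?T x + 1) * (1 / ln (ln x))) at_top"
      using eventually_ge_at_top[of 4]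
    proof eventually_elim
      case (elim x)
      have V: "0 \<le> ?V x n" "ln x - ln (real n) \<ge> ln x / 2" "ln x > 0" "n \<ge> 2" if "n \<in> {2..?N x}" for n
      proof -
        have nx: "real n \<le> sqrt x" "n \<ge> 2" using that elim by (auto simp: le_nat_floor_iff)
        then show "0 \<le> ?V x n" "ln x - ln (real n) \<ge> ln x / 2" "ln x > 0" "n \<ge> 2"
          using log_weight_bounds[OF elim(2) _ order_refl nx(1)] by auto
      qed
      have nonneg: "0 \<le> (\<Sum>n=2..?N x. \<kappa> n / real n * ?V x n)"
        by (intro sum_nonneg mult_nonneg_nonneg divide_nonneg_nonneg \<kappa> V) auto
      have "(\<Sum>n=2..?N x. \<kappa> n / real n * ?V x n) \<le>
          (\<Sum>n=2..?N x. (prime_ind n - 1 / ln (real n)) / real n * ?V x n + 2 / ln x * (1 / real n))"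
      proof (rule sum_mono)
        fix n assume n: "n \<in> {2..?N x}"
        have "\<kappa> n / real n * ?V x n \<le> prime_ind n / real n * ?V x n"
          by (intro mult_right_mono divide_right_mono \<kappa> V(1)[OF n]) auto
        also have "\<dots> = (prime_ind n - 1 / ln (real n)) / real n * ?V x n + 1 / ln (real n) / real n * ?V x n"
          by (simp add: diff_divide_distrib left_diff_distrib)
        also have "1 / ln (real n) / real n * ?V x n = 1 / (ln x - ln (real n)) * (1 / real n)"
          using V(4)[OF n] by simp
        also have "1 / (ln x - ln (real n)) * (1 / real n) \<le> 1 / (ln x / 2) * (1 / real n)"
          using V[OF n] by (intro mult_right_mono divide_left_mono) (auto intro!: mult_pos_pos)
        finally show "\<kappa> n / real n * ?V x n \<le> (prime_ind n - 1 / ln (real n)) / real n * ?V x n + 2 / ln x * (1 / real n)"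
          by simp
      qed
      also have "\<dots> = ?T x + 2 / ln x * (\<Sum>n=2..?N x. 1 / real n)"
        by (simp add: sum.distrib sum_distrib_left)
      also have "\<dots> \<le> ?T x + 1"
      proof -
        have lx: "ln x > 0" using elim by simp
        have N1: "?N x \<ge> 1" using elim le_nat_floor[of 1 "sqrt x"] by simp
        have "(\<Sum>n=2..?N x. 1 / real n) \<le> ln (real (?N x))" by (rule sum_inverse_le_ln[OF N1])
        also have "\<dots> \<le> ln (sqrt x)" using N1 elim by (subst ln_le_cancel_iff) auto
        also have "\<dots> = ln x / 2" using elim by (simp add: ln_sqrt)
        finally have "2 / ln x * (\<Sum>n=2..?N x. 1 / real n) \<le> 2 / ln x * (ln x / 2)"
          using lx by (intro mult_left_mono) auto
        then show ?thesis using lx by simp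
      qed
      finally have "(\<Sum>n=2..?N x. \<kappa> n / real n * ?V x n) / ln (ln x) \<le> (?T x + 1) / ln (ln x)"
        using elim(1) by (intro divide_right_mono) auto
      then show ?case using nonneg elim(1) by simp
    qed
  qed
  have corner: "((\<lambda>x. psum \<kappa> (sqrt x) * psum \<kappa> (sqrt x) * ln x / x) \<longlongrightarrow> 0) at_top"
  proof -
    have "((\<lambda>x. psum \<kappa> (sqrt x) * ln (sqrt x) / sqrt x) \<longlongrightarrow> 1) at_top"
      by (rule filterlim_compose[OF psum_\<kappa>_asymptotic sqrt_at_top])
    moreover have "((\<lambda>x::real. 4 / ln x) \<longlongrightarrow> 0) at_top" by real_asymp
    ultimately have "((\<lambda>x. (psum \<kappa> (sqrt x) * ln (sqrt x) / sqrt x) ^ 2 * (4 / ln x)) \<longlongrightarrow> 1 ^ 2 * 0) at_top"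
      by (intro tendsto_intros)
    moreover have "eventually (\<lambda>x. (psum \<kappa> (sqrt x) * ln (sqrt x) / sqrt x) ^ 2 * (4 / ln x) =
        psum \<kappa> (sqrt x) * psum \<kappa> (sqrt x) * ln x / x) at_top"
      using eventually_ge_at_top[of 4]
      by eventually_elim (simp add: power_divide power_mult_distrib ln_sqrt power2_eq_square)
    ultimately show ?thesis by (simp add: Lim_transform_eventually)
  qed
  let ?R = "\<lambda>x. (\<Sum>n=2..?N x. \<kappa> n * (psum \<kappa> (x / real n) - (x / real n) / ln (x / real n))) * ln x / x"
  have "((\<lambda>x. 2 * (psum (\<lambda>n. \<kappa> n / real n) (sqrt x) / ln (ln x) +
      (\<Sum>n=2..?N x. \<kappa> n / real n * ?V x n) / ln (ln x) + ?R x * (1 / ln (ln x))) -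
      psum \<kappa> (sqrt x) * psum \<kappa> (sqrt x) * ln x / x * (1 / ln (ln x))) \<longlongrightarrow> 2 * (1 + 0 + 0 * 0) - 0 * 0) at_top"
    by (intro tendsto_add tendsto_diff tendsto_mult H W tendsto_const corner lnln
        error_sum_tendsto_0[OF K'(2) K'(1) \<kappa>_abs])
  moreover have "eventually (\<lambda>x. 2 * (psum (\<lambda>n. \<kappa> n / real n) (sqrt x) / ln (ln x) +
      (\<Sum>n=2..?N x. \<kappa> n / real n * ?V x n) / ln (ln x) + ?R x * (1 / ln (ln x))) -
      psum \<kappa> (sqrt x) * psum \<kappa> (sqrt x) * ln x / x * (1 / ln (ln x)) =
      pair_sum \<kappa> \<kappa> x * ln x / (x * ln (ln x))) at_top"
    using eventually_ge_at_top[of 4]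
  proof eventually_elim
    case (elim x)
    then have x0: "x \<ge> 0" by simp
    define S where "S = (\<Sum>n=2..?N x. \<kappa> n * psum \<kappa> (x / real n))"
    have "S * ln x / x = psum (\<lambda>n. \<kappa> n / real n) (sqrt x) + (\<Sum>n=2..?N x. \<kappa> n / real n * ?V x n) + ?R x"
      unfolding S_def main_sum_eq[OF elim, symmetric] by (rule half_sum_split)
    then have "2 * (psum (\<lambda>n. \<kappa> n / real n) (sqrt x) / ln (ln x) +
      (\<Sum>n=2..?N x. \<kappa> n / real n * ?V x n) / ln (ln x) + ?R x * (1 / ln (ln x))) = 2 * ((S * ln x / x) / ln (ln x))"
      by (simp add: add_divide_distrib)
    moreover have "pair_sum \<kappa> \<kappa> x = 2 * S - psum \<kappa> (sqrt x) * psum \<kappa> (sqrt x)"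
      unfolding hyperbola[OF x0] S_def by simp
    ultimately show ?case by (simp add: left_diff_distrib diff_divide_distrib)
  qed
  ultimately show ?thesis by (simp add: Lim_transform_eventually)
qed

end

section \<open>Counting products of two primes\<close>

lemma prime_mult_eq_cases:
  fixes p q p' q' :: nat
  assumes "prime p" "prime q" "prime p'" "prime q'" "p * q = p' * q'" "p \<le> q" "p' \<le> q'"
  shows "p = p' \<and> q = q'"
proof -
  have "p dvd p' * q'" using assms(5) by (metis dvd_triv_left)
  then have "p = p' \<or> p = q'"
    using assms by (metis prime_dvd_mult_iff primes_dvd_imp_eq)
  then show ?thesis
  proof
    assume "p = p'"
    then show ?thesis using assms prime_gt_0_nat[of p] by auto
  next
    assume pq: "p = q'"
    then have "q = p'" using assms prime_gt_0_nat[of p] by (auto simp: mult.commute)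
    then show ?thesis using pq assms by auto
  qed
qed

text \<open>By unique factorization each n comes from exactly one pair with p \<le> q. Ordered pairs
  count it twice unless p = q, and there are at most sqrt x such squares.\<close>

lemma count_products:
  fixes Q :: "nat \<Rightarrow> bool" and x :: real
  assumes Q: "\<And>n. Q n \<Longrightarrow> prime n" and x: "x \<ge> 0"
  shows "\<bar>2 * real (card {n::nat. real n \<le> x \<and> (\<exists>p q. Q p \<and> Q q \<and> n = p * q)}) -
           pair_sum (\<lambda>n. if Q n then 1 else 0) (\<lambda>n. if Q n then 1 else 0) x\<bar> \<le> sqrt x"
proof -
  let ?A = "{(p, q). Q p \<and> Q q \<and> real (p * q) \<le> x}"
  let ?L = "{(p, q). Q p \<and> Q q \<and> real (p * q) \<le> x \<and> p \<le> q}"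
  let ?G = "{(p, q). Q p \<and> Q q \<and> real (p * q) \<le> x \<and> q \<le> p}"
  let ?S = "{n::nat. real n \<le> x \<and> (\<exists>p q. Q p \<and> Q q \<and> n = p * q)}"
  have Q2: "n \<ge> 2" if "Q n" for n using Q[OF that] prime_ge_2_nat by blast
  have finA: "finite ?A" by (rule finite_subset[OF _ finite_pairs[of x]]) (use Q2 in auto)
  have fin: "finite ?L" "finite ?G" by (auto intro: finite_subset[OF _ finA])
  have pair: "pair_sum (\<lambda>n. if Q n then 1 else 0) (\<lambda>n. if Q n then 1 else 0) x = real (card ?A)"
  proof -
    have "pair_sum (\<lambda>n. if Q n then 1 else 0) (\<lambda>n. if Q n then 1 else 0) x = (\<Sum>(p, q)\<in>?A. 1)"
      unfolding pair_sum_def using Q2 by (intro sum.mono_neutral_cong_right finite_pairs) (auto split: if_splits)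
    then show ?thesis by simp
  qed
  have "bij_betw (\<lambda>(p, q). p * q) ?L ?S"
    unfolding bij_betw_def
  proof
    show "inj_on (\<lambda>(p, q). p * q) ?L"
    proof (rule inj_onI)
      fix z z' assume z: "z \<in> ?L" "z' \<in> ?L" "(case z of (p, q) \<Rightarrow> p * q) = (case z' of (p, q) \<Rightarrow> p * q)"
      obtain p q p' q' where zz: "z = (p, q)" "z' = (p', q')" by (cases z, cases z') auto
      show "z = z'" using z prime_mult_eq_cases[OF Q Q Q Q, of p q p' q'] unfolding zz by simp
    qed
    show "(\<lambda>(p, q). p * q) ` ?L = ?S"
    proof (intro equalityI subsetI)
      fix n assume "n \<in> ?S"
      then obtain p q where pq: "Q p" "Q q" "n = p * q" "real n \<le> x" by auto
      show "n \<in> (\<lambda>(p, q). p * q) ` ?L"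
      proof (cases "p \<le> q")
        case True
        then show ?thesis using pq by (intro image_eqI[of _ _ "(p, q)"]) auto
      next
        case False
        then show ?thesis using pq by (intro image_eqI[of _ _ "(q, p)"]) (auto simp: mult.commute)
      qed
    qed auto
  qed
  then have L: "card ?L = card ?S" by (rule bij_betw_same_card)
  have "bij_betw (\<lambda>(p, q). (q, p)) ?L ?G"
    by (rule bij_betwI[of _ _ _ "\<lambda>(p, q). (q, p)"]) (auto simp: mult.commute)
  then have G: "card ?G = card ?L" by (rule bij_betw_same_card[symmetric])
  have "?A = ?L \<union> ?G" by auto
  then have sum: "card ?A + card (?L \<inter> ?G) = 2 * card ?S"
    using card_Un_Int[OF fin] L G by simp
  have "card (?L \<inter> ?G) \<le> card ((\<lambda>p. (p, p)) ` {1..nat \<lfloor>sqrt x\<rfloor>})"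
  proof (rule card_mono)
    show "?L \<inter> ?G \<subseteq> (\<lambda>p. (p, p)) ` {1..nat \<lfloor>sqrt x\<rfloor>}"
    proof
      fix z assume "z \<in> ?L \<inter> ?G"
      then obtain p where p: "z = (p, p)" "Q p" "real (p * p) \<le> x" by auto
      have "real p \<le> sqrt x" using p(3) by (intro real_le_rsqrt) (simp add: power2_eq_square)
      then have "p \<le> nat \<lfloor>sqrt x\<rfloor>" by (rule le_nat_floor)
      then show "z \<in> (\<lambda>p. (p, p)) ` {1..nat \<lfloor>sqrt x\<rfloor>}" using p Q2[OF p(2)] by auto
    qed
  qed simp
  also have "\<dots> \<le> nat \<lfloor>sqrt x\<rfloor>" using card_image_le[of "{1..nat \<lfloor>sqrt x\<rfloor>}" "\<lambda>p. (p, p)"] by simp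
  finally have "real (card (?L \<inter> ?G)) \<le> real (nat \<lfloor>sqrt x\<rfloor>)" by simp
  also have "\<dots> \<le> sqrt x" using x by simp
  finally have "real (card (?L \<inter> ?G)) \<le> sqrt x" .
  moreover have "real (card ?A) + real (card (?L \<inter> ?G)) = 2 * real (card ?S)"
    using arg_cong[OF sum, of real] by simp
  ultimately show ?thesis unfolding pair by (simp add: abs_le_iff)
qed

lemma pair_sum_commute: "pair_sum f g x = pair_sum g f x"
  unfolding pair_sum_def
  by (rule sum.reindex_bij_witness[of _ "\<lambda>(p, q). (q, p)" "\<lambda>(p, q). (q, p)"]) (auto simp: mult.commute)

lemma pair_sum_square:
  assumes "\<eta> ^ 2 = 1" "\<And>n. u n = (\<kappa> n + \<eta> * \<rho> n) / 2"
  shows "4 * pair_sum u u x = pair_sum \<kappa> \<kappa> x + 2 * \<eta> * pair_sum \<rho> \<kappa> x + pair_sum \<rho> \<rho> x"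
proof -
  have "4 * pair_sum u u x = pair_sum \<kappa> \<kappa> x + \<eta> * pair_sum \<rho> \<kappa> x + \<eta> * pair_sum \<kappa> \<rho> x + \<eta> ^ 2 * pair_sum \<rho> \<rho> x"
    unfolding pair_sum_def sum_distrib_left sum.distrib[symmetric]
    by (intro sum.cong refl) (auto simp: assms(2) field_simps power2_eq_square)
  then show ?thesis using assms(1) pair_sum_commute[where f = \<kappa> and g = \<rho> and x = x] by simp
qed

context prime_asymptotics
begin

text \<open>The pair sum of \<kappa> cancels in 4 A - B, leaving \<eta> L x / ln x as main term,
  while B is asymptotic to x ln ln x / ln x. The diagonal errors sqrt x are negligible against
  both.\<close>

theorem semiprime_ratio:
  fixes \<eta> :: real and A B :: "real \<Rightarrow> real"
  assumes \<eta>: "\<eta> ^ 2 = 1" and u: "\<And>n. u n = (\<kappa> n + \<eta> * \<rho> n) / 2"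
    and A: "\<And>x. x \<ge> 0 \<Longrightarrow> \<bar>2 * A x - pair_sum u u x\<bar> \<le> sqrt x"
    and B: "\<And>x. x \<ge> 0 \<Longrightarrow> \<bar>2 * B x - pair_sum \<kappa> \<kappa> x\<bar> \<le> sqrt x"
  shows "((\<lambda>x. \<eta> * (A x / (1 / 4 * B x) - 1) * ln (ln x)) \<longlongrightarrow> (\<Sum>n. \<rho> n / real n)) at_top"
proof -
  let ?L = "\<Sum>n. \<rho> n / real n"
  have small: "((\<lambda>x. e x * ln x / x) \<longlongrightarrow> 0) at_top" if e: "\<And>x. x \<ge> 0 \<Longrightarrow> \<bar>e x\<bar> \<le> sqrt x" for e :: "real \<Rightarrow> real"
  proof (rule Lim_null_comparison)
    show "((\<lambda>x::real. sqrt x * ln x / x) \<longlongrightarrow> 0) at_top" by real_asymp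
    show "eventually (\<lambda>x. norm (e x * ln x / x) \<le> sqrt x * ln x / x) at_top"
      using eventually_ge_at_top[of 1]
    proof eventually_elim
      case (elim x)
      then have "\<bar>e x\<bar> * (ln x / x) \<le> sqrt x * (ln x / x)" using e[of x] by (intro mult_right_mono) auto
      then show ?case using elim by (simp add: abs_mult)
    qed
  qed
  have sq: "4 * pair_sum u u x = pair_sum \<kappa> \<kappa> x + 2 * \<eta> * pair_sum \<rho> \<kappa> x + pair_sum \<rho> \<rho> x" for x
    by (rule pair_sum_square[OF \<eta> u])
  define e1 e2 where "e1 x = 2 * A x - pair_sum u u x" and "e2 x = 2 * B x - pair_sum \<kappa> \<kappa> x" for x
  have e1: "((\<lambda>x. e1 x * ln x / x) \<longlongrightarrow> 0) at_top" and e2: "((\<lambda>x. e2 x * ln x / x) \<longlongrightarrow> 0) at_top"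
    by (rule small[of e1], unfold e1_def, rule A, assumption)
       (rule small[of e2], unfold e2_def, rule B, assumption)
  have num: "((\<lambda>x. (4 * A x - B x) * ln x / x) \<longlongrightarrow> \<eta> * ?L) at_top"
  proof -
    have "((\<lambda>x. \<eta> * (pair_sum \<rho> \<kappa> x * ln x / x) + 1 / 2 * (pair_sum \<rho> \<rho> x * ln x / x) +
        2 * (e1 x * ln x / x) - 1 / 2 * (e2 x * ln x / x)) \<longlongrightarrow> \<eta> * ?L + 1 / 2 * 0 + 2 * 0 - 1 / 2 * 0) at_top"
      by (intro tendsto_intros pair_sum_\<rho>_\<kappa> pair_sum_\<rho>_\<rho> e1 e2)
    moreover have "\<eta> * (pair_sum \<rho> \<kappa> x * ln x / x) + 1 / 2 * (pair_sum \<rho> \<rho> x * ln x / x) +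
        2 * (e1 x * ln x / x) - 1 / 2 * (e2 x * ln x / x) = (4 * A x - B x) * ln x / x" for x
    proof -
      have "4 * A x - B x = \<eta> * pair_sum \<rho> \<kappa> x + 1 / 2 * pair_sum \<rho> \<rho> x + 2 * e1 x - 1 / 2 * e2 x"
      proof -
        have "4 * a - b = t + 1 / 2 * r + 2 * (2 * a - v) - 1 / 2 * (2 * b - k)"
          if "4 * v = k + 2 * t + r" for a b t r v k :: real
          using that by argo
        then show ?thesis using sq[of x] unfolding e1_def e2_def mult.assoc by blast
      qed
      then show ?thesis by (simp only: divide_inverse ring_distribs mult_ac)
    qed
    ultimately show ?thesis by simp
  qed
  have den: "((\<lambda>x. B x * ln x / (x * ln (ln x))) \<longlongrightarrow> 1) at_top"
  proof -
    have lnln: "((\<lambda>x::real. 1 / ln (ln x)) \<longlongrightarrow> 0) at_top" by real_asymp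
    have "((\<lambda>x. 1 / 2 * (pair_sum \<kappa> \<kappa> x * ln x / (x * ln (ln x))) + 1 / 2 * (e2 x * ln x / x * (1 / ln (ln x)))) \<longlongrightarrow>
       1 / 2 * 2 + 1 / 2 * (0 * 0)) at_top"
      by (intro tendsto_intros pair_sum_\<kappa>_\<kappa> e2 lnln)
    moreover have "1 / 2 * (pair_sum \<kappa> \<kappa> x * ln x / (x * ln (ln x))) + 1 / 2 * (e2 x * ln x / x * (1 / ln (ln x))) =
        B x * ln x / (x * ln (ln x))" for x
    proof -
      have "B x = 1 / 2 * pair_sum \<kappa> \<kappa> x + 1 / 2 * e2 x" by (simp add: e2_def diff_divide_distrib)
      then show ?thesis by (simp only: divide_inverse inverse_mult_distrib ring_distribs mult_ac mult_1_left mult_1_right)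
    qed
    ultimately show ?thesis by simp
  qed
  have l1: "((\<lambda>x. \<eta> * (((4 * A x - B x) * ln x / x) / (B x * ln x / (x * ln (ln x))))) \<longlongrightarrow> \<eta> * ((\<eta> * ?L) / 1)) at_top"
    by (intro tendsto_intros num den) auto
  have ev: "eventually (\<lambda>x. \<eta> * (((4 * A x - B x) * ln x / x) / (B x * ln x / (x * ln (ln x)))) =
      \<eta> * (A x / (1 / 4 * B x) - 1) * ln (ln x)) at_top"
  proof -
    \<comment> \<open>Positivity of the normalized denominator yields all nonvanishing conditions at
      once, since a zero divisor would make it 0.\<close>
    have "eventually (\<lambda>x. B x * ln x / (x * ln (ln x)) > 0) at_top"
      using order_tendstoD(1)[OF den, of 0] by simp
    then show ?thesis
    proof eventually_elim
      case (elim x)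
      then have nz: "B x \<noteq> 0" "ln x \<noteq> 0" "x \<noteq> 0" "ln (ln x) \<noteq> 0" by auto
      have "((4 * A x - B x) * ln x / x) / (B x * ln x / (x * ln (ln x))) = (4 * A x - B x) / B x * ln (ln x)"
        using nz by (simp add: divide_simps)
      also have "(4 * A x - B x) / B x = A x / (1 / 4 * B x) - 1"
        using nz by (simp add: divide_simps)
      finally show ?case by (simp add: mult.assoc)
    qed
  qed
  have eq: "\<eta> * ((\<eta> * ?L) / 1) = ?L" using \<eta> by (simp add: power2_eq_square mult.assoc[symmetric])
  show ?thesis using Lim_transform_eventually[OF l1 ev] unfolding eq .
qed

end

section \<open>From the complex character to its sign function\<close>

locale quadratic_dirichlet_character =
  fixes d :: nat and \<chi> :: "int \<Rightarrow> complex"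
  assumes quad: "quadratic_character d \<chi>"
begin

lemma d_pos: "d > 0"
  and chi_mult: "\<chi> (a * b) = \<chi> a * \<chi> b"
  and periodic: "\<chi> (a + int d) = \<chi> a"
  and nonzero_iff: "\<chi> a \<noteq> 0 \<longleftrightarrow> coprime a (int d)"
  using quad by (auto simp: quadratic_character_def dirichlet_character_def)

text \<open>Taking real parts loses nothing: the square is the principal character, so all values
  are -1, 0 or 1.\<close>

definition c :: "nat \<Rightarrow> real" where
  "c n = Re (\<chi> (int n))"

lemma char_values: "\<chi> a \<in> {-1, 0, 1}"
proof (cases "coprime a (int d)")
  case True
  have "(\<chi> a) ^ 2 = principal_character d a"
    using quad by (auto simp: quadratic_character_def dest: fun_cong)
  then have "(\<chi> a) ^ 2 = 1" using True by (simp add: principal_character_def)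
  then show ?thesis by (simp add: power2_eq_1_iff) blast
next
  case False
  then show ?thesis using nonzero_iff by auto
qed

lemma of_real_c: "complex_of_real (c n) = \<chi> (int n)"
  using char_values[of "int n"] by (auto simp: c_def)

lemma c_eq_iff: "\<chi> (int n) = of_real t \<longleftrightarrow> c n = t"
  unfolding of_real_c[symmetric] by simp

lemma c_nonzero_iff: "c n \<noteq> 0 \<longleftrightarrow> coprime n d"
proof -
  have "c n \<noteq> 0 \<longleftrightarrow> \<chi> (int n) \<noteq> 0" using c_eq_iff[of n 0] by simp
  then show ?thesis by (simp add: nonzero_iff)
qed

sublocale sign_character c
proof
  show "c (m * n) = c m * c n" for m n
  proof -
    have "complex_of_real (c (m * n)) = complex_of_real (c m * c n)"
      by (simp add: of_real_c chi_mult)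
    then show ?thesis by (simp only: of_real_eq_iff)
  qed
  have "\<chi> 1 = \<chi> 1 * \<chi> 1" using chi_mult[of 1 1] by simp
  moreover have "\<chi> 1 \<noteq> 0" by (simp add: nonzero_iff)
  ultimately have "\<chi> 1 = 1" by simp
  then show "c 1 = 1" by (simp add: c_def)
  show "c n \<in> {-1, 0, 1}" for n using char_values[of "int n"] by (auto simp: c_def)
qed

lemma periodic_mult: "\<chi> (a + int d * int k) = \<chi> a"
proof (induction k)
  case (Suc k)
  have "a + int d * int (Suc k) = (a + int d * int k) + int d" by (simp add: algebra_simps)
  then show ?case using Suc periodic by metis
qed simp

lemma mod_d: "\<chi> (a mod int d) = \<chi> a"
proof -
  define k where "k = a div int d"
  have a: "a = a mod int d + int d * k" by (simp add: k_def)
  show ?thesis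
  proof (cases "k \<ge> 0")
    case True
    then show ?thesis using periodic_mult[of "a mod int d" "nat k"] a by simp
  next
    case False
    have "a mod int d = a + int d * int (nat (- k))" using a False by (simp add: algebra_simps)
    then show ?thesis using periodic_mult[of a "nat (- k)"] by simp
  qed
qed

text \<open>Multiplication by some b with \<chi>(b) different from 0 and 1 permutes the residues, so
  the sum equals \<chi>(b) times itself. Such b exists because the character is not
  principal.\<close>

lemma sum_period: "(\<Sum>a\<in>{0..<int d}. \<chi> a) = 0"
proof -
  have "\<chi> \<noteq> principal_character d" using quad by (simp add: quadratic_character_def)
  then obtain b where b: "\<chi> b \<noteq> principal_character d b" by auto
  then have cop: "coprime b (int d)" "\<chi> b \<noteq> 1"
    using nonzero_iff[of b] by (auto simp: principal_character_def split: if_splits)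
  let ?S = "{0..<int d}"
  have inj: "inj_on (\<lambda>a. (b * a) mod int d) ?S"
  proof (rule inj_onI)
    fix a a' assume aa: "a \<in> ?S" "a' \<in> ?S" "(b * a) mod int d = (b * a') mod int d"
    then have "int d dvd b * a - b * a'" by (simp add: mod_eq_dvd_iff)
    then have "int d dvd b * (a - a')" by (simp add: right_diff_distrib)
    then have "int d dvd a - a'" using cop(1) by (simp add: coprime_dvd_mult_right_iff coprime_commute)
    then have "a mod int d = a' mod int d" by (simp add: mod_eq_dvd_iff)
    then show "a = a'" using aa by simp
  qed
  moreover have "(\<lambda>a. (b * a) mod int d) ` ?S \<subseteq> ?S" using d_pos by auto
  ultimately have img: "(\<lambda>a. (b * a) mod int d) ` ?S = ?S"
    by (intro card_subset_eq) (auto simp: card_image)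
  have "\<chi> b * (\<Sum>a\<in>?S. \<chi> a) = (\<Sum>a\<in>?S. \<chi> ((b * a) mod int d))"
    by (simp add: sum_distrib_left chi_mult mod_d)
  also have "\<dots> = (\<Sum>a\<in>?S. \<chi> a)"
    using sum.reindex[OF inj, of \<chi>] img by simp
  finally have "(\<chi> b - 1) * (\<Sum>a\<in>?S. \<chi> a) = 0" by (simp add: left_diff_distrib)
  then show ?thesis using cop(2) by simp
qed

lemma sum_c_period: "(\<Sum>n<d. c (Suc n)) = 0"
proof -
  have "(\<Sum>n<d. c n) = 0"
  proof -
    have "complex_of_real (\<Sum>n<d. c n) = (\<Sum>n<d. \<chi> (int n))" by (simp add: of_real_c)
    also have "\<dots> = (\<Sum>a\<in>{0..<int d}. \<chi> a)"
      by (rule sum.reindex_bij_witness[of _ nat int]) auto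
    finally have "complex_of_real (\<Sum>n<d. c n) = of_real 0" by (simp only: sum_period of_real_0)
    then show ?thesis by (simp only: of_real_eq_iff)
  qed
  moreover have "c d = c 0" using periodic[of 0] by (simp add: c_def)
  moreover have "(\<Sum>n<Suc d. c n) = c 0 + (\<Sum>n<d. c (Suc n))" by (rule sum.lessThan_Suc_shift)
  ultimately show ?thesis by simp
qed

lemma c_periodic: "c (n + d) = c n"
  using periodic[of "int n"] by (simp add: c_def)

lemma partial_sums_le: "\<bar>\<Sum>n<N. c (Suc n)\<bar> \<le> real d"
proof (induction N rule: less_induct)
  case (less N)
  show ?case
  proof (cases "N < d")
    case True
    have "\<bar>\<Sum>n<N. c (Suc n)\<bar> \<le> (\<Sum>n<N. 1)"
      by (intro order_trans[OF sum_abs sum_mono] abs_le_1)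
    then show ?thesis using True by simp
  next
    case False
    define M where "M = N - d"
    have N: "N = d + M" using False by (simp add: M_def)
    have "(\<Sum>n<d + k. c (Suc n)) = (\<Sum>n<d. c (Suc n)) + (\<Sum>n<k. c (Suc n))" for k
    proof (induction k)
      case (Suc k)
      have "c (Suc (d + k)) = c (Suc k)" using c_periodic[of "Suc k"] by (simp add: add.commute)
      then show ?case using Suc by simp
    qed simp
    then have "(\<Sum>n<N. c (Suc n)) = (\<Sum>n<M. c (Suc n))" by (simp add: N sum_c_period)
    then show ?thesis using less[of M] N d_pos by simp
  qed
qed

sublocale nonprincipal_character c "real d"
  by unfold_locales (rule partial_sums_le)

definition prime_char :: "nat \<Rightarrow> real" where
  "prime_char n = (if prime n then c n else 0)"

definition coprime_ind :: "nat \<Rightarrow> real" where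
  "coprime_ind n = (if prime n \<and> coprime n d then 1 else 0)"

text \<open>Dropping the proper prime powers leaves ln p at each prime, and dividing by ln n turns
  this into the prime indicator while raising the exponent to 1 + \<epsilon>.\<close>

lemma prime_asymptotics_exists:
  obtains \<epsilon> where "prime_asymptotics prime_char coprime_ind \<epsilon> d"
proof -
  obtain \<epsilon>1 where \<epsilon>1: "0 < \<epsilon>1" "\<epsilon>1 \<le> 1" "log_saving (\<lambda>n. mangoldt n - 1) \<epsilon>1"
    by (rule log_saving_mangoldt)
  obtain \<epsilon>2 where \<epsilon>2: "0 < \<epsilon>2" "\<epsilon>2 \<le> 1" "log_saving (\<lambda>n. c n * mangoldt n) \<epsilon>2"
    by (rule log_saving_char_mangoldt)
  define \<epsilon> where "\<epsilon> = min \<epsilon>1 \<epsilon>2"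
  have \<epsilon>: "0 < \<epsilon>" "\<epsilon> \<le> 1" "\<epsilon> \<le> \<epsilon>1" "\<epsilon> \<le> \<epsilon>2" using \<epsilon>1 \<epsilon>2 by (auto simp: \<epsilon>_def)
  have pp: "log_saving (\<lambda>n. if prime n then 0 else a n * mangoldt n) \<epsilon>" if "\<And>n. \<bar>a n\<bar> \<le> 1" for a
    by (rule log_saving_mono[OF log_saving_prime_powers]) (use that \<epsilon> in auto)
  have "log_saving (\<lambda>n. (mangoldt n - 1) - (if prime n then 0 else 1 * mangoldt n)) \<epsilon>"
    by (rule log_saving_diff[OF log_saving_mono[OF \<epsilon>1(3)] pp]) (use \<epsilon> in auto)
  then have 1: "log_saving (\<lambda>n. ((mangoldt n - 1) - (if prime n then 0 else 1 * mangoldt n)) / ln (real n)) (1 + \<epsilon>)"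
    by (rule log_saving_divide_ln) (use \<epsilon> in auto)
  have "log_saving (\<lambda>n. c n * mangoldt n - (if prime n then 0 else c n * mangoldt n)) \<epsilon>"
    by (rule log_saving_diff[OF log_saving_mono[OF \<epsilon>2(3)] pp]) (use \<epsilon> abs_le_1 in auto)
  then have 2: "log_saving (\<lambda>n. (c n * mangoldt n - (if prime n then 0 else c n * mangoldt n)) / ln (real n)) (1 + \<epsilon>)"
    by (rule log_saving_divide_ln) (use \<epsilon> in auto)
  have "prime_asymptotics prime_char coprime_ind \<epsilon> d"
  proof
    show "log_saving (\<lambda>n. prime_ind n - 1 / ln (real n)) (1 + \<epsilon>)"
      by (rule log_saving_cong[OF 1]) (auto simp: diff_divide_distrib)
    show "log_saving prime_char (1 + \<epsilon>)"
      by (rule log_saving_cong[OF 2]) (auto simp: prime_char_def)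
    show "coprime_ind n = prime_ind n" if "n > d" for n
    proof (cases "prime n")
      case True
      then have "\<not> n dvd d" using that d_pos by (auto dest: dvd_imp_le)
      then have "coprime n d" using True by (rule prime_imp_coprime[rotated])
      then show ?thesis using True by (simp add: coprime_ind_def)
    qed (simp add: coprime_ind_def)
    show "\<bar>prime_char n\<bar> \<le> prime_ind n" for n using abs_le_1 by (simp add: prime_char_def)
  qed (use \<epsilon> in \<open>auto simp: coprime_ind_def\<close>)
  then show ?thesis by (rule that)
qed

text \<open>On primes \<open>coprime_ind\<close> equals the square of c, so the right side is c (c +
  \<eta>) / 2 whenever c is nonzero up to the sign \<eta>, and it vanishes at primes dividing the
  modulus.\<close>

lemma indicator_eq:
  assumes "\<eta> \<in> {-1, 1}"
  shows "(if prime n \<and> c n = \<eta> then 1 else 0) = (coprime_ind n + \<eta> * prime_char n) / 2"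
proof (cases "prime n")
  case True
  have "coprime_ind n = (c n)\<^sup>2"
    using True vals[of n] c_nonzero_iff[of n] by (cases "coprime n d") (auto simp: coprime_ind_def)
  moreover have "prime_char n = c n" using True by (simp add: prime_char_def)
  ultimately show ?thesis using True assms vals[of n] by (elim insertE) simp_all
qed (simp add: coprime_ind_def prime_char_def)

end

theorem mainTheorem1:
  fixes \<chi> :: "int \<Rightarrow> complex" and d :: nat and \<eta> :: int
  assumes "quadratic_character d \<chi>"
    and "conductor d \<chi> = d"
    and "\<eta> \<in> {-1, 1}"
  shows "\<exists>\<epsilon> :: real \<Rightarrow> complex. (\<epsilon> \<longlongrightarrow> 0) at_top \<and>
    (\<forall>\<^sub>F x in at_top.
       complex_of_real
         (real (count_pq x (\<lambda>p q. \<chi> (int p) = of_int \<eta> \<and> \<chi> (int q) = of_int \<eta>)) /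
          (1 / 4 * real (count_pq x (\<lambda>p q. coprime (p * q) d)))) =
       1 + of_int \<eta> * ((prime_sum \<chi> + \<epsilon> x) / complex_of_real (ln (ln x))))"
proof -
  interpret quadratic_dirichlet_character d \<chi> by unfold_locales (rule assms(1))
  obtain \<epsilon> where "prime_asymptotics prime_char coprime_ind \<epsilon> d" by (rule prime_asymptotics_exists)
  then interpret P: prime_asymptotics prime_char coprime_ind \<epsilon> d .
  define e where "e = real_of_int \<eta>"
  have e: "e \<in> {-1, 1}" "e ^ 2 = 1" using assms(3) by (auto simp: e_def)
  define A where "A x = real (count_pq x (\<lambda>p q. \<chi> (int p) = of_int \<eta> \<and> \<chi> (int q) = of_int \<eta>))" for x
  define B where "B x = real (count_pq x (\<lambda>p q. coprime (p * q) d))" for x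
  let ?u = "\<lambda>n. if prime n \<and> c n = e then 1 else (0 :: real)"
  have \<chi>_eq: "\<chi> (int n) = of_int \<eta> \<longleftrightarrow> c n = e" for n
    using c_eq_iff[of n e] by (simp add: e_def)
  have A: "\<bar>2 * A x - pair_sum ?u ?u x\<bar> \<le> sqrt x" if "x \<ge> 0" for x
  proof -
    have "A x = real (card {n. real n \<le> x \<and> (\<exists>p q. (prime p \<and> c p = e) \<and> (prime q \<and> c q = e) \<and> n = p * q)})"
      unfolding A_def count_pq_def \<chi>_eq by (intro arg_cong[where f = "\<lambda>S. real (card S)"]) blast
    then show ?thesis using count_products[of "\<lambda>n. prime n \<and> c n = e", OF _ that] by simp
  qed
  have B: "\<bar>2 * B x - pair_sum coprime_ind coprime_ind x\<bar> \<le> sqrt x" if "x \<ge> 0" for x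
  proof -
    have "B x = real (card {n. real n \<le> x \<and> (\<exists>p q. (prime p \<and> coprime p d) \<and> (prime q \<and> coprime q d) \<and> n = p * q)})"
      unfolding B_def count_pq_def coprime_mult_left_iff
      by (intro arg_cong[where f = "\<lambda>S. real (card S)"]) blast
    then show ?thesis
      using count_products[of "\<lambda>n. prime n \<and> coprime n d", OF _ that] by (simp add: coprime_ind_def[abs_def])
  qed
  have lim: "((\<lambda>x. e * (A x / (1 / 4 * B x) - 1) * ln (ln x)) \<longlongrightarrow> (\<Sum>n. prime_char n / real n)) at_top"
    by (rule P.semiprime_ratio[OF e(2) indicator_eq[OF e(1)] A B])
  have L: "prime_sum \<chi> = of_real (\<Sum>n. prime_char n / real n)"
  proof -
    have "prime_sum \<chi> = (\<Sum>n. of_real (prime_char n / real n))"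
      unfolding prime_sum_def by (intro arg_cong[where f = suminf] ext) (simp add: prime_char_def of_real_c)
    then show ?thesis using suminf_of_real[OF P.summable_\<rho>, where ?'a = complex] by simp
  qed
  \<comment> \<open>The error term is found by solving the asserted equation for it; \<eta> is its
    own inverse, so multiplication by \<eta> undoes the factor in front.\<close>
  define E where "E x = complex_of_real (e * (A x / (1 / 4 * B x) - 1) * ln (ln x)) - prime_sum \<chi>" for x
  have "(E \<longlongrightarrow> of_real (\<Sum>n. prime_char n / real n) - prime_sum \<chi>) at_top"
    unfolding E_def by (intro tendsto_diff tendsto_of_real lim tendsto_const)
  then have E0: "(E \<longlongrightarrow> 0) at_top" by (simp add: L)
  have "eventually (\<lambda>x::real. ln (ln x) > 0) at_top" by real_asymp
  then have "\<forall>\<^sub>F x in at_top. complex_of_real (A x / (1 / 4 * B x)) =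
       1 + of_int \<eta> * ((prime_sum \<chi> + E x) / complex_of_real (ln (ln x)))"
  proof eventually_elim
    case (elim x)
    have "(prime_sum \<chi> + E x) / complex_of_real (ln (ln x)) = complex_of_real (e * (A x / (1 / 4 * B x) - 1))"
      using elim by (simp add: E_def)
    moreover have "complex_of_int \<eta> = of_real e" by (simp add: e_def)
    ultimately have "1 + of_int \<eta> * ((prime_sum \<chi> + E x) / complex_of_real (ln (ln x))) =
        complex_of_real (1 + e * (e * (A x / (1 / 4 * B x) - 1)))"
      by (simp only: of_real_add of_real_mult of_real_1)
    also have "e * (e * (A x / (1 / 4 * B x) - 1)) = A x / (1 / 4 * B x) - 1"
      using e(2) by (simp only: mult.assoc[symmetric] power2_eq_square) simp
    finally show ?case by simp
  qed
  with E0 show ?thesis unfolding A_def B_def by blast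
qed

end
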